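(* Let $X$ be an $n$-dimensional complex manifold with a finite group $G$ of holomorphic automorphisms, $X_H^i$ an orbit type stratum of $X$ of codimension $l\geq 1$, $W_x$ an $H$-invariant linear slice at a point $x\in X_H^i$, $W_{x,H}^i=W_x\cap X_H^i$, $N\to X_H^i$ the holomorphic normal bundle, and $\Sigma_0$ the image of the zero section of $N|_{W_{x,H}^i}$. Then there is an $H$-equivariant open embedding $\zeta:W_x\hookrightarrow N|_{W_{x,H}^i}$ with $\mathrm{Im}(\zeta|_{W_{x,H}^i})\subseteq\Sigma_0$ which induces an $H$-equivariant isomorphism of $\mathbb C$-ringed spaces $\widehat\zeta:\widehat W_x\to\widehat V_\epsilon$, where $\widehat W_x=(W_{x,H}^i,\mathcal O_{\widehat W_x})$ is the formal completion of $W_x$ along the analytic subset $W_{x,H}^i$ and $\widehat V_\epsilon=(\Sigma_0\cap V_\epsilon,\mathcal O_{\widehat V_\epsilon})$ is the formal completion of $V_\epsilon:=\zeta(W_x)$ along the analytic subset $\Sigma_0\cap V_\epsilon$.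
   Context: For a subgroup $H\le G$, $X_H=\{x\in X:\mathrm{Stab}(x)=H\}$; $X_H^i$ denotes a connected component of $X_H$ (orbit type stratum), a locally closed complex submanifold. For $x$ with $\mathrm{Stab}(x)=H$, an $H$-invariant linear slice $W_x$ is an $H$-invariant open neighbourhood of $x$ with $gW_x\cap W_x=\varnothing$ for all $g\in G\setminus H$ which is $H$-equivariantly biholomorphic to an $H$-invariant box in $\mathbb C^{n-l}\times\mathbb C^l$ with linear $H$-action (equivalently, embedded via such a chart as an open subset of $T_x^{(1,0)}X=T_x^{(1,0)}X_H^i\oplus N_x$), where $\mathbb C^{n-l}=(\mathbb C^n)^H$. The normal bundle $N$ is identified with the subbundle of $T^{(1,0)}X|_{X_H^i}$ whose fibre $N_x$ is the unique $H$-invariant complement of $(T_x^{(1,0)}X)^H=T^{(1,0)}_xX_H^i$; $H$ acts fibrewise on $N$. The formal completion of a complex manifold $M$ along an analytic subset $Y$ with ideal sheaf $\mathcal J$ is $(Y,\varprojlim_\nu\mathcal O_M/\mathcal J^{\nu+1})$. *)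

theory Defs
  imports "HOL-Analysis.Analysis" "HOL-Algebra.Algebra" "HOL-Algebra.Algebraic_Closure_Type"
begin

section \<open>Complex manifolds\<close>

text \<open>Complex differentiability at every point of \<open>S\<close>: the (two-sided, real) Frechet derivative
  exists and is complex linear.  The set \<open>S\<close> is open in every use below.\<close>

definition holo_fun_on :: "(complex^'n) set \<Rightarrow> (complex^'n \<Rightarrow> complex) \<Rightarrow> bool" where
  "holo_fun_on S f \<longleftrightarrow>
     (\<forall>z\<in>S. \<exists>D. (f has_derivative D) (at z) \<and> (\<forall>a v. D (a *s v) = a * D v))"

definition holo_vec_on :: "(complex^'n) set \<Rightarrow> (complex^'n \<Rightarrow> complex^'m) \<Rightarrow> bool" where
  "holo_vec_on S f \<longleftrightarrow> (\<forall>i. holo_fun_on S (\<lambda>z. f z $ i))"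

type_synonym ('a, 'n) chart = "'a set \<times> ('a \<Rightarrow> complex^'n)"

text \<open>A topology together with a (not necessarily maximal) atlas with values in \<open>complex^'n\<close>.
  The underlying set is the carrier of the topology.\<close>

record ('a, 'n::finite) cmfd =
  mtop :: "'a topology"
  atlas :: "('a, 'n) chart set"

abbreviation pts :: "('a, 'n::finite, 'z) cmfd_scheme \<Rightarrow> 'a set" where
  "pts M \<equiv> topspace (mtop M)"

definition top_chart :: "'a topology \<Rightarrow> ('a, 'n::finite) chart \<Rightarrow> bool" where
  "top_chart T c \<longleftrightarrow> openin T (fst c) \<and> open (snd c ` fst c) \<and>
     homeomorphic_map (subtopology T (fst c)) (top_of_set (snd c ` fst c)) (snd c)"

text \<open>The coordinate change from the chart \<open>c\<close> to the chart \<open>d\<close>.\<close>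

definition transition :: "('a, 'n::finite) chart \<Rightarrow> ('a, 'n) chart \<Rightarrow> complex^'n \<Rightarrow> complex^'n" where
  "transition c d = snd d \<circ> inv_into (fst c) (snd c)"

definition holo_compatible :: "('a, 'n::finite) chart \<Rightarrow> ('a, 'n) chart \<Rightarrow> bool" where
  "holo_compatible c d \<longleftrightarrow>
     holo_vec_on (snd c ` (fst c \<inter> fst d)) (transition c d) \<and>
     holo_vec_on (snd d ` (fst c \<inter> fst d)) (transition d c)"

definition complex_manifold :: "('a, 'n::finite) cmfd \<Rightarrow> bool" where
  "complex_manifold M \<longleftrightarrow>
     Hausdorff_space (mtop M) \<and> second_countable (mtop M) \<and>
     (\<forall>c\<in>atlas M. top_chart (mtop M) c) \<and>
     (\<Union>c\<in>atlas M. fst c) = pts M \<and>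
     (\<forall>c\<in>atlas M. \<forall>d\<in>atlas M. holo_compatible c d)"

text \<open>The charts of the maximal atlas, i.e. the holomorphic coordinate systems.\<close>

definition holo_chart :: "('a, 'n::finite) cmfd \<Rightarrow> ('a, 'n) chart \<Rightarrow> bool" where
  "holo_chart M c \<longleftrightarrow> top_chart (mtop M) c \<and> (\<forall>d\<in>atlas M. holo_compatible c d)"

definition open_submfd :: "('a, 'n::finite) cmfd \<Rightarrow> 'a set \<Rightarrow> ('a, 'n) cmfd" where
  "open_submfd M U = \<lparr>mtop = subtopology (mtop M) U,
                      atlas = (\<lambda>c. (fst c \<inter> U, snd c)) ` atlas M\<rparr>"

definition holo_on_mfd :: "('a, 'n::finite) cmfd \<Rightarrow> 'a set \<Rightarrow> ('a \<Rightarrow> complex) \<Rightarrow> bool" where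
  "holo_on_mfd M U f \<longleftrightarrow>
     (\<forall>c\<in>atlas M. holo_fun_on (snd c ` (U \<inter> fst c)) (f \<circ> inv_into (fst c) (snd c)))"

definition holo_map :: "('a, 'n::finite) cmfd \<Rightarrow> ('b, 'm::finite) cmfd \<Rightarrow> ('a \<Rightarrow> 'b) \<Rightarrow> bool" where
  "holo_map M M' F \<longleftrightarrow> continuous_map (mtop M) (mtop M') F \<and>
     (\<forall>c\<in>atlas M. \<forall>d\<in>atlas M'.
        holo_vec_on (snd c ` {p\<in>fst c. F p \<in> fst d}) (snd d \<circ> F \<circ> inv_into (fst c) (snd c)))"

definition biholomorphic :: "('a, 'n::finite) cmfd \<Rightarrow> ('b, 'm::finite) cmfd \<Rightarrow> ('a \<Rightarrow> 'b) \<Rightarrow> bool" where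
  "biholomorphic M M' F \<longleftrightarrow> complex_manifold M \<and> complex_manifold M' \<and>
     bij_betw F (pts M) (pts M') \<and> holo_map M M' F \<and> holo_map M' M (inv_into (pts M) F)"

definition holo_open_embedding ::
    "('a, 'n::finite) cmfd \<Rightarrow> ('b, 'm::finite) cmfd \<Rightarrow> ('a \<Rightarrow> 'b) \<Rightarrow> bool" where
  "holo_open_embedding M M' F \<longleftrightarrow> complex_manifold M' \<and> openin (mtop M') (F ` pts M) \<and>
     biholomorphic M (open_submfd M' (F ` pts M)) F"

definition analytic_subset :: "('a, 'n::finite) cmfd \<Rightarrow> 'a set \<Rightarrow> bool" where
  "analytic_subset M Y \<longleftrightarrow> Y \<subseteq> pts M \<and>
     (\<forall>p\<in>pts M. \<exists>U fs. openin (mtop M) U \<and> p \<in> U \<and> finite fs \<and> (\<forall>f\<in>fs. holo_on_mfd M U f) \<and>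
        Y \<inter> U = {q\<in>U. \<forall>f\<in>fs. f q = 0})"

text \<open>\<open>c\<close> is a coordinate system of \<open>M\<close> in which \<open>S\<close> is the complex linear subspace \<open>L\<close>.\<close>

definition adapted_chart ::
    "('a, 'n::finite) cmfd \<Rightarrow> 'a set \<Rightarrow> ('a, 'n) chart \<Rightarrow> (complex^'n) set \<Rightarrow> bool" where
  "adapted_chart M S c L \<longleftrightarrow> holo_chart M c \<and> vec.subspace L \<and>
     snd c ` (fst c \<inter> S) = snd c ` fst c \<inter> L"

definition submanifold_of_codim :: "('a, 'n::finite) cmfd \<Rightarrow> 'a set \<Rightarrow> nat \<Rightarrow> bool" where
  "submanifold_of_codim M S l \<longleftrightarrow> S \<subseteq> pts M \<and>
     (\<forall>p\<in>S. \<exists>c L. adapted_chart M S c L \<and> p \<in> fst c \<and> vec.dim L + l = CARD('n))"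

text \<open>The manifold structure induced on a submanifold \<open>S\<close> of dimension \<open>CARD('k)\<close>: the charts are
  the restrictions to \<open>S\<close> of the adapted charts, followed by a linear isomorphism \<open>r\<close> of the model
  subspace with \<open>complex^'k\<close>.\<close>

definition submfd :: "('a, 'n::finite) cmfd \<Rightarrow> 'a set \<Rightarrow> ('a, 'k::finite) cmfd" where
  "submfd M S = \<lparr>mtop = subtopology (mtop M) S,
     atlas = {(fst c \<inter> S, r \<circ> snd c) | c L r. adapted_chart M S c L \<and>
        Vector_Spaces.linear (*s) (*s) r \<and> bij_betw r L (UNIV :: (complex^'k) set)}\<rparr>"


section \<open>The holomorphic tangent bundle\<close>

text \<open>A holomorphic tangent vector at \<open>p\<close> is a family of component vectors, one for each chart
  \<open>c\<close> of the atlas around \<open>p\<close> (the coefficients with respect to \<open>\<partial>/\<partial>z\<^sub>i\<close> in that chart), which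
  transforms by the complex Jacobians of the coordinate changes.  By convention the components at
  all other \<open>c\<close> are 0, so that the vector space operations are the pointwise ones.\<close>

type_synonym ('a, 'n) tvec = "('a, 'n) chart \<Rightarrow> complex^'n"

definition charts_at :: "('a, 'n::finite) cmfd \<Rightarrow> 'a \<Rightarrow> ('a, 'n) chart set" where
  "charts_at M p = {c\<in>atlas M. p \<in> fst c}"

definition tangent_space :: "('a, 'n::finite) cmfd \<Rightarrow> 'a \<Rightarrow> ('a, 'n) tvec set" where
  "tangent_space M p = {v. (\<forall>c. c \<notin> charts_at M p \<longrightarrow> v c = 0) \<and>
     (\<forall>c\<in>charts_at M p. \<forall>d\<in>charts_at M p.
        v d = frechet_derivative (transition c d) (at (snd c p)) (v c))}"

definition tvec_add :: "('a, 'n::finite) tvec \<Rightarrow> ('a, 'n) tvec \<Rightarrow> ('a, 'n) tvec" where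
  "tvec_add v w = (\<lambda>c. v c + w c)"

definition tvec_scale :: "complex \<Rightarrow> ('a, 'n::finite) tvec \<Rightarrow> ('a, 'n) tvec" where
  "tvec_scale a v = (\<lambda>c. a *s v c)"

definition tvec_zero :: "('a, 'n::finite) tvec" where
  "tvec_zero = (\<lambda>c. 0)"

text \<open>The differential at \<open>p\<close> of a holomorphic map of \<open>M\<close> to itself; its components do not depend
  on the choice of the chart \<open>c\<close> at \<open>p\<close>.\<close>

definition tangent_map :: "('a, 'n::finite) cmfd \<Rightarrow> ('a \<Rightarrow> 'a) \<Rightarrow> 'a \<Rightarrow> ('a, 'n) tvec \<Rightarrow> ('a, 'n) tvec" where
  "tangent_map M F p v = (\<lambda>d. if d \<in> charts_at M (F p)
     then let c = (SOME c. c \<in> charts_at M p)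
          in frechet_derivative (snd d \<circ> F \<circ> inv_into (fst c) (snd c)) (at (snd c p)) (v c)
     else 0)"

definition tangent_total :: "('a, 'n::finite) cmfd \<Rightarrow> ('a \<times> ('a, 'n) tvec) set" where
  "tangent_total M = Sigma (pts M) (tangent_space M)"

definition tangent_chart ::
    "('a, 'n::finite) cmfd \<Rightarrow> ('a, 'n) chart \<Rightarrow> ('a \<times> ('a, 'n) tvec, 'n + 'n) chart" where
  "tangent_chart M c = ({(p, v)\<in>tangent_total M. p \<in> fst c},
     \<lambda>(p, v). \<chi> k. case k of Inl i \<Rightarrow> snd c p $ i | Inr i \<Rightarrow> v c $ i)"

definition tangent_bundle :: "('a, 'n::finite) cmfd \<Rightarrow> ('a \<times> ('a, 'n) tvec, 'n + 'n) cmfd" where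
  "tangent_bundle M = \<lparr>mtop = topology_generated_by
       {{q\<in>fst (tangent_chart M c). snd (tangent_chart M c) q \<in> B} | c B. c \<in> atlas M \<and> open B},
     atlas = tangent_chart M ` atlas M\<rparr>"


section \<open>Orbit type strata, slices and normal bundles\<close>

text \<open>Groups of automorphisms are sets of maps, closed under composition and inverses; formally
  they are subgroups of the HOL-Algebra group \<open>BijGroup\<close> of all bijections of the manifold.\<close>

definition subgrp :: "('a, 'n::finite) cmfd \<Rightarrow> ('a \<Rightarrow> 'a) set \<Rightarrow> ('a \<Rightarrow> 'a) monoid" where
  "subgrp M K = BijGroup (pts M)\<lparr>carrier := K\<rparr>"

definition holo_automorphism_group :: "('a, 'n::finite) cmfd \<Rightarrow> ('a \<Rightarrow> 'a) set \<Rightarrow> bool" where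
  "holo_automorphism_group M G \<longleftrightarrow>
     subgroup G (BijGroup (pts M)) \<and> (\<forall>g\<in>G. biholomorphic M M g)"

definition Stab :: "('a \<Rightarrow> 'a) set \<Rightarrow> 'a \<Rightarrow> ('a \<Rightarrow> 'a) set" where
  "Stab G x = {g\<in>G. g x = x}"

definition orbit_type :: "('a, 'n::finite) cmfd \<Rightarrow> ('a \<Rightarrow> 'a) set \<Rightarrow> ('a \<Rightarrow> 'a) set \<Rightarrow> 'a set" where
  "orbit_type M G H = {x\<in>pts M. Stab G x = H}"

definition orbit_type_strata ::
    "('a, 'n::finite) cmfd \<Rightarrow> ('a \<Rightarrow> 'a) set \<Rightarrow> ('a \<Rightarrow> 'a) set \<Rightarrow> 'a set set" where
  "orbit_type_strata M G H = connected_components_of (subtopology (mtop M) (orbit_type M G H))"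

definition coord_subspace :: "'n::finite set \<Rightarrow> (complex^'n) set" where
  "coord_subspace J = {z. \<forall>i. i \<notin> J \<longrightarrow> z $ i = 0}"

text \<open>A box in the product of the coordinate subspaces of \<open>- I\<close> and of \<open>I\<close> is a product
  of connected, relatively open subsets of the two factors.\<close>

definition product_box :: "'n::finite set \<Rightarrow> (complex^'n) set \<Rightarrow> bool" where
  "product_box I B \<longleftrightarrow> (\<exists>D E.
     openin (top_of_set (coord_subspace (- I))) D \<and> connected D \<and>
     openin (top_of_set (coord_subspace I)) E \<and> connected E \<and>
     B = {a + b | a b. a \<in> D \<and> b \<in> E})"

text \<open>The model is \<open>complex^'n\<close>, written as the product of the coordinate subspace of \<open>- I\<close>, which
  is the fixed space of the linear action \<open>\<rho>\<close> of \<open>H\<close>, and the \<open>H\<close>-invariant coordinate subspace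
  of \<open>I\<close>, which has dimension \<open>l\<close>.  That \<open>\<Phi>\<close> maps \<open>W\<close> biholomorphically to an open set of the
  model says precisely that \<open>(W, \<Phi>)\<close> is a chart of the maximal atlas.\<close>

definition linear_slice ::
    "('a, 'n::finite) cmfd \<Rightarrow> ('a \<Rightarrow> 'a) set \<Rightarrow> ('a \<Rightarrow> 'a) set \<Rightarrow> nat \<Rightarrow> 'a \<Rightarrow> 'a set \<Rightarrow> bool" where
  "linear_slice M G H l x W \<longleftrightarrow>
     openin (mtop M) W \<and> x \<in> W \<and> (\<forall>h\<in>H. h ` W = W) \<and> (\<forall>g\<in>G - H. g ` W \<inter> W = {}) \<and>
     (\<exists>\<Phi> \<rho> I.
        card I = l \<and>
        group_action (subgrp M H) UNIV \<rho> \<and> (\<forall>h\<in>H. Vector_Spaces.linear (*s) (*s) (\<rho> h)) \<and>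
        {z. \<forall>h\<in>H. \<rho> h z = z} = coord_subspace (- I) \<and>
        (\<forall>h\<in>H. \<rho> h ` coord_subspace I = coord_subspace I) \<and>
        holo_chart M (W, \<Phi>) \<and>
        product_box I (\<Phi> ` W) \<and> (\<forall>h\<in>H. \<rho> h ` \<Phi> ` W = \<Phi> ` W) \<and>
        (\<forall>h\<in>H. \<forall>w\<in>W. \<Phi> (h w) = \<rho> h (\<Phi> w)))"

definition fixed_tangent :: "('a, 'n::finite) cmfd \<Rightarrow> ('a \<Rightarrow> 'a) set \<Rightarrow> 'a \<Rightarrow> ('a, 'n) tvec set" where
  "fixed_tangent M H p = {v\<in>tangent_space M p. \<forall>h\<in>H. tangent_map M h p v = v}"

definition tangent_csubspace :: "('a, 'n::finite) cmfd \<Rightarrow> 'a \<Rightarrow> ('a, 'n) tvec set \<Rightarrow> bool" where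
  "tangent_csubspace M p K \<longleftrightarrow> K \<subseteq> tangent_space M p \<and> tvec_zero \<in> K \<and>
     (\<forall>v\<in>K. \<forall>w\<in>K. tvec_add v w \<in> K) \<and> (\<forall>a. \<forall>v\<in>K. tvec_scale a v \<in> K)"

definition invariant_complement ::
    "('a, 'n::finite) cmfd \<Rightarrow> ('a \<Rightarrow> 'a) set \<Rightarrow> 'a \<Rightarrow> ('a, 'n) tvec set \<Rightarrow> bool" where
  "invariant_complement M H p K \<longleftrightarrow> tangent_csubspace M p K \<and>
     (\<forall>h\<in>H. tangent_map M h p ` K \<subseteq> K) \<and>
     (\<forall>v\<in>tangent_space M p. \<exists>!(a, b). a \<in> fixed_tangent M H p \<and> b \<in> K \<and> v = tvec_add a b)"

definition normal_space :: "('a, 'n::finite) cmfd \<Rightarrow> ('a \<Rightarrow> 'a) set \<Rightarrow> 'a \<Rightarrow> ('a, 'n) tvec set" where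
  "normal_space M H p = (THE K. invariant_complement M H p K)"

text \<open>The normal bundle of a stratum \<open>C\<close> with isotropy group \<open>H\<close>, as a complex submanifold of the
  tangent bundle.  Its total space has dimension \<open>(n - l) + l = n\<close>, hence charts in
  \<open>complex^'n\<close>.\<close>

definition normal_bundle ::
    "('a, 'n::finite) cmfd \<Rightarrow> ('a \<Rightarrow> 'a) set \<Rightarrow> 'a set \<Rightarrow> ('a \<times> ('a, 'n) tvec, 'n) cmfd" where
  "normal_bundle M H C = submfd (tangent_bundle M) (Sigma C (normal_space M H))"

definition bundle_restrict ::
    "('a \<times> 'v, 'm::finite) cmfd \<Rightarrow> 'a set \<Rightarrow> ('a \<times> 'v, 'm) cmfd" where
  "bundle_restrict E U = open_submfd E {q\<in>pts E. fst q \<in> U}"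

definition zero_section :: "'a set \<Rightarrow> ('a \<times> ('a, 'n::finite) tvec) set" where
  "zero_section U = U \<times> {tvec_zero}"

definition bundle_action ::
    "('a, 'n::finite) cmfd \<Rightarrow> ('a \<Rightarrow> 'a) \<Rightarrow> 'a \<times> ('a, 'n) tvec \<Rightarrow> 'a \<times> ('a, 'n) tvec" where
  "bundle_action M h = (\<lambda>(p, v). (h p, tangent_map M h p v))"


section \<open>Ringed spaces over the complex numbers\<close>

text \<open>\<open>rs_scal R U\<close> is the structure map from the complex numbers to the ring of sections over \<open>U\<close>.\<close>

record ('p, 's) cringed =
  rs_top :: "'p topology"
  rs_sec :: "'p set \<Rightarrow> 's ring"
  rs_res :: "'p set \<Rightarrow> 'p set \<Rightarrow> 's \<Rightarrow> 's"
  rs_scal :: "'p set \<Rightarrow> complex \<Rightarrow> 's"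

definition cringed_space :: "('p, 's) cringed \<Rightarrow> bool" where
  "cringed_space R \<longleftrightarrow>
     (\<forall>U. openin (rs_top R) U \<longrightarrow>
        cring (rs_sec R U) \<and> rs_scal R U \<in> ring_hom (ring_of_type_algebra :: complex ring) (rs_sec R U) \<and>
        (\<forall>s\<in>carrier (rs_sec R U). rs_res R U U s = s)) \<and>
     (\<forall>U V. openin (rs_top R) U \<and> openin (rs_top R) V \<and> V \<subseteq> U \<longrightarrow>
        rs_res R U V \<in> ring_hom (rs_sec R U) (rs_sec R V) \<and>
        (\<forall>a. rs_res R U V (rs_scal R U a) = rs_scal R V a)) \<and>
     (\<forall>U V Z. openin (rs_top R) U \<and> openin (rs_top R) V \<and> openin (rs_top R) Z \<and> Z \<subseteq> V \<and> V \<subseteq> U \<longrightarrow>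
        (\<forall>s\<in>carrier (rs_sec R U). rs_res R V Z (rs_res R U V s) = rs_res R U Z s)) \<and>
     (\<forall>\<U> s. (\<forall>U\<in>\<U>. openin (rs_top R) U \<and> s U \<in> carrier (rs_sec R U)) \<and>
        (\<forall>U\<in>\<U>. \<forall>V\<in>\<U>. rs_res R U (U \<inter> V) (s U) = rs_res R V (U \<inter> V) (s V)) \<longrightarrow>
        (\<exists>!t. t \<in> carrier (rs_sec R (\<Union>\<U>)) \<and> (\<forall>U\<in>\<U>. rs_res R (\<Union>\<U>) U t = s U)))"

text \<open>A morphism from \<open>R\<close> to \<open>S\<close> is a pair of a map of points and, for each open set \<open>U\<close> of \<open>S\<close>,
  a map from the sections of \<open>S\<close> over \<open>U\<close> to the sections of \<open>R\<close> over the preimage of \<open>U\<close>.\<close>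

type_synonym ('p, 's, 'q, 't) rs_map = "('p \<Rightarrow> 'q) \<times> ('q set \<Rightarrow> 't \<Rightarrow> 's)"

definition rs_preimage :: "('p, 's) cringed \<Rightarrow> ('p \<Rightarrow> 'q) \<Rightarrow> 'q set \<Rightarrow> 'p set" where
  "rs_preimage R f U = {p\<in>topspace (rs_top R). f p \<in> U}"

definition cringed_morphism ::
    "('p, 's) cringed \<Rightarrow> ('q, 't) cringed \<Rightarrow> ('p, 's, 'q, 't) rs_map \<Rightarrow> bool" where
  "cringed_morphism R S \<phi> \<longleftrightarrow> cringed_space R \<and> cringed_space S \<and>
     continuous_map (rs_top R) (rs_top S) (fst \<phi>) \<and>
     (\<forall>U. openin (rs_top S) U \<longrightarrow>
        snd \<phi> U \<in> ring_hom (rs_sec S U) (rs_sec R (rs_preimage R (fst \<phi>) U)) \<and>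
        (\<forall>a. snd \<phi> U (rs_scal S U a) = rs_scal R (rs_preimage R (fst \<phi>) U) a)) \<and>
     (\<forall>U V. openin (rs_top S) U \<and> openin (rs_top S) V \<and> V \<subseteq> U \<longrightarrow>
        (\<forall>s\<in>carrier (rs_sec S U). snd \<phi> V (rs_res S U V s) =
           rs_res R (rs_preimage R (fst \<phi>) U) (rs_preimage R (fst \<phi>) V) (snd \<phi> U s)))"

definition cringed_iso ::
    "('p, 's) cringed \<Rightarrow> ('q, 't) cringed \<Rightarrow> ('p, 's, 'q, 't) rs_map \<Rightarrow> bool" where
  "cringed_iso R S \<phi> \<longleftrightarrow> cringed_morphism R S \<phi> \<and>
     homeomorphic_map (rs_top R) (rs_top S) (fst \<phi>) \<and>
     (\<forall>U. openin (rs_top S) U \<longrightarrow>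
        snd \<phi> U \<in> ring_iso (rs_sec S U) (rs_sec R (rs_preimage R (fst \<phi>) U)))"

text \<open>The composite of \<open>\<phi>\<close> into \<open>S\<close> and \<open>\<psi>\<close> out of \<open>S\<close>.\<close>

definition rs_comp ::
    "('q, 't) cringed \<Rightarrow> ('q, 't, 'r, 'u) rs_map \<Rightarrow> ('p, 's, 'q, 't) rs_map \<Rightarrow>
     ('p, 's, 'r, 'u) rs_map" where
  "rs_comp S \<psi> \<phi> = (fst \<psi> \<circ> fst \<phi>, \<lambda>U. snd \<phi> (rs_preimage S (fst \<psi>) U) \<circ> snd \<psi> U)"

text \<open>Equality of morphisms, ignoring values outside the relevant domains.\<close>

definition rs_map_eq ::
    "('p, 's) cringed \<Rightarrow> ('q, 't) cringed \<Rightarrow> ('p, 's, 'q, 't) rs_map \<Rightarrow> ('p, 's, 'q, 't) rs_map \<Rightarrow> bool" where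
  "rs_map_eq R S \<phi> \<psi> \<longleftrightarrow> (\<forall>p\<in>topspace (rs_top R). fst \<phi> p = fst \<psi> p) \<and>
     (\<forall>U. openin (rs_top S) U \<longrightarrow> (\<forall>s\<in>carrier (rs_sec S U). snd \<phi> U s = snd \<psi> U s))"


section \<open>Formal completion along an analytic subset\<close>

text \<open>The ring of functions that are holomorphic near \<open>p\<close>.  Functions are total, with arbitrary
  values away from \<open>p\<close>; the stalk of the structure sheaf is the quotient by the ideal of functions
  vanishing near \<open>p\<close>.\<close>

definition near_ring :: "('a, 'n::finite) cmfd \<Rightarrow> 'a \<Rightarrow> ('a \<Rightarrow> complex) ring" where
  "near_ring M p = \<lparr>carrier = {f. \<exists>U. openin (mtop M) U \<and> p \<in> U \<and> holo_on_mfd M U f},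
     monoid.mult = (\<lambda>f g z. f z * g z), monoid.one = (\<lambda>z. 1),
     ring.zero = (\<lambda>z. 0), ring.add = (\<lambda>f g z. f z + g z)\<rparr>"

definition null_near :: "('a, 'n::finite) cmfd \<Rightarrow> 'a \<Rightarrow> ('a \<Rightarrow> complex) set" where
  "null_near M p = {f. \<exists>U. openin (mtop M) U \<and> p \<in> U \<and> (\<forall>z\<in>U. f z = 0)}"

type_synonym 'a germ = "('a \<Rightarrow> complex) set"

definition stalk :: "('a, 'n::finite) cmfd \<Rightarrow> 'a \<Rightarrow> 'a germ ring" where
  "stalk M p = near_ring M p Quot (carrier (near_ring M p) \<inter> null_near M p)"

definition germ_at :: "('a, 'n::finite) cmfd \<Rightarrow> 'a \<Rightarrow> ('a \<Rightarrow> complex) \<Rightarrow> 'a germ" where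
  "germ_at M p f = (carrier (near_ring M p) \<inter> null_near M p) +>\<^bsub>near_ring M p\<^esub> f"

text \<open>The stalk at \<open>p\<close> of the ideal sheaf of \<open>Y\<close>.\<close>

definition ideal_stalk :: "('a, 'n::finite) cmfd \<Rightarrow> 'a set \<Rightarrow> 'a \<Rightarrow> 'a germ set" where
  "ideal_stalk M Y p = {germ_at M p f | f. f \<in> carrier (near_ring M p) \<and>
     (\<exists>U. openin (mtop M) U \<and> p \<in> U \<and> (\<forall>z\<in>U \<inter> Y. f z = 0))}"

definition ideal_power :: "('r, 'z) ring_scheme \<Rightarrow> 'r set \<Rightarrow> nat \<Rightarrow> 'r set" where
  "ideal_power R J k = ((\<lambda>K. ideal_prod R J K) ^^ k) (carrier R)"

type_synonym 'a jet = "'a germ set"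

text \<open>The stalk at \<open>p\<close> of the quotient of the structure sheaf by the \<open>k\<close>-th power of the ideal
  sheaf of \<open>Y\<close>, and the class in it of a function holomorphic near \<open>p\<close>.\<close>

definition jet_ring :: "('a, 'n::finite) cmfd \<Rightarrow> 'a set \<Rightarrow> nat \<Rightarrow> 'a \<Rightarrow> 'a jet ring" where
  "jet_ring M Y k p = stalk M p Quot (ideal_power (stalk M p) (ideal_stalk M Y p) k)"

definition jet_at :: "('a, 'n::finite) cmfd \<Rightarrow> 'a set \<Rightarrow> nat \<Rightarrow> 'a \<Rightarrow> ('a \<Rightarrow> complex) \<Rightarrow> 'a jet" where
  "jet_at M Y k p f =
     ideal_power (stalk M p) (ideal_stalk M Y p) k +>\<^bsub>stalk M p\<^esub> germ_at M p f"

text \<open>Sections over \<open>U \<subseteq> Y\<close> of the quotient sheaf, restricted to its support \<open>Y\<close>: families of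
  elements of the stalks that are locally induced by one holomorphic function.\<close>

definition jet_sections ::
    "('a, 'n::finite) cmfd \<Rightarrow> 'a set \<Rightarrow> nat \<Rightarrow> 'a set \<Rightarrow> ('a \<Rightarrow> 'a jet) set" where
  "jet_sections M Y k U = {s\<in>extensional U. \<forall>p\<in>U. \<exists>V f. openin (mtop M) V \<and> p \<in> V \<and>
     holo_on_mfd M V f \<and> (\<forall>q\<in>V \<inter> U. s q = jet_at M Y k q f)}"

text \<open>A section of the inverse limit is a sequence, whose \<open>\<nu>\<close>-th member is a section of the quotient
  by the \<open>(\<nu> + 1)\<close>-st power.  The transition maps send a coset to the unique coset of the larger
  ideal that contains it, so compatibility means inclusion of cosets.\<close>

type_synonym 'a fsec = "nat \<Rightarrow> 'a \<Rightarrow> 'a jet"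

definition formal_sections :: "('a, 'n::finite) cmfd \<Rightarrow> 'a set \<Rightarrow> 'a set \<Rightarrow> 'a fsec ring" where
  "formal_sections M Y U = \<lparr>
     carrier = {S. (\<forall>\<nu>. S \<nu> \<in> jet_sections M Y (\<nu> + 1) U) \<and>
                   (\<forall>\<nu>. \<forall>p\<in>U. S (\<nu> + 1) p \<subseteq> S \<nu> p)},
     monoid.mult = (\<lambda>S T \<nu>. \<lambda>p\<in>U. S \<nu> p \<otimes>\<^bsub>jet_ring M Y (\<nu> + 1) p\<^esub> T \<nu> p),
     monoid.one = (\<lambda>\<nu>. \<lambda>p\<in>U. \<one>\<^bsub>jet_ring M Y (\<nu> + 1) p\<^esub>),
     ring.zero = (\<lambda>\<nu>. \<lambda>p\<in>U. \<zero>\<^bsub>jet_ring M Y (\<nu> + 1) p\<^esub>),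
     ring.add = (\<lambda>S T \<nu>. \<lambda>p\<in>U. S \<nu> p \<oplus>\<^bsub>jet_ring M Y (\<nu> + 1) p\<^esub> T \<nu> p)\<rparr>"

definition formal_completion :: "('a, 'n::finite) cmfd \<Rightarrow> 'a set \<Rightarrow> ('a, 'a fsec) cringed" where
  "formal_completion M Y = \<lparr>
     rs_top = subtopology (mtop M) Y,
     rs_sec = formal_sections M Y,
     rs_res = (\<lambda>U V S \<nu>. restrict (S \<nu>) V),
     rs_scal = (\<lambda>U a \<nu>. \<lambda>p\<in>U. jet_at M Y (\<nu> + 1) p (\<lambda>z. a))\<rparr>"

text \<open>The map of formal completions induced by a holomorphic map \<open>F\<close> from \<open>M\<close> to \<open>M'\<close> that maps
  \<open>Y\<close> into \<open>Y'\<close>: on points it is \<open>F\<close>, on sections it is the composition of representatives with \<open>F\<close>.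
  The functions representing a jet \<open>j\<close> are the elements of \<open>\<Union> j\<close>.\<close>

definition jet_pullback ::
    "('a, 'n::finite) cmfd \<Rightarrow> 'a set \<Rightarrow> ('a \<Rightarrow> 'b) \<Rightarrow> nat \<Rightarrow> 'a \<Rightarrow> 'b jet \<Rightarrow> 'a jet" where
  "jet_pullback M Y F k p j = the_elem ((\<lambda>f. jet_at M Y k p (f \<circ> F)) ` \<Union> j)"

definition completion_map ::
    "('a, 'n::finite) cmfd \<Rightarrow> 'a set \<Rightarrow> ('a \<Rightarrow> 'b) \<Rightarrow> ('a, 'a fsec, 'b, 'b fsec) rs_map" where
  "completion_map M Y F = (restrict F Y,
     \<lambda>U S \<nu>. \<lambda>p\<in>{p\<in>Y. F p \<in> U}. jet_pullback M Y F (\<nu> + 1) p (S \<nu> (F p)))"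

end

theory Submission
  imports Defs "HOL-Complex_Analysis.Complex_Analysis"
begin

text \<open>
  Let \<open>\<Phi>\<close> be the linear chart of the slice.  It maps \<open>W\<close> onto a box \<open>D + E\<close> in the direct sum of the fixed
  space of \<open>H\<close> and an invariant complement (the coordinate subspaces of \<open>- I\<close> and of \<open>I\<close>).  A point of \<open>W\<close>
  has stabiliser \<open>H\<close> exactly if \<open>\<Phi>\<close> maps it into the fixed space.  These points form the preimage of the
  connected set \<open>D\<close>, so all of them lie in the component \<open>C\<close>, and \<open>W \<inter> C\<close> is the set where the
  \<open>I\<close>-coordinates of \<open>\<Phi>\<close> vanish (\<open>linear_slice_imp_slice\<close>).

  At a point \<open>p\<close> of \<open>W \<inter> C\<close> the differential of \<open>\<Phi>\<close> identifies the tangent space with the model as a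
  representation of \<open>H\<close> (\<open>tangent_map_coords\<close>).  Averaging over \<open>H\<close> shows that the only invariant complement
  of the fixed vectors consists of the vectors with components in the coordinate subspace of \<open>I\<close>
  (\<open>normal_space_eq\<close>).  Hence \<open>\<Psi> (p, v) = \<Phi> p + d\<Phi>\<^sub>p v\<close> is one chart of the whole normal bundle over
  \<open>W \<inter> C\<close>, and its image contains that of \<open>\<Phi>\<close>.  The embedding is \<open>\<zeta> = \<Psi>\<inverse> \<circ> \<Phi>\<close>: it splits
  \<open>\<Phi> w = a + b\<close> into a base point with coordinates \<open>a\<close> and a normal vector with components \<open>b\<close>.  In the charts
  \<open>\<Phi>\<close> and \<open>\<Psi>\<close> it is the identity, and every \<open>h\<close> in \<open>H\<close> acts on both sides by the same linear map
  \<open>\<rho> h\<close>; so \<open>\<zeta>\<close> is a holomorphic embedding, equivariant, and maps \<open>W \<inter> C\<close> onto the zero section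
  inside \<open>\<zeta> ` W\<close>.

  Two points need real work.  That \<open>\<Psi>\<close> comes from a holomorphic chart of the tangent bundle means that the
  differential of a coordinate change depends holomorphically on base point and vector.  Since holomorphy only says
  that complex derivatives exist, this is derived from Cauchy's integral formula (\<open>holo_fun_on_derivative\<close>).

  The statement about formal completions is functoriality.  Composition with a holomorphic map of pairs respects the
  vanishing ideals, hence their powers (\<open>germ_pullback_jet_ideal\<close>), and so acts on jets and on formal sections.
  A biholomorphic map of pairs and its inverse thus induce mutually inverse maps (\<open>cringed_iso_completion_map\<close>),
  and \<open>\<zeta> \<circ> h = h \<circ> \<zeta>\<close> gives the equivariance of the induced map
  (\<open>completion_map_commuting_square\<close>).
\<close>


section \<open>Holomorphic functions of several variables\<close>

lemma scaleR_eq_of_real_smult: "c *\<^sub>R (v :: complex^'n) = (of_real c :: complex) *s v"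
  by (simp add: vec_eq_iff scaleR_conv_of_real[where 'a=complex])

lemma bounded_linear_clinear:
  fixes r :: "complex^'n \<Rightarrow> complex^'m"
  assumes "Vector_Spaces.linear (*s) (*s) r"
  shows "bounded_linear r"
proof -
  interpret r: Vector_Spaces.linear "(*s)" "(*s)" r by fact
  have "linear r"
    by (rule linearI) (simp_all add: r.add r.scale scaleR_eq_of_real_smult)
  then show ?thesis by (simp add: linear_conv_bounded_linear)
qed

lemma clinear_frechet:
  fixes D :: "complex^'n \<Rightarrow> complex^'m"
  assumes "bounded_linear D" "\<And>a v. D (a *s v) = a *s D v"
  shows "Vector_Spaces.linear (*s) (*s) D"
proof -
  interpret bounded_linear D by fact
  show ?thesis
    by (simp add: Vector_Spaces.linear_iff vec.vector_space_axioms assms add)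
qed

lemma holo_fun_on_frechet:
  assumes "holo_fun_on S f" "z \<in> S"
  shows "(f has_derivative frechet_derivative f (at z)) (at z)"
    and "frechet_derivative f (at z) (a *s v) = a * frechet_derivative f (at z) v"
proof -
  obtain D where D: "(f has_derivative D) (at z)" "\<And>a v. D (a *s v) = a * D v"
    using assms unfolding holo_fun_on_def by blast
  have "D = frechet_derivative f (at z)"
    by (rule frechet_derivative_at[OF D(1)])
  with D show "(f has_derivative frechet_derivative f (at z)) (at z)"
    "frechet_derivative f (at z) (a *s v) = a * frechet_derivative f (at z) v" by simp_all
qed

lemma has_derivative_vec_componentwise:
  fixes g :: "'a::real_normed_vector \<Rightarrow> complex^'m"
  shows "(g has_derivative D) (at z) \<longleftrightarrow>
     (\<forall>i. ((\<lambda>z. g z $ i) has_derivative (\<lambda>v. D v $ i)) (at z))" (is "?L \<longleftrightarrow> ?R")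
proof
  assume ?L
  then show ?R
    using bounded_linear.has_derivative[OF bounded_linear_vec_nth] by blast
next
  assume R: ?R
  have "((\<lambda>z. g z \<bullet> b) has_derivative (\<lambda>v. D v \<bullet> b)) (at z)" if b: "b \<in> Basis" for b
  proof -
    obtain i u where b: "b = axis i u" using b by (auto simp: Basis_vec_def)
    have "((\<lambda>z. (g z $ i) \<bullet> u) has_derivative (\<lambda>v. (D v $ i) \<bullet> u)) (at z)"
      by (rule bounded_linear.has_derivative[OF bounded_linear_inner_left]) (use R in blast)
    then show ?thesis by (simp add: b inner_axis)
  qed
  then show ?L using has_derivative_componentwise_within[of g D z UNIV] by blast
qed

lemma holo_vec_on_iff:
  "holo_vec_on S g \<longleftrightarrow>
     (\<forall>z\<in>S. \<exists>D. (g has_derivative D) (at z) \<and> (\<forall>a v. D (a *s v) = a *s D v))" (is "?L \<longleftrightarrow> ?R")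
proof
  assume L: ?L
  show ?R
  proof
    fix z assume z: "z \<in> S"
    let ?D = "\<lambda>v. \<chi> i. frechet_derivative (\<lambda>z. g z $ i) (at z) v"
    have h: "holo_fun_on S (\<lambda>z. g z $ i)" for i using L by (simp add: holo_vec_on_def)
    have "(g has_derivative ?D) (at z)"
      using holo_fun_on_frechet(1)[OF h z] by (simp add: has_derivative_vec_componentwise)
    moreover have "?D (a *s v) = a *s ?D v" for a v
      using holo_fun_on_frechet(2)[OF h z] by (simp add: vec_eq_iff)
    ultimately show "\<exists>D. (g has_derivative D) (at z) \<and> (\<forall>a v. D (a *s v) = a *s D v)" by blast
  qed
next
  assume R: ?R
  show ?L unfolding holo_vec_on_def holo_fun_on_def
  proof (intro allI ballI)
    fix i z assume "z \<in> S"
    then obtain D where D: "(g has_derivative D) (at z)" "\<And>a v. D (a *s v) = a *s D v" using R by blast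
    then have "((\<lambda>z. g z $ i) has_derivative (\<lambda>v. D v $ i)) (at z)"
      using has_derivative_vec_componentwise[of g D z] by simp
    then show "\<exists>D. ((\<lambda>z. g z $ i) has_derivative D) (at z) \<and> (\<forall>a v. D (a *s v) = a * D v)"
      using D(2) by (intro exI[of _ "\<lambda>v. D v $ i"]) simp
  qed
qed

lemma holo_vec_on_frechet:
  fixes g :: "complex^'n \<Rightarrow> complex^'m"
  assumes "holo_vec_on S g" "z \<in> S"
  shows "(g has_derivative frechet_derivative g (at z)) (at z)"
    and "Vector_Spaces.linear (*s) (*s) (frechet_derivative g (at z))"
proof -
  obtain D where D: "(g has_derivative D) (at z)" "\<And>a v. D (a *s v) = a *s D v"
    using assms unfolding holo_vec_on_iff by blast
  have *: "D = frechet_derivative g (at z)"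
    by (rule frechet_derivative_at[OF D(1)])
  show "(g has_derivative frechet_derivative g (at z)) (at z)" using D * by simp
  show "Vector_Spaces.linear (*s) (*s) (frechet_derivative g (at z))"
    unfolding *[symmetric] by (rule clinear_frechet[OF has_derivative_bounded_linear[OF D(1)] D(2)])
qed

lemma holo_fun_on_cong_open:
  assumes "holo_fun_on S f" "open T" "T \<subseteq> S" "\<And>z. z \<in> T \<Longrightarrow> f z = g z"
  shows "holo_fun_on T g"
  unfolding holo_fun_on_def
proof
  fix z assume z: "z \<in> T"
  then obtain D where "(f has_derivative D) (at z)" "\<forall>a v. D (a *s v) = a * D v"
    using assms(1,3) unfolding holo_fun_on_def by blast
  moreover from this(1) have "(g has_derivative D) (at z)"
    by (rule has_derivative_transform_within_open[OF _ assms(2) z]) (rule assms(4))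
  ultimately show "\<exists>D. (g has_derivative D) (at z) \<and> (\<forall>a v. D (a *s v) = a * D v)"
    by blast
qed

lemma holo_vec_on_cong_open:
  assumes "holo_vec_on S f" "open T" "T \<subseteq> S" "\<And>z. z \<in> T \<Longrightarrow> f z = g z"
  shows "holo_vec_on T g"
  using assms holo_fun_on_cong_open[of S _ T] unfolding holo_vec_on_def
  by (metis (no_types, lifting))

lemma holo_fun_on_subset: "holo_fun_on S f \<Longrightarrow> T \<subseteq> S \<Longrightarrow> holo_fun_on T f"
  unfolding holo_fun_on_def by blast

lemma holo_vec_on_subset: "holo_vec_on S f \<Longrightarrow> T \<subseteq> S \<Longrightarrow> holo_vec_on T f"
  unfolding holo_vec_on_def using holo_fun_on_subset by blast

lemma holo_vec_on_local:
  "(\<And>z. z \<in> S \<Longrightarrow> \<exists>T. z \<in> T \<and> holo_vec_on T f) \<Longrightarrow> holo_vec_on S f"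
  unfolding holo_vec_on_iff by blast

lemma holo_fun_on_local:
  "(\<And>z. z \<in> S \<Longrightarrow> \<exists>T. z \<in> T \<and> holo_fun_on T f) \<Longrightarrow> holo_fun_on S f"
  unfolding holo_fun_on_def by blast

lemma holo_fun_on_const: "holo_fun_on S (\<lambda>z. a)"
  unfolding holo_fun_on_def by (auto intro!: exI[of _ "\<lambda>v. 0"])

lemma holo_fun_on_add:
  assumes "holo_fun_on S f" "holo_fun_on S g" shows "holo_fun_on S (\<lambda>z. f z + g z)"
  unfolding holo_fun_on_def
proof
  fix z assume "z \<in> S"
  then obtain D E where "(f has_derivative D) (at z)" "\<forall>a v. D (a *s v) = a * D v"
    "(g has_derivative E) (at z)" "\<forall>a v. E (a *s v) = a * E v"
    using assms unfolding holo_fun_on_def by metis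
  then show "\<exists>D. ((\<lambda>z. f z + g z) has_derivative D) (at z) \<and> (\<forall>a v. D (a *s v) = a * D v)"
    by (intro exI[of _ "\<lambda>v. D v + E v"]) (simp add: has_derivative_add algebra_simps)
qed

lemma holo_fun_on_mult:
  assumes "holo_fun_on S f" "holo_fun_on S g" shows "holo_fun_on S (\<lambda>z. f z * g z)"
  unfolding holo_fun_on_def
proof
  fix z assume "z \<in> S"
  then obtain D E where "(f has_derivative D) (at z)" "\<forall>a v. D (a *s v) = a * D v"
    "(g has_derivative E) (at z)" "\<forall>a v. E (a *s v) = a * E v"
    using assms unfolding holo_fun_on_def by metis
  then show "\<exists>D. ((\<lambda>z. f z * g z) has_derivative D) (at z) \<and> (\<forall>a v. D (a *s v) = a * D v)"
    by (intro exI[of _ "\<lambda>v. f z * E v + D v * g z"])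
       (simp add: has_derivative_mult[where 'a=complex] distrib_left mult.left_commute mult.assoc)
qed

lemma holo_vec_on_clinear:
  fixes r :: "complex^'n \<Rightarrow> complex^'m"
  assumes "Vector_Spaces.linear (*s) (*s) r" shows "holo_vec_on S r"
  unfolding holo_vec_on_iff
  using bounded_linear_imp_has_derivative[OF bounded_linear_clinear[OF assms]]
    vec.linear_scale[OF assms] by blast

lemma holo_vec_on_compose:
  assumes "holo_vec_on S g" "holo_vec_on T f" "\<And>z. z \<in> S \<Longrightarrow> g z \<in> T"
  shows "holo_vec_on S (\<lambda>z. f (g z))"
  unfolding holo_vec_on_iff
proof
  fix z assume z: "z \<in> S"
  then obtain D where D: "(g has_derivative D) (at z)" "\<forall>a v. D (a *s v) = a *s D v"
    using assms(1) unfolding holo_vec_on_iff by blast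
  obtain E where E: "(f has_derivative E) (at (g z))" "\<forall>a v. E (a *s v) = a *s E v"
    using assms(2,3) z unfolding holo_vec_on_iff by blast
  show "\<exists>D. ((\<lambda>z. f (g z)) has_derivative D) (at z) \<and> (\<forall>a v. D (a *s v) = a *s D v)"
    using has_derivative_compose[OF D(1) E(1)] D(2) E(2) by (intro exI[of _ "\<lambda>v. E (D v)"]) simp
qed

lemma holo_fun_on_compose:
  assumes "holo_vec_on S g" "holo_fun_on T f" "\<And>z. z \<in> S \<Longrightarrow> g z \<in> T"
  shows "holo_fun_on S (\<lambda>z. f (g z))"
proof -
  have "holo_vec_on T (\<lambda>z. (\<chi> i. f z) :: complex^1)" using assms(2) by (simp add: holo_vec_on_def)
  from holo_vec_on_compose[OF assms(1) this assms(3)] show ?thesis by (simp add: holo_vec_on_def)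
qed

lemma holo_vec_on_imp_continuous_on: "holo_vec_on S g \<Longrightarrow> continuous_on S g"
  unfolding holo_vec_on_iff
  by (meson continuous_at_imp_continuous_on has_derivative_continuous)

lemma holo_fun_on_imp_continuous_on: "holo_fun_on S g \<Longrightarrow> continuous_on S g"
  unfolding holo_fun_on_def
  by (meson continuous_at_imp_continuous_on has_derivative_continuous)

definition left_half :: "complex^('n+'n) \<Rightarrow> complex^'n" where
  "left_half y = (\<chi> i. y $ Inl i)"

definition right_half :: "complex^('n+'n) \<Rightarrow> complex^'n" where
  "right_half y = (\<chi> i. y $ Inr i)"

definition join_halves :: "complex^'n \<Rightarrow> complex^'n \<Rightarrow> complex^('n+'n)" where
  "join_halves a b = (\<chi> k. case k of Inl i \<Rightarrow> a $ i | Inr i \<Rightarrow> b $ i)"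

lemma halves_join [simp]: "left_half (join_halves a b) = a" "right_half (join_halves a b) = b"
  by (simp_all add: left_half_def right_half_def join_halves_def vec_eq_iff)

lemma join_halves_halves [simp]: "join_halves (left_half y) (right_half y) = y"
  by (simp add: left_half_def right_half_def join_halves_def vec_eq_iff split: sum.splits)

lemma clinear_left_half: "Vector_Spaces.linear (*s) (*s) left_half"
  and clinear_right_half: "Vector_Spaces.linear (*s) (*s) right_half"
  by (auto simp: Vector_Spaces.linear_iff vec.vector_space_axioms left_half_def right_half_def vec_eq_iff)

lemma continuous_on_join_halves [continuous_intros]:
  assumes "continuous_on S f" "continuous_on S g"
  shows "continuous_on S (\<lambda>z. join_halves (f z) (g z))"
  unfolding join_halves_def
proof (rule continuous_on_vec_lambda)
  fix k show "continuous_on S (\<lambda>z. case k of Inl i \<Rightarrow> f z $ i | Inr i \<Rightarrow> g z $ i)"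
    by (cases k) (auto intro!: continuous_intros assms)
qed

lemma continuous_on_left_half [continuous_intros]:
  "continuous_on S f \<Longrightarrow> continuous_on S (\<lambda>z. left_half (f z))"
  and continuous_on_right_half [continuous_intros]:
  "continuous_on S f \<Longrightarrow> continuous_on S (\<lambda>z. right_half (f z))"
  unfolding left_half_def right_half_def by (auto intro!: continuous_intros)

lemma continuous_on_smult [continuous_intros]:
  fixes g :: "'a::topological_space \<Rightarrow> complex^'n"
  assumes "continuous_on S f" "continuous_on S g"
  shows "continuous_on S (\<lambda>z. f z *s g z)"
  unfolding vector_scalar_mult_def by (intro continuous_intros assms)

lemma bounded_linear_smult_left: "bounded_linear (\<lambda>u. u *s (v::complex^'n))"
proof -
  have "linear (\<lambda>u. u *s (v::complex^'n))"
    by (rule linearI) (simp_all add: vec_eq_iff algebra_simps)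
  then show ?thesis by (simp add: linear_conv_bounded_linear)
qed

text \<open>This is Cauchy's formula for the first derivative of \<open>u \<mapsto> f (z + u v)\<close> at \<open>0\<close>, with the circle of radius \<open>r\<close>
  parametrised by \<open>[0, 1]\<close>.  It expresses the differential of \<open>f\<close> by values of \<open>f\<close>, which is what gives access
  to its regularity in \<open>z\<close> and \<open>v\<close>.\<close>

lemma Cauchy_directional_derivative:
  fixes f :: "complex^'n \<Rightarrow> complex"
  assumes S: "open S" and f: "holo_fun_on S f" and r: "r > 0"
    and disc: "\<And>u. norm u \<le> r \<Longrightarrow> z + u *s v \<in> S"
  shows "frechet_derivative f (at z) v =
     integral {0..1} (\<lambda>t. f (z + (of_real r * exp (2 * of_real pi * \<i> * of_real t)) *s v)
       / (of_real r * exp (2 * of_real pi * \<i> * of_real t)))"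
proof -
  let ?g = "\<lambda>u. f (z + u *s v)"
  have der: "(?g has_field_derivative frechet_derivative f (at (z + u *s v)) v) (at u)"
    if u: "norm u \<le> r" for u
  proof -
    have 1: "((\<lambda>u. z + u *s v) has_derivative (\<lambda>h. h *s v)) (at u)"
      using has_derivative_add[OF has_derivative_const[of z]
          bounded_linear_imp_has_derivative[OF bounded_linear_smult_left[of v]]] by simp
    have "(?g has_derivative (\<lambda>h. frechet_derivative f (at (z + u *s v)) (h *s v))) (at u)"
      by (rule has_derivative_compose[OF 1 holo_fun_on_frechet(1)[OF f disc[OF u]]])
    moreover have "(\<lambda>h. h * c) = (*) c" for c :: complex
      by (simp add: fun_eq_iff mult.commute)
    ultimately show ?thesis
      unfolding has_field_derivative_def holo_fun_on_frechet(2)[OF f disc[OF u]] by simp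
  qed
  have cont: "continuous_on (cball 0 r) ?g"
    by (rule continuous_at_imp_continuous_on) (use der DERIV_isCont in fastforce)
  have hol: "?g holomorphic_on ball 0 r"
    unfolding holomorphic_on_def field_differentiable_def
    by (metis der has_field_derivative_at_within less_imp_le mem_ball_0)
  have "((\<lambda>u. ?g u / (u - 0) ^ Suc 1) has_contour_integral
       (2 * pi * \<i>) / fact 1 * (deriv ^^ 1) ?g 0) (circlepath 0 r)"
    by (rule Cauchy_has_contour_integral_higher_derivative_circlepath[OF cont hol]) (use r in simp)
  moreover have "(deriv ^^ 1) ?g 0 = frechet_derivative f (at z) v"
    using DERIV_imp_deriv[OF der[of 0]] r by simp
  ultimately have "((\<lambda>u. ?g u / u\<^sup>2) has_contour_integral
       (2 * pi * \<i>) * frechet_derivative f (at z) v) (circlepath 0 r)"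
    by (simp add: power2_eq_square)
  then have I: "((\<lambda>t. ?g (circlepath 0 r t) / (circlepath 0 r t)\<^sup>2 *
       (2 * pi * \<i> * r * exp (2 * of_real pi * \<i> * t)))
     has_integral (2 * pi * \<i>) * frechet_derivative f (at z) v) {0..1}"
    unfolding has_contour_integral_def
    by (subst (asm) has_integral_cong[OF ])
       (auto simp: vector_derivative_circlepath01 mult_ac)
  then have "((\<lambda>t. (?g (circlepath 0 r t) / (circlepath 0 r t)\<^sup>2 *
       (2 * pi * \<i> * r * exp (2 * of_real pi * \<i> * t))) / (2 * pi * \<i>))
     has_integral ((2 * pi * \<i>) * frechet_derivative f (at z) v) / (2 * pi * \<i>)) {0..1}"
    by (rule has_integral_divide)
  moreover have "(?g (circlepath 0 r t) / (circlepath 0 r t)\<^sup>2 *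
       (2 * pi * \<i> * r * exp (2 * of_real pi * \<i> * t))) / (2 * pi * \<i>)
     = ?g (of_real r * exp (2 * of_real pi * \<i> * of_real t)) /
        (of_real r * exp (2 * of_real pi * \<i> * of_real t))" for t
    using r by (simp add: circlepath power2_eq_square divide_simps)
  ultimately show ?thesis
    by (simp add: integral_unique)
qed

text \<open>One radius serves all base points and directions near a given pair, so that Cauchy's formula holds there with
  a fixed circle.\<close>

lemma uniform_directional_disc:
  fixes S :: "(complex^'n) set"
  assumes "open S" "left_half y0 \<in> S"
  obtains r e where "r > 0" "e > 0"
    "\<And>y u. y \<in> ball y0 e \<Longrightarrow> norm u \<le> r \<Longrightarrow> left_half y + u *s right_half y \<in> S"
proof -
  define P where "P = (\<lambda>p::(complex^('n+'n)) \<times> complex. left_half (fst p) + snd p *s right_half (fst p)) -` S"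
  have "open P"
    unfolding P_def by (intro open_vimage assms continuous_intros)
  moreover have "(y0, 0) \<in> P" using assms(2) by (simp add: P_def)
  ultimately obtain A B where AB: "open A" "open B" "(y0, 0) \<in> A \<times> B" "A \<times> B \<subseteq> P"
    by (rule open_prod_elim)
  obtain e where e: "e > 0" "ball y0 e \<subseteq> A" using AB by (auto simp: open_contains_ball)
  obtain r where r: "r > 0" "cball 0 r \<subseteq> B" using AB by (auto simp: open_contains_cball)
  show ?thesis
  proof (rule that[OF r(1) e(1)])
    fix y and u :: complex assume "y \<in> ball y0 e" "norm u \<le> r"
    then have "(y, u) \<in> P" using e r AB(4) by (auto simp: subset_iff)
    then show "left_half y + u *s right_half y \<in> S" by (simp add: P_def)
  qed
qed

text \<open>The integral in Cauchy's formula depends continuously on the parameters because its integrand does.\<close>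

lemma continuous_on_holo_derivative:
  fixes f :: "complex^'n \<Rightarrow> complex"
  assumes S: "open S" and f: "holo_fun_on S f"
  shows "continuous_on {y. left_half y \<in> S} (\<lambda>y. frechet_derivative f (at (left_half y)) (right_half y))"
proof (rule continuous_at_imp_continuous_on, safe)
  fix y0 :: "complex^('n+'n)" assume "left_half y0 \<in> S"
  then obtain r e where re: "r > 0" "e > 0"
    and disc: "\<And>y u. y \<in> ball y0 e \<Longrightarrow> norm u \<le> r \<Longrightarrow> left_half y + u *s right_half y \<in> S"
    using uniform_directional_disc[OF S] by metis
  define c where "c = (\<lambda>t. of_real r * exp (2 * of_real pi * \<i> * of_real t))"
  have c: "continuous_on T c" for T unfolding c_def by (intro continuous_intros)
  have normc: "norm (c t) = r" "c t \<noteq> 0" for t using re by (auto simp: c_def norm_mult)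
  have "continuous_on (ball y0 e \<times> cbox 0 1) (\<lambda>(y, t). f (left_half y + c t *s right_half y) / c t)"
    unfolding case_prod_unfold
    by (intro continuous_intros continuous_on_compose2[OF holo_fun_on_imp_continuous_on[OF f]]
        continuous_on_compose2[OF c[of UNIV]])
       (use disc normc in auto)
  from integral_continuous_on_param[OF this]
  have "continuous_on (ball y0 e) (\<lambda>y. integral {0..1} (\<lambda>t. f (left_half y + c t *s right_half y) / c t))"
    by simp
  then have "continuous_on (ball y0 e) (\<lambda>y. frechet_derivative f (at (left_half y)) (right_half y))"
    by (rule continuous_on_eq)
       (simp only: c_def Cauchy_directional_derivative[OF S f re(1) disc])
  then show "isCont (\<lambda>y. frechet_derivative f (at (left_half y)) (right_half y)) y0"
    using re(2) by (simp add: continuous_on_eq_continuous_at)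
qed

text \<open>Cauchy's formula is differentiated under the integral sign.  The Leibniz rule asks for a continuous derivative
  of the integrand; by the chain rule this derivative is again a value of the differential of \<open>f\<close>, so its
  continuity is the preceding lemma.  The integral of complex linear maps is complex linear.\<close>

lemma holo_fun_on_derivative:
  fixes f :: "complex^'n \<Rightarrow> complex"
  assumes S: "open S" and f: "holo_fun_on S f"
  shows "holo_fun_on {y. left_half y \<in> S} (\<lambda>y. frechet_derivative f (at (left_half y)) (right_half y))"
  unfolding holo_fun_on_def
proof safe
  fix y0 :: "complex^('n+'n)" assume "left_half y0 \<in> S"
  then obtain r e where re: "r > 0" "e > 0"
    and disc: "\<And>y u. y \<in> ball y0 e \<Longrightarrow> norm u \<le> r \<Longrightarrow> left_half y + u *s right_half y \<in> S"
    using uniform_directional_disc[OF S] by metis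
  define U where "U = ball y0 e"
  define c where "c = (\<lambda>t. of_real r * exp (2 * of_real pi * \<i> * of_real t))"
  have c: "continuous_on T c" for T unfolding c_def by (intro continuous_intros)
  have normc: "norm (c t) = r" "c t \<noteq> 0" for t using re by (auto simp: c_def norm_mult)
  define D where "D = (\<lambda>y. frechet_derivative f (at (left_half y)) (right_half y))"
  define L where "L = (\<lambda>t (y::complex^('n+'n)). left_half y + c t *s right_half y)"
  (* F is the integrand of Cauchy's formula, F' y t its differential at y *)
  define F where "F = (\<lambda>y t. f (L t y) / c t)"
  define F' where "F' = (\<lambda>y t v. frechet_derivative f (at (L t y)) (L t v) / c t)"
  have LS: "L t y \<in> S" if "y \<in> U" for t y
    using disc[of y "c t"] that normc(1)[of t] by (simp add: L_def U_def)
  have linL: "Vector_Spaces.linear (*s) (*s) (L t)" for t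
    by (auto simp: Vector_Spaces.linear_iff vec.vector_space_axioms L_def
        vec.linear_add[OF clinear_left_half] vec.linear_scale[OF clinear_left_half]
        vec.linear_add[OF clinear_right_half] vec.linear_scale[OF clinear_right_half]
        algebra_simps vec_eq_iff)
  have derF: "((\<lambda>y. F y t) has_derivative F' y t) (at y)" if "y \<in> U" for y t
    unfolding F_def F'_def
    by (intro has_derivative_divide' has_derivative_compose[OF bounded_linear_imp_has_derivative[OF bounded_linear_clinear[OF linL]]
        holo_fun_on_frechet(1)[OF f LS[OF that]]] bounded_linear.has_derivative[OF bounded_linear_divide])
  have bl: "bounded_linear (F' y t)" if "y \<in> U" for y t
    using has_derivative_bounded_linear[OF derF[OF that]] .
  have contF: "continuous_on (U \<times> cbox 0 1) (\<lambda>(y, t). F y t)"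
    unfolding case_prod_unfold F_def L_def
    by (intro continuous_intros continuous_on_compose2[OF holo_fun_on_imp_continuous_on[OF f]]
        continuous_on_compose2[OF c[of UNIV]])
       (use LS normc in \<open>auto simp: L_def\<close>)
  have F'D: "F' y t v = D (join_halves (L t y) (L t v)) / c t" for y t v
    by (simp add: F'_def D_def)
  have contF': "continuous_on (U \<times> cbox 0 1) (\<lambda>(y, t). F' y t v)" for v
    unfolding case_prod_unfold F'D
    by (intro continuous_intros continuous_on_compose2[OF continuous_on_holo_derivative[OF S f, folded D_def]]
        continuous_on_compose2[OF c[of UNIV]])
       (use LS normc in \<open>auto simp: L_def intro!: continuous_intros continuous_on_compose2[OF c[of UNIV]]\<close>)
  have contB: "continuous_on (U \<times> cbox 0 1) (\<lambda>(y, t). Blinfun (F' y t))"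
  proof (rule continuous_on_blinfun_componentwise)
    fix v :: "complex^('n+'n)"
    show "continuous_on (U \<times> cbox 0 1) (\<lambda>p. blinfun_apply (case p of (y, t) \<Rightarrow> Blinfun (F' y t)) v)"
      by (rule continuous_on_eq[OF contF'[of v]])
         (auto simp: bounded_linear_Blinfun_apply[OF bl])
  qed
  have intF: "F y integrable_on cbox 0 1" if "y \<in> U" for y
  proof (rule integrable_continuous)
    have "continuous_on (cbox 0 1) (\<lambda>t. case (y, t) of (y, t) \<Rightarrow> F y t)"
      by (rule continuous_on_compose2[OF contF]) (use that in \<open>auto intro!: continuous_intros\<close>)
    then show "continuous_on (cbox 0 1) (F y)" by simp
  qed
  have y0: "y0 \<in> U" and opU: "open U" using re by (simp_all add: U_def)
  let ?B = "integral (cbox 0 1) (\<lambda>t. Blinfun (F' y0 t))"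
  have "((\<lambda>y. integral (cbox 0 1) (F y)) has_derivative ?B) (at y0 within U)"
  proof (rule leibniz_rule[OF _ intF contB y0])
    show "((\<lambda>y. F y t) has_derivative blinfun_apply (Blinfun (F' y t))) (at y within U)" if "y \<in> U" for y t
      by (simp only: bounded_linear_Blinfun_apply[OF bl[OF that]] has_derivative_at_withinI[OF derF[OF that]])
    show "convex U" by (simp add: U_def)
  qed auto
  then have "((\<lambda>y. integral (cbox 0 1) (F y)) has_derivative ?B) (at y0)"
    by (simp add: at_within_open[OF y0 opU])
  moreover have "integral (cbox 0 1) (F y) = D y" if "y \<in> U" for y
  proof -
    have "D y = integral {0..1} (F y)"
      unfolding D_def F_def L_def c_def
      by (rule Cauchy_directional_derivative[OF S f re(1)]) (use disc that in \<open>simp add: U_def\<close>)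
    then show ?thesis by simp
  qed
  ultimately have "(D has_derivative ?B) (at y0)"
    by (rule has_derivative_transform_within_open[OF _ opU y0])
  moreover have "blinfun_apply ?B (a *s v) = a * blinfun_apply ?B v" for a v
  proof -
    have "continuous_on (cbox 0 1) (\<lambda>t. case (y0, t) of (y, t) \<Rightarrow> Blinfun (F' y t))"
      by (rule continuous_on_compose2[OF contB]) (use y0 in \<open>auto intro!: continuous_intros\<close>)
    then have "(\<lambda>t. Blinfun (F' y0 t)) integrable_on cbox 0 1"
      by (intro integrable_continuous) simp
    then have *: "blinfun_apply ?B w = integral (cbox 0 1) (\<lambda>t. F' y0 t w)" for w
      by (simp add: blinfun_apply_integral bounded_linear_Blinfun_apply[OF bl[OF y0]])
    have "F' y0 t (a *s v) = a * F' y0 t v" for t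
      by (simp add: F'_def vec.linear_scale[OF linL] holo_fun_on_frechet(2)[OF f LS[OF y0]])
    then show ?thesis unfolding * by simp
  qed
  ultimately show "\<exists>E. ((\<lambda>y. frechet_derivative f (at (left_half y)) (right_half y)) has_derivative E) (at y0) \<and>
      (\<forall>a v. E (a *s v) = a * E v)"
    unfolding D_def by blast
qed

section \<open>Charts, holomorphic maps and submanifolds\<close>

lemma top_chart_subset: "top_chart T c \<Longrightarrow> fst c \<subseteq> topspace T"
  unfolding top_chart_def using openin_subset by blast

lemma top_chart_inj: "top_chart T c \<Longrightarrow> inj_on (snd c) (fst c)"
  unfolding top_chart_def
  by (metis homeomorphic_imp_injective_map inf.absorb2 openin_subset topspace_subtopology)

lemma top_chart_open_image:
  assumes c: "top_chart T c" and U: "openin T U"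
  shows "open (snd c ` (fst c \<inter> U))"
proof -
  have "openin (subtopology T (fst c)) (fst c \<inter> U)"
    using U by (metis inf_commute openin_subtopology_Int)
  then have "openin (top_of_set (snd c ` fst c)) (snd c ` (fst c \<inter> U))"
    using c homeomorphic_imp_open_map unfolding top_chart_def open_map_def by blast
  then show ?thesis using c openin_open_eq unfolding top_chart_def by blast
qed

lemma top_chart_openin_vimage:
  assumes c: "top_chart T c" and B: "open B"
  shows "openin T {p \<in> fst c. snd c p \<in> B}"
proof -
  have o: "openin T (fst c)" using c by (simp add: top_chart_def)
  have "continuous_map (subtopology T (fst c)) (top_of_set (snd c ` fst c)) (snd c)"
    using c homeomorphic_imp_continuous_map unfolding top_chart_def by blast
  moreover have "openin (top_of_set (snd c ` fst c)) (snd c ` fst c \<inter> B)"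
    using B by (simp add: openin_open_Int)
  ultimately have "openin (subtopology T (fst c))
      {p \<in> topspace (subtopology T (fst c)). snd c p \<in> snd c ` fst c \<inter> B}"
    by (rule openin_continuous_map_preimage)
  then have "openin T {p \<in> topspace (subtopology T (fst c)). snd c p \<in> snd c ` fst c \<inter> B}"
    by (rule openin_trans_full[OF _ o])
  moreover have "{p \<in> topspace (subtopology T (fst c)). snd c p \<in> snd c ` fst c \<inter> B} = {p \<in> fst c. snd c p \<in> B}"
    using openin_subset[OF o] by auto
  ultimately show ?thesis by simp
qed

lemma top_chartI:
  assumes U: "openin T (fst c)" and inj: "inj_on (snd c) (fst c)"
    and im: "\<And>V. openin T V \<Longrightarrow> open (snd c ` (fst c \<inter> V))"
    and pre: "\<And>B. open B \<Longrightarrow> openin T {p \<in> fst c. snd c p \<in> B}"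
  shows "top_chart T c"
proof -
  have sub: "fst c \<subseteq> topspace T" using U openin_subset by blast
  have o: "open (snd c ` fst c)" using im[OF U] by simp
  have "homeomorphic_map (subtopology T (fst c)) (top_of_set (snd c ` fst c)) (snd c)"
  proof (rule bijective_open_imp_homeomorphic_map)
    show "continuous_map (subtopology T (fst c)) (top_of_set (snd c ` fst c)) (snd c)"
      unfolding continuous_map_def
    proof (intro conjI allI impI)
      fix V assume "openin (top_of_set (snd c ` fst c)) V"
      then have "open V" using o openin_open_eq by blast
      then have "openin T {p \<in> fst c. snd c p \<in> V}" by (rule pre)
      moreover have "{p \<in> topspace (subtopology T (fst c)). snd c p \<in> V} = {p \<in> fst c. snd c p \<in> V}"
        using sub by auto
      ultimately show "openin (subtopology T (fst c)) {p \<in> topspace (subtopology T (fst c)). snd c p \<in> V}"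
        using U by (auto simp: openin_open_subtopology)
    qed auto
    show "open_map (subtopology T (fst c)) (top_of_set (snd c ` fst c)) (snd c)"
      unfolding open_map_def
    proof (intro allI impI)
      fix V assume "openin (subtopology T (fst c)) V"
      then have V: "openin T V" "V \<subseteq> fst c" using U by (auto simp: openin_open_subtopology)
      then show "openin (top_of_set (snd c ` fst c)) (snd c ` V)"
        using im[OF V(1)] o by (auto simp: openin_open_eq Int_absorb1)
    qed
  qed (use inj sub in \<open>auto simp: Int_absorb1\<close>)
  then show ?thesis using U o by (simp add: top_chart_def)
qed

lemma transition_chart:
  "inj_on (snd c) (fst c) \<Longrightarrow> p \<in> fst c \<Longrightarrow> transition c d (snd c p) = snd d p"
  by (simp add: transition_def)

lemma top_chart_restrict:
  assumes c: "top_chart T c" and U: "openin T U"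
  shows "top_chart (subtopology T U) (fst c \<inter> U, snd c)"
proof (rule top_chartI, unfold fst_conv snd_conv)
  have o: "openin T (fst c \<inter> U)" using c U by (auto simp: top_chart_def)
  then show "openin (subtopology T U) (fst c \<inter> U)" using U by (simp add: openin_open_subtopology)
  show "inj_on (snd c) (fst c \<inter> U)" using top_chart_inj[OF c] inj_on_Int by blast
  show "open (snd c ` (fst c \<inter> U \<inter> V))" if "openin (subtopology T U) V" for V
    using that U top_chart_open_image[OF c, of V]
    by (auto simp: openin_open_subtopology Int_assoc Int_absorb1)
  show "openin (subtopology T U) {p \<in> fst c \<inter> U. snd c p \<in> B}" if B: "open B" for B
  proof -
    have "openin T ({p \<in> fst c. snd c p \<in> B} \<inter> U)" using top_chart_openin_vimage[OF c B] U by blast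
    moreover have "{p \<in> fst c. snd c p \<in> B} \<inter> U = {p \<in> fst c \<inter> U. snd c p \<in> B}" by auto
    ultimately show ?thesis using U by (auto simp: openin_open_subtopology)
  qed
qed

lemma holo_compatible_sym: "holo_compatible c d \<Longrightarrow> holo_compatible d c"
  unfolding holo_compatible_def by (simp add: Int_commute)

lemma holo_transition:
  "holo_compatible c d \<Longrightarrow> holo_vec_on (snd c ` (fst c \<inter> fst d)) (transition c d)"
  unfolding holo_compatible_def by blast

lemma holo_transition_restrict:
  assumes c: "top_chart T c" and d: "top_chart T d" and cd: "holo_compatible c d" and U: "openin T U"
  shows "holo_vec_on (snd c ` (fst c \<inter> U \<inter> (fst d \<inter> U)))
     (transition (fst c \<inter> U, snd c) (fst d \<inter> U, snd d))"
proof (rule holo_vec_on_cong_open[OF holo_transition[OF cd]])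
  have "openin T (fst d \<inter> U)" using d U by (auto simp: top_chart_def)
  from top_chart_open_image[OF c this] show "open (snd c ` (fst c \<inter> U \<inter> (fst d \<inter> U)))"
    by (simp add: Int_ac)
  fix z assume "z \<in> snd c ` (fst c \<inter> U \<inter> (fst d \<inter> U))"
  then obtain p where p: "z = snd c p" "p \<in> fst c" "p \<in> U" "p \<in> fst d" by auto
  have i: "inj_on (snd c) (fst c)" by (rule top_chart_inj[OF c])
  then have "inj_on (snd c) (fst c \<inter> U)" by (auto simp: inj_on_def)
  then show "transition c d z = transition (fst c \<inter> U, snd c) (fst d \<inter> U, snd d) z"
    using p i by (simp add: transition_def)
qed auto

lemma holo_compatible_restrict:
  assumes c: "top_chart T c" and d: "top_chart T d" and cd: "holo_compatible c d" and U: "openin T U"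
  shows "holo_compatible (fst c \<inter> U, snd c) (fst d \<inter> U, snd d)"
  using holo_transition_restrict[OF assms]
    holo_transition_restrict[OF d c holo_compatible_sym[OF cd] U]
  unfolding holo_compatible_def by (simp add: Int_ac)

lemma holo_transition_trans:
  assumes c: "top_chart T c" and d: "top_chart T d"
    and e: "\<And>p. p \<in> fst c \<inter> fst d \<Longrightarrow>
      \<exists>e. top_chart T e \<and> p \<in> fst e \<and> holo_compatible c e \<and> holo_compatible e d"
  shows "holo_vec_on (snd c ` (fst c \<inter> fst d)) (transition c d)"
proof (rule holo_vec_on_local)
  fix z assume "z \<in> snd c ` (fst c \<inter> fst d)"
  then obtain p where p: "z = snd c p" "p \<in> fst c \<inter> fst d" by auto
  obtain e where e: "top_chart T e" "p \<in> fst e" "holo_compatible c e" "holo_compatible e d"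
    using e[OF p(2)] by blast
  let ?T = "snd c ` (fst c \<inter> (fst d \<inter> fst e))"
  note inj = top_chart_inj[OF c] top_chart_inj[OF e(1)]
  have "openin T (fst d \<inter> fst e)" using d e by (auto simp: top_chart_def)
  then have o: "open ?T" by (rule top_chart_open_image[OF c])
  have 1: "holo_vec_on ?T (transition c e)"
    by (rule holo_vec_on_subset[OF holo_transition[OF e(3)]]) auto
  have "holo_vec_on ?T (\<lambda>z. transition e d (transition c e z))"
    by (rule holo_vec_on_compose[OF 1 holo_transition[OF e(4)]]) (auto simp: transition_chart inj)
  then have "holo_vec_on ?T (transition c d)"
    by (rule holo_vec_on_cong_open[OF _ o]) (auto simp: transition_chart inj)
  moreover have "z \<in> ?T" using p e(2) by auto
  ultimately show "\<exists>S. z \<in> S \<and> holo_vec_on S (transition c d)" by (intro exI conjI)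
qed

text \<open>Holomorphy of the coordinate change is a local question, so it may be checked through a third chart that is
  chosen around each point.\<close>

lemma holo_compatible_trans:
  assumes c: "top_chart T c" and d: "top_chart T d"
    and e: "\<And>p. p \<in> fst c \<inter> fst d \<Longrightarrow>
      \<exists>e. top_chart T e \<and> p \<in> fst e \<and> holo_compatible c e \<and> holo_compatible e d"
  shows "holo_compatible c d"
  unfolding holo_compatible_def
proof
  show "holo_vec_on (snd c ` (fst c \<inter> fst d)) (transition c d)"
    by (rule holo_transition_trans[OF c d e])
  have "holo_vec_on (snd d ` (fst d \<inter> fst c)) (transition d c)"
    by (rule holo_transition_trans[OF d c]) (use e holo_compatible_sym in blast)
  then show "holo_vec_on (snd d ` (fst c \<inter> fst d)) (transition d c)" by (simp add: Int_commute)
qed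

text \<open>The part of the manifold axioms on which local arguments rest.\<close>

definition charted :: "('a, 'n::finite) cmfd \<Rightarrow> bool" where
  "charted M \<longleftrightarrow> (\<forall>c\<in>atlas M. top_chart (mtop M) c) \<and> (\<Union>c\<in>atlas M. fst c) = pts M"

lemma complex_manifold_charted: "complex_manifold M \<Longrightarrow> charted M"
  by (simp add: complex_manifold_def charted_def)

lemma charted_top_chart: "charted M \<Longrightarrow> c \<in> atlas M \<Longrightarrow> top_chart (mtop M) c"
  by (simp add: charted_def)

lemma charted_cover: "charted M \<Longrightarrow> p \<in> pts M \<Longrightarrow> \<exists>c\<in>atlas M. p \<in> fst c"
  unfolding charted_def by blast

lemma atlas_holo_chart: "complex_manifold M \<Longrightarrow> c \<in> atlas M \<Longrightarrow> holo_chart M c"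
  by (simp add: complex_manifold_def holo_chart_def)

lemma holo_chart_compatible:
  assumes M: "charted M" and c: "holo_chart M c" and d: "holo_chart M d"
  shows "holo_compatible c d"
proof (rule holo_compatible_trans)
  show "top_chart (mtop M) c" "top_chart (mtop M) d" using c d by (auto simp: holo_chart_def)
  fix p assume "p \<in> fst c \<inter> fst d"
  then have "p \<in> pts M" using c top_chart_subset[of "mtop M" c] by (auto simp: holo_chart_def)
  then obtain e where e: "e \<in> atlas M" "p \<in> fst e" using charted_cover[OF M] by blast
  moreover have "top_chart (mtop M) e" by (rule charted_top_chart[OF M e(1)])
  moreover have "holo_compatible c e" "holo_compatible e d"
    using c d e(1) holo_compatible_sym unfolding holo_chart_def by blast+
  ultimately show "\<exists>e. top_chart (mtop M) e \<and> p \<in> fst e \<and> holo_compatible c e \<and> holo_compatible e d"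
    by blast
qed

lemma mtop_open_submfd [simp]: "mtop (open_submfd M U) = subtopology (mtop M) U"
  and atlas_open_submfd: "atlas (open_submfd M U) = (\<lambda>c. (fst c \<inter> U, snd c)) ` atlas M"
  by (simp_all add: open_submfd_def)

lemma complex_manifold_open_submfd:
  assumes M: "complex_manifold M" and U: "openin (mtop M) U"
  shows "complex_manifold (open_submfd M U)"
  unfolding complex_manifold_def
proof (intro conjI ballI)
  show "Hausdorff_space (mtop (open_submfd M U))" "second_countable (mtop (open_submfd M U))"
    using M by (auto simp: complex_manifold_def Hausdorff_space_subtopology second_countable_subtopology)
  show "top_chart (mtop (open_submfd M U)) c" if "c \<in> atlas (open_submfd M U)" for c
    using that M top_chart_restrict[OF _ U] by (auto simp: complex_manifold_def atlas_open_submfd)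
  show "holo_compatible c d" if cd: "c \<in> atlas (open_submfd M U)" "d \<in> atlas (open_submfd M U)" for c d
  proof -
    obtain c' d' where cd': "c' \<in> atlas M" "d' \<in> atlas M"
        "c = (fst c' \<inter> U, snd c')" "d = (fst d' \<inter> U, snd d')"
      using cd unfolding atlas_open_submfd image_iff by metis
    then have "top_chart (mtop M) c'" "top_chart (mtop M) d'" "holo_compatible c' d'"
      using M by (simp_all only: complex_manifold_def)
    then show ?thesis unfolding cd'(3,4) by (rule holo_compatible_restrict[OF _ _ _ U])
  qed
  show "(\<Union>c\<in>atlas (open_submfd M U). fst c) = pts (open_submfd M U)"
    using M by (auto simp: complex_manifold_def atlas_open_submfd)
qed

lemma holo_chart_open_submfd:
  assumes M: "charted M" and U: "openin (mtop M) U" and c: "holo_chart M c"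
  shows "holo_chart (open_submfd M U) (fst c \<inter> U, snd c)"
  unfolding holo_chart_def
proof (intro conjI ballI)
  have tc: "top_chart (mtop M) c" using c by (simp add: holo_chart_def)
  then show "top_chart (mtop (open_submfd M U)) (fst c \<inter> U, snd c)"
    using top_chart_restrict[OF _ U] by simp
  show "holo_compatible (fst c \<inter> U, snd c) d" if "d \<in> atlas (open_submfd M U)" for d
    using that c holo_compatible_restrict[OF tc charted_top_chart[OF M] _ U]
    by (auto simp: atlas_open_submfd holo_chart_def)
qed

lemma holo_on_mfd_chart_component:
  fixes c :: "('a, 'n::finite) chart"
  assumes M: "charted M" and c: "holo_chart M c" and U: "openin (mtop M) U" "U \<subseteq> fst c"
  shows "holo_on_mfd M U (\<lambda>p. snd c p $ i)"
  unfolding holo_on_mfd_def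
proof
  fix d assume d: "d \<in> atlas M"
  have td: "top_chart (mtop M) d" by (rule charted_top_chart[OF M d])
  have "holo_vec_on (snd d ` (fst d \<inter> fst c)) (transition d c)"
    using c d holo_compatible_sym holo_transition unfolding holo_chart_def by blast
  then have "holo_fun_on (snd d ` (fst d \<inter> fst c)) (\<lambda>z. transition d c z $ i)"
    by (simp add: holo_vec_on_def)
  then have "holo_fun_on (snd d ` (fst d \<inter> U)) (\<lambda>z. transition d c z $ i)"
    by (rule holo_fun_on_subset) (use U in auto)
  then show "holo_fun_on (snd d ` (U \<inter> fst d)) ((\<lambda>p. snd c p $ i) \<circ> inv_into (fst d) (snd d))"
    by (simp add: transition_def o_def Int_commute)
qed

lemma holo_on_mfd_const: "holo_on_mfd M U (\<lambda>p. a)"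
  by (simp add: holo_on_mfd_def o_def holo_fun_on_const)

lemma holo_on_mfd_add:
  "holo_on_mfd M U f \<Longrightarrow> holo_on_mfd M U g \<Longrightarrow> holo_on_mfd M U (\<lambda>p. f p + g p)"
  by (simp add: holo_on_mfd_def o_def holo_fun_on_add)

lemma holo_on_mfd_mult:
  "holo_on_mfd M U f \<Longrightarrow> holo_on_mfd M U g \<Longrightarrow> holo_on_mfd M U (\<lambda>p. f p * g p)"
  by (simp add: holo_on_mfd_def o_def holo_fun_on_mult)

lemma holo_on_mfd_subset: "holo_on_mfd M U f \<Longrightarrow> V \<subseteq> U \<Longrightarrow> holo_on_mfd M V f"
  unfolding holo_on_mfd_def by (meson Int_mono holo_fun_on_subset image_mono order_refl)

lemma holo_on_mfd_pullback:
  assumes M: "charted M" and M': "charted M'" and F: "holo_map M M' F"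
    and U: "openin (mtop M') U" and f: "holo_on_mfd M' U f"
  shows "holo_on_mfd M {p \<in> pts M. F p \<in> U} (f \<circ> F)"
  unfolding holo_on_mfd_def
proof (intro ballI holo_fun_on_local)
  fix c z assume c: "c \<in> atlas M" and "z \<in> snd c ` ({p \<in> pts M. F p \<in> U} \<inter> fst c)"
  then obtain p where p: "z = snd c p" "p \<in> fst c" "F p \<in> U" by auto
  have cF: "continuous_map (mtop M) (mtop M') F" using F by (simp add: holo_map_def)
  have "F p \<in> pts M'" using p U openin_subset by blast
  then obtain d where d: "d \<in> atlas M'" "F p \<in> fst d" using charted_cover[OF M'] by blast
  have tc: "top_chart (mtop M) c" and td: "top_chart (mtop M') d"
    using c d charted_top_chart M M' by blast+
  note inj = top_chart_inj[OF tc] top_chart_inj[OF td]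
  let ?O = "{q \<in> pts M. F q \<in> fst d \<inter> U}"
  have "openin (mtop M') (fst d \<inter> U)" using td U by (auto simp: top_chart_def)
  then have o: "open (snd c ` (fst c \<inter> ?O))"
    using openin_continuous_map_preimage[OF cF] top_chart_open_image[OF tc] by blast
  have "holo_vec_on (snd c ` {p\<in>fst c. F p \<in> fst d}) (snd d \<circ> F \<circ> inv_into (fst c) (snd c))"
    using F c d by (simp add: holo_map_def)
  then have 1: "holo_vec_on (snd c ` (fst c \<inter> ?O)) (snd d \<circ> F \<circ> inv_into (fst c) (snd c))"
    by (rule holo_vec_on_subset) auto
  have 2: "holo_fun_on (snd d ` (U \<inter> fst d)) (f \<circ> inv_into (fst d) (snd d))"
    using f d by (simp add: holo_on_mfd_def)
  have "holo_fun_on (snd c ` (fst c \<inter> ?O)) (\<lambda>z. (f \<circ> inv_into (fst d) (snd d))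
      ((snd d \<circ> F \<circ> inv_into (fst c) (snd c)) z))"
    by (rule holo_fun_on_compose[OF 1 2]) (use inj in auto)
  then have "holo_fun_on (snd c ` (fst c \<inter> ?O)) (f \<circ> F \<circ> inv_into (fst c) (snd c))"
    by (rule holo_fun_on_cong_open[OF _ o]) (use inj in auto)
  moreover have "z \<in> snd c ` (fst c \<inter> ?O)"
    using p d top_chart_subset[OF tc] by auto
  ultimately show "\<exists>T. z \<in> T \<and> holo_fun_on T (f \<circ> F \<circ> inv_into (fst c) (snd c))"
    by (intro exI conjI)
qed

text \<open>Between manifolds that are covered by one chart each, the expression \<open>k\<close> of a map in these two charts decides
  about holomorphy.  In the application \<open>k\<close> is a linear map.\<close>

lemma holo_map_global_chart:
  assumes M: "charted M" and M': "charted M'"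
    and c: "holo_chart M c" "fst c = pts M" and d: "holo_chart M' d" "fst d = pts M'"
    and F: "\<And>p. p \<in> pts M \<Longrightarrow> F p \<in> pts M'"
    and k: "holo_vec_on (snd c ` pts M) k"
    and Fk: "\<And>p. p \<in> pts M \<Longrightarrow> snd d (F p) = k (snd c p)"
  shows "holo_map M M' F"
proof -
  have tc: "top_chart (mtop M) c" and td: "top_chart (mtop M') d"
    using c d by (simp_all add: holo_chart_def)
  note inj = top_chart_inj[OF tc] top_chart_inj[OF td]
  have oc: "open (snd c ` pts M)" using tc c by (simp add: top_chart_def)
  have pre: "openin (mtop M) {p \<in> pts M. F p \<in> V}" if V: "openin (mtop M') V" for V
  proof -
    have "open (snd d ` (fst d \<inter> V))" by (rule top_chart_open_image[OF td V])
    then have "open (k -` (snd d ` (fst d \<inter> V)) \<inter> snd c ` pts M)"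
      using continuous_on_open_vimage[OF oc, of k] holo_vec_on_imp_continuous_on[OF k] by blast
    then have "openin (mtop M) {p \<in> fst c. snd c p \<in> k -` (snd d ` (fst d \<inter> V)) \<inter> snd c ` pts M}"
      by (rule top_chart_openin_vimage[OF tc])
    moreover have "{p \<in> fst c. snd c p \<in> k -` (snd d ` (fst d \<inter> V)) \<inter> snd c ` pts M} = {p \<in> pts M. F p \<in> V}"
    proof -
      have "snd d (F p) \<in> snd d ` (fst d \<inter> V) \<longleftrightarrow> F p \<in> V" if "p \<in> pts M" for p
        using inj(2) F[OF that] d(2) by (auto simp: inj_on_def)
      then show ?thesis using c(2) Fk by auto
    qed
    ultimately show ?thesis by simp
  qed
  have cont: "continuous_map (mtop M) (mtop M') F"
    unfolding continuous_map_def using F pre by auto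
  moreover have "holo_vec_on (snd c' ` {p\<in>fst c'. F p \<in> fst d'}) (snd d' \<circ> F \<circ> inv_into (fst c') (snd c'))"
    if c': "c' \<in> atlas M" and d': "d' \<in> atlas M'" for c' d'
  proof -
    have tc': "top_chart (mtop M) c'" and td': "top_chart (mtop M') d'"
      using c' d' charted_top_chart M M' by blast+
    note inj = inj top_chart_inj[OF tc'] top_chart_inj[OF td']
    let ?S = "snd c' ` {p\<in>fst c'. F p \<in> fst d'}"
    have "openin (mtop M) {p \<in> pts M. F p \<in> fst d'}" using td' pre by (simp add: top_chart_def)
    then have "open (snd c' ` (fst c' \<inter> {p \<in> pts M. F p \<in> fst d'}))"
      by (rule top_chart_open_image[OF tc'])
    moreover have eq: "fst c' \<inter> {p \<in> pts M. F p \<in> fst d'} = {p\<in>fst c'. F p \<in> fst d'}"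
      using top_chart_subset[OF tc'] by auto
    ultimately have o: "open ?S" by simp
    have cc': "holo_compatible c' c" and dd': "holo_compatible d d'"
      using c(1) d(1) c' d' holo_compatible_sym[of c c'] unfolding holo_chart_def by simp_all
    have 1: "holo_vec_on ?S (transition c' c)"
      by (rule holo_vec_on_subset[OF holo_transition[OF cc']]) (use top_chart_subset[OF tc'] c(2) in auto)
    have 2: "holo_vec_on ?S (\<lambda>z. k (transition c' c z))"
      by (rule holo_vec_on_compose[OF 1 k])
         (use top_chart_subset[OF tc'] inj in \<open>auto simp: transition_chart\<close>)
    have "holo_vec_on ?S (\<lambda>z. transition d d' (k (transition c' c z)))"
    proof (rule holo_vec_on_compose[OF 2 holo_transition[OF dd']])
      fix z assume "z \<in> ?S"
      then obtain p where p: "z = snd c' p" "p \<in> fst c'" "F p \<in> fst d'" by auto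
      then have "p \<in> pts M" using top_chart_subset[OF tc'] by auto
      then show "k (transition c' c z) \<in> snd d ` (fst d \<inter> fst d')"
        using p inj Fk[symmetric] F d(2) by (auto simp: transition_chart)
    qed
    then show ?thesis
    proof (rule holo_vec_on_cong_open[OF _ o order_refl])
      fix z assume "z \<in> ?S"
      then obtain p where p: "z = snd c' p" "p \<in> fst c'" "F p \<in> fst d'" by auto
      then have pM: "p \<in> pts M" using top_chart_subset[OF tc'] by auto
      have "transition d d' (k (transition c' c z)) = transition d d' (snd d (F p))"
        using p inj Fk[OF pM] by (simp add: transition_chart)
      also have "\<dots> = snd d' (F p)"
        using F[OF pM] d(2) inj by (simp add: transition_chart)
      finally show "transition d d' (k (transition c' c z)) = (snd d' \<circ> F \<circ> inv_into (fst c') (snd c')) z"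
        using p inj by simp
    qed
  qed
  ultimately show ?thesis by (simp add: holo_map_def)
qed

text \<open>The inverse of \<open>r\<close> on \<open>L\<close>, taken as a linear map on the whole model space.  It turns images under the chart
  \<open>r \<circ> snd c\<close> of a submanifold into preimages under a linear map.\<close>

lemma adapted_chart_linear_section:
  assumes "adapted_chart M S c L" "Vector_Spaces.linear (*s) (*s) (r :: complex^'n \<Rightarrow> complex^'k)"
    "bij_betw r L UNIV"
  obtains s where "Vector_Spaces.linear (*s) (*s) s" "\<And>w. s w \<in> L" "\<And>w. r (s w) = w"
    "\<And>z. z \<in> L \<Longrightarrow> s (r z) = z"
proof -
  have "vec.subspace L" "inj_on r L" using assms by (auto simp: adapted_chart_def bij_betw_def)
  then obtain s where s: "range s \<subseteq> L" "Vector_Spaces.linear (*s) (*s) s" "\<forall>z\<in>L. s (r z) = z"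
    using vec.linear_exists_left_inverse_on[OF assms(2)] by blast
  have "r (s w) = w" for w
  proof -
    obtain z where "z \<in> L" "w = r z" using assms(3) by (metis UNIV_I bij_betw_def imageE)
    then show ?thesis using s by simp
  qed
  then show ?thesis using s that by blast
qed

lemma adapted_chart_mem_iff:
  assumes "adapted_chart M S c L" "p \<in> fst c" shows "snd c p \<in> L \<longleftrightarrow> p \<in> S"
proof
  have inj: "inj_on (snd c) (fst c)" using assms top_chart_inj[of "mtop M" c] by (auto simp: adapted_chart_def holo_chart_def)
  have *: "snd c ` (fst c \<inter> S) = snd c ` fst c \<inter> L" using assms by (simp add: adapted_chart_def)
  show "p \<in> S \<Longrightarrow> snd c p \<in> L" using * assms by blast
  assume "snd c p \<in> L"
  then have "snd c p \<in> snd c ` (fst c \<inter> S)" using * assms by blast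
  then show "p \<in> S" using inj assms(2) by (auto simp: inj_on_def)
qed

lemma adapted_chart_image:
  assumes "adapted_chart M S c L" "Vector_Spaces.linear (*s) (*s) (r :: complex^'n \<Rightarrow> complex^'k)"
    "bij_betw r L UNIV" and V: "openin (mtop M) V"
  shows "open ((r \<circ> snd c) ` (fst c \<inter> S \<inter> V))"
proof -
  obtain s where s: "Vector_Spaces.linear (*s) (*s) s" "\<And>w. s w \<in> L" "\<And>w. r (s w) = w"
    "\<And>z. z \<in> L \<Longrightarrow> s (r z) = z"
    using adapted_chart_linear_section[OF assms(1-3)] by metis
  have tc: "top_chart (mtop M) c" using assms by (simp add: adapted_chart_def holo_chart_def)
  have "(r \<circ> snd c) ` (fst c \<inter> S \<inter> V) = s -` (snd c ` (fst c \<inter> V))"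
  proof (intro equalityI subsetI)
    fix w assume "w \<in> (r \<circ> snd c) ` (fst c \<inter> S \<inter> V)"
    then show "w \<in> s -` (snd c ` (fst c \<inter> V))"
      using adapted_chart_mem_iff[OF assms(1)] s(4) by auto
  next
    fix w assume "w \<in> s -` (snd c ` (fst c \<inter> V))"
    then obtain p where p: "p \<in> fst c" "p \<in> V" "s w = snd c p" by auto
    then have "p \<in> S" using adapted_chart_mem_iff[OF assms(1), of p] s(2)[of w] by simp
    moreover have "w = r (snd c p)" using p s(3)[of w] by simp
    ultimately show "w \<in> (r \<circ> snd c) ` (fst c \<inter> S \<inter> V)" using p by auto
  qed
  moreover have "open (s -` (snd c ` (fst c \<inter> V)))"
    by (rule open_vimage[OF top_chart_open_image[OF tc V]])
       (rule holo_vec_on_imp_continuous_on[OF holo_vec_on_clinear[OF s(1)]])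
  ultimately show ?thesis by simp
qed

lemma adapted_chart_top_chart:
  assumes "adapted_chart M S c L" "Vector_Spaces.linear (*s) (*s) (r :: complex^'n \<Rightarrow> complex^'k)"
    "bij_betw r L UNIV"
  shows "top_chart (subtopology (mtop M) S) (fst c \<inter> S, r \<circ> snd c)"
proof (rule top_chartI)
  have tc: "top_chart (mtop M) c" using assms by (simp add: adapted_chart_def holo_chart_def)
  show "openin (subtopology (mtop M) S) (fst (fst c \<inter> S, r \<circ> snd c))"
    using tc by (auto simp: top_chart_def openin_subtopology_Int)
  have "inj_on r (snd c ` (fst c \<inter> S))"
    using assms by (auto simp: adapted_chart_def bij_betw_def intro: inj_on_subset)
  moreover have "inj_on (snd c) (fst c \<inter> S)" using top_chart_inj[OF tc] by (auto simp: inj_on_def)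
  ultimately show "inj_on (snd (fst c \<inter> S, r \<circ> snd c)) (fst (fst c \<inter> S, r \<circ> snd c))"
    by (simp add: comp_inj_on)
  fix V assume "openin (subtopology (mtop M) S) V"
  then obtain V' where "openin (mtop M) V'" "V = V' \<inter> S" by (auto simp: openin_subtopology)
  then show "open (snd (fst c \<inter> S, r \<circ> snd c) ` (fst (fst c \<inter> S, r \<circ> snd c) \<inter> V))"
    using adapted_chart_image[OF assms, of V'] by (simp add: Int_ac)
next
  fix B :: "(complex^'k) set" assume "open B"
  have tc: "top_chart (mtop M) c" using assms by (simp add: adapted_chart_def holo_chart_def)
  have "open (r -` B)"
    by (rule open_vimage[OF \<open>open B\<close>])
       (rule holo_vec_on_imp_continuous_on[OF holo_vec_on_clinear[OF assms(2)]])
  then have "openin (mtop M) {p \<in> fst c. snd c p \<in> r -` B}" by (rule top_chart_openin_vimage[OF tc])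
  then have "openin (subtopology (mtop M) S) ({p \<in> fst c. snd c p \<in> r -` B} \<inter> S)"
    by (rule openin_subtopology_Int)
  moreover have "{p \<in> fst c. snd c p \<in> r -` B} \<inter> S =
    {p \<in> fst (fst c \<inter> S, r \<circ> snd c). snd (fst c \<inter> S, r \<circ> snd c) p \<in> B}" by auto
  ultimately show "openin (subtopology (mtop M) S)
      {p \<in> fst (fst c \<inter> S, r \<circ> snd c). snd (fst c \<inter> S, r \<circ> snd c) p \<in> B}" by simp
qed

lemma adapted_chart_transition:
  assumes M: "charted M"
    and c: "adapted_chart M S c L" "Vector_Spaces.linear (*s) (*s) (r :: complex^'n \<Rightarrow> complex^'k)" "bij_betw r L UNIV"
    and d: "adapted_chart M S d L'" "Vector_Spaces.linear (*s) (*s) (r' :: complex^'n \<Rightarrow> complex^'k)" "bij_betw r' L' UNIV"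
  shows "holo_vec_on ((r \<circ> snd c) ` (fst c \<inter> S \<inter> (fst d \<inter> S)))
     (transition (fst c \<inter> S, r \<circ> snd c) (fst d \<inter> S, r' \<circ> snd d))"
proof -
  obtain s where s: "Vector_Spaces.linear (*s) (*s) s" "\<And>w. s w \<in> L" "\<And>w. r (s w) = w"
    "\<And>z. z \<in> L \<Longrightarrow> s (r z) = z"
    using adapted_chart_linear_section[OF c] by metis
  have hc: "holo_chart M c" and hd: "holo_chart M d" using c(1) d(1) by (simp_all add: adapted_chart_def)
  then have tc: "top_chart (mtop M) c" and td: "top_chart (mtop M) d" by (simp_all add: holo_chart_def)
  have cd: "holo_compatible c d" by (rule holo_chart_compatible[OF M hc hd])
  let ?S = "(r \<circ> snd c) ` (fst c \<inter> S \<inter> (fst d \<inter> S))"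
  have eq: "fst c \<inter> S \<inter> (fst d \<inter> S) = fst c \<inter> S \<inter> fst d" by auto
  have o: "open ?S"
    unfolding eq by (rule adapted_chart_image[OF c]) (use td in \<open>simp add: top_chart_def\<close>)
  note inj = top_chart_inj[OF tc] top_chart_inj[OF adapted_chart_top_chart[OF c]]
  have 1: "holo_vec_on ?S s" by (rule holo_vec_on_clinear[OF s(1)])
  have 2: "holo_vec_on ?S (\<lambda>w. transition c d (s w))"
    by (rule holo_vec_on_compose[OF 1 holo_transition[OF cd]])
       (use s(4) adapted_chart_mem_iff[OF c(1)] in auto)
  have "holo_vec_on ?S (\<lambda>w. r' (transition c d (s w)))"
    by (rule holo_vec_on_compose[OF 2 holo_vec_on_clinear[OF d(2)]]) (rule UNIV_I)
  then show ?thesis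
  proof (rule holo_vec_on_cong_open[OF _ o order_refl])
    fix w assume "w \<in> ?S"
    then obtain p where p: "w = r (snd c p)" "p \<in> fst c" "p \<in> S" "p \<in> fst d" by auto
    have "s w = snd c p" using p s(4) adapted_chart_mem_iff[OF c(1)] by auto
    then have "r' (transition c d (s w)) = r' (snd d p)" using p inj by (simp add: transition_chart)
    moreover have "transition (fst c \<inter> S, r \<circ> snd c) (fst d \<inter> S, r' \<circ> snd d) w = r' (snd d p)"
      using transition_chart[OF inj(2), of p "(fst d \<inter> S, r' \<circ> snd d)"] p by simp
    ultimately show "r' (transition c d (s w)) = transition (fst c \<inter> S, r \<circ> snd c) (fst d \<inter> S, r' \<circ> snd d) w"
      by simp
  qed
qed

lemma atlas_submfd_cases:
  assumes "c \<in> atlas (submfd M S :: ('a, 'k::finite) cmfd)"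
  obtains d L r where "c = (fst d \<inter> S, r \<circ> snd d)" "adapted_chart M S d L"
    "Vector_Spaces.linear (*s) (*s) r" "bij_betw r L (UNIV :: (complex^'k) set)"
  using assms unfolding submfd_def by auto

lemma submfd_top_chart:
  "c \<in> atlas (submfd M S) \<Longrightarrow> top_chart (subtopology (mtop M) S) c"
  using adapted_chart_top_chart by (elim atlas_submfd_cases) blast

lemma submfd_compatible:
  assumes M: "charted M" and c: "c \<in> atlas (submfd M S)" and d: "d \<in> atlas (submfd M S)"
  shows "holo_compatible c d"
proof -
  have "holo_vec_on (snd c ` (fst c \<inter> fst d)) (transition c d)"
    if c: "c \<in> atlas (submfd M S)" and d: "d \<in> atlas (submfd M S)" for c d
    by (rule atlas_submfd_cases[OF c], rule atlas_submfd_cases[OF d])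
       (use adapted_chart_transition[OF M] in \<open>simp only: fst_conv snd_conv\<close>)
  then show ?thesis using c d unfolding holo_compatible_def by (metis Int_commute)
qed

lemma mtop_submfd [simp]: "mtop (submfd M S) = subtopology (mtop M) S"
  by (simp add: submfd_def)

section \<open>Germs, powers of the vanishing ideal and jets\<close>

text \<open>Closure under negatives is part of absorption because \<open>\<ominus> a = (\<ominus> \<one>) \<otimes> a\<close>.\<close>

lemma (in cring) idealI_absorbing:
  assumes "I \<subseteq> carrier R" "\<zero> \<in> I"
    and add: "\<And>a b. a \<in> I \<Longrightarrow> b \<in> I \<Longrightarrow> a \<oplus> b \<in> I"
    and mult: "\<And>x a. x \<in> carrier R \<Longrightarrow> a \<in> I \<Longrightarrow> x \<otimes> a \<in> I"
  shows "ideal I R"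
proof (rule idealI[OF ring_axioms])
  show "subgroup I (add_monoid R)"
  proof
    fix a assume a: "a \<in> I"
    then have "\<ominus> a = (\<ominus> \<one>) \<otimes> a" using assms(1) l_minus by auto
    then have "\<ominus> a \<in> I" using mult[OF _ a] by simp
    then show "inv\<^bsub>add_monoid R\<^esub> a \<in> I" by (simp add: a_inv_def)
  qed (use assms in auto)
  show "x \<otimes> a \<in> I" "a \<otimes> x \<in> I" if "a \<in> I" "x \<in> carrier R" for a x
    using mult[OF that(2,1)] m_comm[of a x] that assms(1) by auto
qed

lemma (in ideal) mem_a_r_coset_iff:
  assumes "a \<in> carrier R"
  shows "x \<in> I +> a \<longleftrightarrow> x \<in> carrier R \<and> I +> x = I +> a"
  by (metis a_r_coset_subset_G a_rcos_self a_repr_independence a_subset a_subgroup assms subsetD)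

lemma carrier_FactRing: "carrier (R Quot I) = (\<lambda>a. I +>\<^bsub>R\<^esub> a) ` carrier R"
  by (auto simp: FactRing_def A_RCOSETS_def')

lemma carrier_near_ring:
  "f \<in> carrier (near_ring M p) \<longleftrightarrow> (\<exists>U. openin (mtop M) U \<and> p \<in> U \<and> holo_on_mfd M U f)"
  by (simp add: near_ring_def)

lemma near_ring_ops [simp]:
  "f \<otimes>\<^bsub>near_ring M p\<^esub> g = (\<lambda>z. f z * g z)" "f \<oplus>\<^bsub>near_ring M p\<^esub> g = (\<lambda>z. f z + g z)"
  "\<one>\<^bsub>near_ring M p\<^esub> = (\<lambda>z. 1)" "\<zero>\<^bsub>near_ring M p\<^esub> = (\<lambda>z. 0)"
  by (simp_all add: near_ring_def)

lemma const_near_ring: "p \<in> pts M \<Longrightarrow> (\<lambda>z. a) \<in> carrier (near_ring M p)"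
  unfolding carrier_near_ring using holo_on_mfd_const by blast

lemma add_near_ring:
  assumes "f \<in> carrier (near_ring M p)" "g \<in> carrier (near_ring M p)"
  shows "(\<lambda>z. f z + g z) \<in> carrier (near_ring M p)"
proof -
  obtain U V where "openin (mtop M) U" "p \<in> U" "holo_on_mfd M U f"
    "openin (mtop M) V" "p \<in> V" "holo_on_mfd M V g"
    using assms unfolding carrier_near_ring by blast
  then have "openin (mtop M) (U \<inter> V)" "p \<in> U \<inter> V" "holo_on_mfd M (U \<inter> V) (\<lambda>z. f z + g z)"
    by (auto intro!: holo_on_mfd_add elim: holo_on_mfd_subset)
  then show ?thesis unfolding carrier_near_ring by blast
qed

lemma mult_near_ring:
  assumes "f \<in> carrier (near_ring M p)" "g \<in> carrier (near_ring M p)"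
  shows "(\<lambda>z. f z * g z) \<in> carrier (near_ring M p)"
proof -
  obtain U V where "openin (mtop M) U" "p \<in> U" "holo_on_mfd M U f"
    "openin (mtop M) V" "p \<in> V" "holo_on_mfd M V g"
    using assms unfolding carrier_near_ring by blast
  then have "openin (mtop M) (U \<inter> V)" "p \<in> U \<inter> V" "holo_on_mfd M (U \<inter> V) (\<lambda>z. f z * g z)"
    by (auto intro!: holo_on_mfd_mult elim: holo_on_mfd_subset)
  then show ?thesis unfolding carrier_near_ring by blast
qed

lemma cring_near_ring: assumes p: "p \<in> pts M" shows "cring (near_ring M p)"
proof (rule cringI)
  show "abelian_group (near_ring M p)"
  proof (rule abelian_groupI)
    fix f assume f: "f \<in> carrier (near_ring M p)"
    have "(\<lambda>z. (-1) * f z) \<in> carrier (near_ring M p)"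
      by (rule mult_near_ring[OF const_near_ring[OF p] f])
    then show "\<exists>y\<in>carrier (near_ring M p). y \<oplus>\<^bsub>near_ring M p\<^esub> f = \<zero>\<^bsub>near_ring M p\<^esub>"
      by (rule bexI[rotated]) simp
  qed (use p in \<open>auto simp: add_near_ring const_near_ring algebra_simps\<close>)
  show "comm_monoid (near_ring M p)"
    by (rule comm_monoidI) (use p in \<open>auto simp: mult_near_ring const_near_ring algebra_simps\<close>)
qed (auto simp: algebra_simps)

lemma near_ring_minus:
  assumes p: "p \<in> pts M" and f: "f \<in> carrier (near_ring M p)" and g: "g \<in> carrier (near_ring M p)"
  shows "f \<ominus>\<^bsub>near_ring M p\<^esub> g = (\<lambda>z. f z - g z)"
proof -
  interpret cring "near_ring M p" by (rule cring_near_ring[OF p])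
  have g': "(\<lambda>z. (-1) * g z) \<in> carrier (near_ring M p)"
    by (rule mult_near_ring[OF const_near_ring[OF p] g])
  have "\<ominus>\<^bsub>near_ring M p\<^esub> g = (\<lambda>z. (-1) * g z)"
    by (rule minus_equality[OF _ g g']) simp
  then show ?thesis by (simp add: a_minus_def)
qed

abbreviation null_ideal :: "('a, 'n::finite) cmfd \<Rightarrow> 'a \<Rightarrow> ('a \<Rightarrow> complex) set" where
  "null_ideal M p \<equiv> carrier (near_ring M p) \<inter> null_near M p"

lemma ideal_null: assumes p: "p \<in> pts M" shows "ideal (null_ideal M p) (near_ring M p)"
proof -
  interpret cring "near_ring M p" by (rule cring_near_ring[OF p])
  show ?thesis
  proof (rule idealI_absorbing)
    show "\<zero>\<^bsub>near_ring M p\<^esub> \<in> null_ideal M p"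
      using p const_near_ring[OF p] by (auto simp: null_near_def)
    fix f g assume f: "f \<in> null_ideal M p" and g: "g \<in> null_ideal M p"
    then obtain U V where "openin (mtop M) U" "p \<in> U" "\<forall>z\<in>U. f z = 0" "openin (mtop M) V" "p \<in> V" "\<forall>z\<in>V. g z = 0"
      by (auto simp: null_near_def)
    then have "(\<lambda>z. f z + g z) \<in> null_near M p"
      unfolding null_near_def by (intro CollectI exI[of _ "U \<inter> V"]) auto
    then show "f \<oplus>\<^bsub>near_ring M p\<^esub> g \<in> null_ideal M p"
      using f g add_near_ring by auto
  next
    fix h f assume h: "h \<in> carrier (near_ring M p)" and f: "f \<in> null_ideal M p"
    then have "(\<lambda>z. h z * f z) \<in> null_near M p" by (auto simp: null_near_def)
    then show "h \<otimes>\<^bsub>near_ring M p\<^esub> f \<in> null_ideal M p" using h f mult_near_ring by auto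
  qed auto
qed

lemma cring_stalk: "p \<in> pts M \<Longrightarrow> cring (stalk M p)"
  unfolding stalk_def by (rule ideal.quotient_is_cring[OF ideal_null cring_near_ring])

lemma germ_hom: "p \<in> pts M \<Longrightarrow> germ_at M p \<in> ring_hom (near_ring M p) (stalk M p)"
  using ideal.rcos_ring_hom[OF ideal_null] by (simp add: stalk_def germ_at_def[abs_def])

lemma carrier_stalk: "carrier (stalk M p) = germ_at M p ` carrier (near_ring M p)"
  by (simp add: stalk_def carrier_FactRing germ_at_def[abs_def])

lemma germ_at_eq_iff:
  assumes p: "p \<in> pts M" and f: "f \<in> carrier (near_ring M p)" and g: "g \<in> carrier (near_ring M p)"
  shows "germ_at M p f = germ_at M p g \<longleftrightarrow> (\<exists>U. openin (mtop M) U \<and> p \<in> U \<and> (\<forall>z\<in>U. f z = g z))"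
proof -
  interpret cring "near_ring M p" by (rule cring_near_ring[OF p])
  have "germ_at M p f = germ_at M p g \<longleftrightarrow> f \<ominus>\<^bsub>near_ring M p\<^esub> g \<in> null_ideal M p"
    unfolding germ_at_def using quotient_eq_iff_same_a_r_cos[OF ideal_null[OF p] f g] by simp
  also have "\<dots> \<longleftrightarrow> (\<lambda>z. f z - g z) \<in> null_near M p"
    using minus_closed[OF f g] near_ring_minus[OF p f g] by auto
  finally show ?thesis by (simp add: null_near_def)
qed

lemma ideal_ideal_stalk:
  assumes p: "p \<in> pts M" shows "ideal (ideal_stalk M Y p) (stalk M p)"
proof -
  interpret cring "near_ring M p" by (rule cring_near_ring[OF p])
  let ?K = "{f \<in> carrier (near_ring M p). \<exists>U. openin (mtop M) U \<and> p \<in> U \<and> (\<forall>z\<in>U \<inter> Y. f z = 0)}"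
  have "ideal ?K (near_ring M p)"
  proof (rule idealI_absorbing)
    show "\<zero>\<^bsub>near_ring M p\<^esub> \<in> ?K" using p const_near_ring[OF p] by auto
    fix f g assume f: "f \<in> ?K" and g: "g \<in> ?K"
    then obtain U V where "openin (mtop M) U" "p \<in> U" "\<forall>z\<in>U \<inter> Y. f z = 0" "openin (mtop M) V" "p \<in> V" "\<forall>z\<in>V \<inter> Y. g z = 0"
      by blast
    then have "openin (mtop M) (U \<inter> V) \<and> p \<in> U \<inter> V \<and> (\<forall>z\<in>U \<inter> V \<inter> Y. f z + g z = 0)" by auto
    then show "f \<oplus>\<^bsub>near_ring M p\<^esub> g \<in> ?K"
      using f g add_near_ring[of f M p g] unfolding near_ring_ops by blast
  next
    fix h f assume h: "h \<in> carrier (near_ring M p)" and f: "f \<in> ?K"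
    then show "h \<otimes>\<^bsub>near_ring M p\<^esub> f \<in> ?K" using mult_near_ring[of h M p f] by auto
  qed auto
  then have "ideal (germ_at M p ` ?K) (stalk M p)"
    using ring_ideal_imp_quot_ideal[OF ideal_null[OF p]] by (simp add: stalk_def germ_at_def[abs_def])
  moreover have "germ_at M p ` ?K = ideal_stalk M Y p" unfolding ideal_stalk_def by blast
  ultimately show ?thesis by simp
qed

lemma ideal_power_0: "ideal_power R J 0 = carrier R"
  and ideal_power_Suc: "ideal_power R J (Suc k) = ideal_prod R J (ideal_power R J k)"
  by (simp_all add: ideal_power_def)

lemma (in cring) ideal_ideal_power: "ideal J R \<Longrightarrow> ideal (ideal_power R J k) R"
  by (induction k) (simp_all add: ideal_power_0 ideal_power_Suc oneideal ideal_prod_is_ideal)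

lemma (in cring) ideal_power_Suc_subset: "ideal J R \<Longrightarrow> ideal_power R J (Suc k) \<subseteq> ideal_power R J k"
  using ideal_prod_inter[OF _ ideal_ideal_power] by (auto simp: ideal_power_Suc)

abbreviation jet_ideal :: "('a, 'n::finite) cmfd \<Rightarrow> 'a set \<Rightarrow> nat \<Rightarrow> 'a \<Rightarrow> 'a germ set" where
  "jet_ideal M Y k p \<equiv> ideal_power (stalk M p) (ideal_stalk M Y p) k"

lemma ideal_jet_ideal: "p \<in> pts M \<Longrightarrow> ideal (jet_ideal M Y k p) (stalk M p)"
  by (rule cring.ideal_ideal_power[OF cring_stalk ideal_ideal_stalk])

lemma cring_jet_ring: "p \<in> pts M \<Longrightarrow> cring (jet_ring M Y k p)"
  unfolding jet_ring_def by (rule ideal.quotient_is_cring[OF ideal_jet_ideal cring_stalk])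

lemma jet_hom:
  assumes p: "p \<in> pts M"
  shows "jet_at M Y k p \<in> ring_hom (near_ring M p) (jet_ring M Y k p)"
proof -
  have "(\<lambda>x. jet_ideal M Y k p +>\<^bsub>stalk M p\<^esub> x) \<circ> germ_at M p \<in> ring_hom (near_ring M p) (jet_ring M Y k p)"
    unfolding jet_ring_def
    using ring_hom_trans[OF germ_hom[OF p] ideal.rcos_ring_hom[OF ideal_jet_ideal[OF p]]] .
  then show ?thesis by (simp add: jet_at_def[abs_def] o_def)
qed

lemma carrier_jet_ring: "carrier (jet_ring M Y k p) = jet_at M Y k p ` carrier (near_ring M p)"
  by (auto simp: jet_ring_def carrier_FactRing carrier_stalk jet_at_def)

lemma jet_at_cong:
  assumes "p \<in> pts M" "f \<in> carrier (near_ring M p)" "g \<in> carrier (near_ring M p)"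
    "openin (mtop M) U" "p \<in> U" "\<And>z. z \<in> U \<Longrightarrow> f z = g z"
  shows "jet_at M Y k p f = jet_at M Y k p g"
  using germ_at_eq_iff[OF assms(1-3)] assms(4-6) unfolding jet_at_def by metis

lemma germ_at_closed: "f \<in> carrier (near_ring M p) \<Longrightarrow> germ_at M p f \<in> carrier (stalk M p)"
  by (simp add: carrier_stalk)

lemma jet_at_eq_iff:
  assumes p: "p \<in> pts M" and f: "f \<in> carrier (near_ring M p)" and g: "g \<in> carrier (near_ring M p)"
  shows "jet_at M Y k p f = jet_at M Y k p g \<longleftrightarrow> germ_at M p (\<lambda>z. f z - g z) \<in> jet_ideal M Y k p"
proof -
  interpret cring "stalk M p" by (rule cring_stalk[OF p])
  interpret N: cring "near_ring M p" by (rule cring_near_ring[OF p])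
  interpret h: ring_hom_cring "near_ring M p" "stalk M p" "germ_at M p"
    using germ_hom[OF p] by unfold_locales
  have "germ_at M p (\<lambda>z. f z - g z) = germ_at M p f \<ominus>\<^bsub>stalk M p\<^esub> germ_at M p g"
    unfolding near_ring_minus[OF p f g, symmetric] a_minus_def
    using h.hom_add[OF f N.a_inv_closed[OF g]] h.hom_a_inv[OF g] by (simp del: near_ring_ops)
  then show ?thesis
    unfolding jet_at_def
    using quotient_eq_iff_same_a_r_cos[OF ideal_jet_ideal[OF p] germ_at_closed[OF f] germ_at_closed[OF g]]
    by simp
qed

text \<open>A jet is a set of germs, and a germ is a set of functions.  The union of a jet consists of the functions that
  represent it; these are the functions over which \<open>jet_pullback\<close> ranges.\<close>

lemma mem_jet_at_iff:
  assumes p: "p \<in> pts M" and f: "f \<in> carrier (near_ring M p)"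
  shows "g \<in> \<Union> (jet_at M Y k p f) \<longleftrightarrow> g \<in> carrier (near_ring M p) \<and> jet_at M Y k p g = jet_at M Y k p f"
proof -
  have 1: "x \<in> jet_at M Y k p f \<longleftrightarrow> x \<in> carrier (stalk M p) \<and>
      jet_ideal M Y k p +>\<^bsub>stalk M p\<^esub> x = jet_at M Y k p f" for x
    unfolding jet_at_def by (rule ideal.mem_a_r_coset_iff[OF ideal_jet_ideal[OF p] germ_at_closed[OF f]])
  have 2: "g \<in> germ_at M p h \<longleftrightarrow> g \<in> carrier (near_ring M p) \<and> germ_at M p g = germ_at M p h"
    if "h \<in> carrier (near_ring M p)" for h
    unfolding germ_at_def by (rule ideal.mem_a_r_coset_iff[OF ideal_null[OF p] that])
  have "g \<in> \<Union> (jet_at M Y k p f) \<longleftrightarrow>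
    (\<exists>h\<in>carrier (near_ring M p). g \<in> germ_at M p h \<and> jet_at M Y k p h = jet_at M Y k p f)"
    using 1 by (auto simp: carrier_stalk jet_at_def)
  also have "\<dots> \<longleftrightarrow> g \<in> carrier (near_ring M p) \<and> jet_at M Y k p g = jet_at M Y k p f"
    using 2 unfolding jet_at_def by metis
  finally show ?thesis .
qed

text \<open>The transition maps of the inverse system are encoded as inclusions of cosets; this turns such an inclusion
  into an equality of jets of the lower order.\<close>

lemma jet_at_subset_iff:
  assumes p: "p \<in> pts M" and f: "f \<in> carrier (near_ring M p)" and g: "g \<in> carrier (near_ring M p)"
  shows "jet_at M Y (Suc k) p f \<subseteq> jet_at M Y k p g \<longleftrightarrow> jet_at M Y k p f = jet_at M Y k p g"
proof
  assume "jet_at M Y (Suc k) p f \<subseteq> jet_at M Y k p g"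
  moreover have "f \<in> \<Union> (jet_at M Y (Suc k) p f)" using mem_jet_at_iff[OF p f] f by blast
  ultimately have "f \<in> \<Union> (jet_at M Y k p g)" by blast
  then show "jet_at M Y k p f = jet_at M Y k p g" using mem_jet_at_iff[OF p g] by blast
next
  interpret cring "stalk M p" by (rule cring_stalk[OF p])
  have "jet_ideal M Y (Suc k) p \<subseteq> jet_ideal M Y k p"
    by (rule ideal_power_Suc_subset[OF ideal_ideal_stalk[OF p]])
  then have "jet_at M Y (Suc k) p f \<subseteq> jet_at M Y k p f"
    by (auto simp: jet_at_def a_r_coset_def')
  then show "jet_at M Y k p f = jet_at M Y k p g \<Longrightarrow> jet_at M Y (Suc k) p f \<subseteq> jet_at M Y k p g" by simp
qed

text \<open>The property of a holomorphic map by which it acts on germs, free of charts.\<close>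

definition pullback_map :: "('a, 'n::finite) cmfd \<Rightarrow> ('b, 'm::finite) cmfd \<Rightarrow> ('a \<Rightarrow> 'b) \<Rightarrow> bool" where
  "pullback_map M M' F \<longleftrightarrow> continuous_map (mtop M) (mtop M') F \<and>
     (\<forall>U f. openin (mtop M') U \<longrightarrow> holo_on_mfd M' U f \<longrightarrow> holo_on_mfd M {p \<in> pts M. F p \<in> U} (f \<circ> F))"

lemma holo_map_pullback_map:
  "charted M \<Longrightarrow> charted M' \<Longrightarrow> holo_map M M' F \<Longrightarrow> pullback_map M M' F"
  using holo_on_mfd_pullback unfolding pullback_map_def holo_map_def by blast

lemma pullback_map_pts: "pullback_map M M' F \<Longrightarrow> p \<in> pts M \<Longrightarrow> F p \<in> pts M'"
  unfolding pullback_map_def continuous_map_def by blast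

lemma pullback_map_openin:
  "pullback_map M M' F \<Longrightarrow> openin (mtop M') U \<Longrightarrow> openin (mtop M) {p \<in> pts M. F p \<in> U}"
  unfolding pullback_map_def continuous_map_def by blast

lemma pullback_map_holo:
  "pullback_map M M' F \<Longrightarrow> openin (mtop M') U \<Longrightarrow> holo_on_mfd M' U f \<Longrightarrow>
   holo_on_mfd M {p \<in> pts M. F p \<in> U} (f \<circ> F)"
  unfolding pullback_map_def by blast

lemma pullback_near_ring:
  assumes F: "pullback_map M M' F" and p: "p \<in> pts M" and f: "f \<in> carrier (near_ring M' (F p))"
  shows "f \<circ> F \<in> carrier (near_ring M p)"
proof -
  obtain U where U: "openin (mtop M') U" "F p \<in> U" "holo_on_mfd M' U f"
    using f unfolding carrier_near_ring by blast
  have "openin (mtop M) {p \<in> pts M. F p \<in> U}" "holo_on_mfd M {p \<in> pts M. F p \<in> U} (f \<circ> F)"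
    using pullback_map_openin[OF F U(1)] pullback_map_holo[OF F U(1,3)] by auto
  moreover have "p \<in> {p \<in> pts M. F p \<in> U}" using p U by simp
  ultimately show ?thesis unfolding carrier_near_ring by blast
qed

lemma germ_pullback_cong:
  assumes F: "pullback_map M M' F" and p: "p \<in> pts M"
    and f: "f \<in> carrier (near_ring M' (F p))" and g: "g \<in> carrier (near_ring M' (F p))"
    and eq: "germ_at M' (F p) f = germ_at M' (F p) g"
  shows "germ_at M p (f \<circ> F) = germ_at M p (g \<circ> F)"
proof -
  have p': "F p \<in> pts M'" by (rule pullback_map_pts[OF F p])
  obtain U where U: "openin (mtop M') U" "F p \<in> U" "\<forall>z\<in>U. f z = g z"
    using eq germ_at_eq_iff[OF p' f g] by blast
  then have "openin (mtop M) {p \<in> pts M. F p \<in> U}" by (intro pullback_map_openin[OF F])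
  then show ?thesis
    using germ_at_eq_iff[OF p pullback_near_ring[OF F p f] pullback_near_ring[OF F p g]] U p by auto
qed

text \<open>Functions vanishing on \<open>Y'\<close> are pulled back to functions vanishing on \<open>Y\<close>, and pulling back respects sums and
  products, so by induction it respects the powers of the vanishing ideals.  Since the elements of the stalk are
  cosets, the inner induction on the generation of the product ideal is carried out for all representatives \<open>f\<close> of
  an element at once.\<close>

lemma germ_pullback_jet_ideal:
  assumes F: "pullback_map M M' F" and p: "p \<in> pts M" and FY: "\<And>q. q \<in> pts M \<Longrightarrow> q \<in> Y \<Longrightarrow> F q \<in> Y'"
    and f: "f \<in> carrier (near_ring M' (F p))" and k: "germ_at M' (F p) f \<in> jet_ideal M' Y' k (F p)"
  shows "germ_at M p (f \<circ> F) \<in> jet_ideal M Y k p"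
  using f k
proof (induction k arbitrary: f)
  case 0
  then show ?case
    using germ_at_closed[OF pullback_near_ring[OF F p 0(1)]] unfolding ideal_power_0 by blast
next
  case (Suc k)
  have p': "F p \<in> pts M'" by (rule pullback_map_pts[OF F p])
  interpret R: cring "stalk M p" by (rule cring_stalk[OF p])
  interpret R': cring "stalk M' (F p)" by (rule cring_stalk[OF p'])
  note h = ring_hom_mult[OF germ_hom[OF p]] ring_hom_add[OF germ_hom[OF p]]
  note h' = ring_hom_mult[OF germ_hom[OF p']] ring_hom_add[OF germ_hom[OF p']]
  have "\<And>f. f \<in> carrier (near_ring M' (F p)) \<Longrightarrow> germ_at M' (F p) f = x \<Longrightarrow>
      germ_at M p (f \<circ> F) \<in> ideal_prod (stalk M p) (ideal_stalk M Y p) (jet_ideal M Y k p)"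
    if "x \<in> ideal_prod (stalk M' (F p)) (ideal_stalk M' Y' (F p)) (jet_ideal M' Y' k (F p))" for x
    using that
  proof (induction x)
    case (prod i j)
    obtain a U where a: "i = germ_at M' (F p) a" "a \<in> carrier (near_ring M' (F p))"
      and U: "openin (mtop M') U" "F p \<in> U" "\<forall>z\<in>U \<inter> Y'. a z = 0"
      using prod(1) unfolding ideal_stalk_def by blast
    have "j \<in> carrier (stalk M' (F p))"
      using ideal.Icarr[OF ideal_jet_ideal[OF p'] prod(2)] .
    then obtain b where b: "j = germ_at M' (F p) b" "b \<in> carrier (near_ring M' (F p))"
      by (auto simp: carrier_stalk)
    have ab: "(\<lambda>z. a z * b z) \<in> carrier (near_ring M' (F p))" by (rule mult_near_ring[OF a(2) b(2)])
    note aF = pullback_near_ring[OF F p a(2)] and bF = pullback_near_ring[OF F p b(2)]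
    have "germ_at M' (F p) f = germ_at M' (F p) (\<lambda>z. a z * b z)"
      using prod(4) h'(1)[OF a(2) b(2)] a(1) b(1) by simp
    then have "germ_at M p (f \<circ> F) = germ_at M p ((\<lambda>z. a z * b z) \<circ> F)"
      by (rule germ_pullback_cong[OF F p prod(3) ab])
    also have "\<dots> = germ_at M p (a \<circ> F) \<otimes>\<^bsub>stalk M p\<^esub> germ_at M p (b \<circ> F)"
      using h(1)[OF aF bF] by (simp add: o_def)
    also have "\<dots> \<in> ideal_prod (stalk M p) (ideal_stalk M Y p) (jet_ideal M Y k p)"
    proof (rule ideal_prod.prod)
      show "germ_at M p (b \<circ> F) \<in> jet_ideal M Y k p" using Suc.IH[OF b(2)] b(1) prod(2) by blast
      have "openin (mtop M) {q \<in> pts M. F q \<in> U}" by (rule pullback_map_openin[OF F U(1)])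
      moreover have "\<forall>z\<in>{q \<in> pts M. F q \<in> U} \<inter> Y. (a \<circ> F) z = 0" using U FY by auto
      moreover have "p \<in> {q \<in> pts M. F q \<in> U}" using p U by simp
      ultimately show "germ_at M p (a \<circ> F) \<in> ideal_stalk M Y p"
        unfolding ideal_stalk_def using aF by blast
    qed
    finally show ?case .
  next
    case (sum s1 s2)
    have "s1 \<in> carrier (stalk M' (F p))" "s2 \<in> carrier (stalk M' (F p))"
      using R'.ideal_prod_in_carrier[OF ideal_ideal_stalk[OF p'] ideal_jet_ideal[OF p']] sum(1,2) by blast+
    then obtain a b where a: "s1 = germ_at M' (F p) a" "a \<in> carrier (near_ring M' (F p))"
      and b: "s2 = germ_at M' (F p) b" "b \<in> carrier (near_ring M' (F p))"
      by (auto simp: carrier_stalk)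
    have ab: "(\<lambda>z. a z + b z) \<in> carrier (near_ring M' (F p))" by (rule add_near_ring[OF a(2) b(2)])
    note aF = pullback_near_ring[OF F p a(2)] and bF = pullback_near_ring[OF F p b(2)]
    have "germ_at M' (F p) f = germ_at M' (F p) (\<lambda>z. a z + b z)"
      using sum(6) h'(2)[OF a(2) b(2)] a(1) b(1) by simp
    then have "germ_at M p (f \<circ> F) = germ_at M p ((\<lambda>z. a z + b z) \<circ> F)"
      by (rule germ_pullback_cong[OF F p sum(5) ab])
    also have "\<dots> = germ_at M p (a \<circ> F) \<oplus>\<^bsub>stalk M p\<^esub> germ_at M p (b \<circ> F)"
      using h(2)[OF aF bF] by (simp add: o_def)
    also have "\<dots> \<in> ideal_prod (stalk M p) (ideal_stalk M Y p) (jet_ideal M Y k p)"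
      by (rule ideal_prod.sum[OF sum(3)[OF a(2) a(1)[symmetric]] sum(4)[OF b(2) b(1)[symmetric]]])
    finally show ?case .
  qed
  then show ?case using Suc.prems unfolding ideal_power_Suc by blast
qed

text \<open>All representatives of a jet have the same pulled back jet, so that \<open>jet_pullback\<close> takes the element of a
  singleton.\<close>

lemma jet_pullback_jet_at:
  assumes F: "pullback_map M M' F" and p: "p \<in> pts M" and FY: "\<And>q. q \<in> pts M \<Longrightarrow> q \<in> Y \<Longrightarrow> F q \<in> Y'"
    and f: "f \<in> carrier (near_ring M' (F p))"
  shows "jet_pullback M Y F k p (jet_at M' Y' k (F p) f) = jet_at M Y k p (f \<circ> F)"
proof -
  have p': "F p \<in> pts M'" by (rule pullback_map_pts[OF F p])
  interpret R': cring "near_ring M' (F p)" by (rule cring_near_ring[OF p'])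
  have "jet_at M Y k p (g \<circ> F) = jet_at M Y k p (f \<circ> F)" if "g \<in> \<Union> (jet_at M' Y' k (F p) f)" for g
  proof -
    have g: "g \<in> carrier (near_ring M' (F p))" and eq: "jet_at M' Y' k (F p) g = jet_at M' Y' k (F p) f"
      using that mem_jet_at_iff[OF p' f] by blast+
    have "(\<lambda>z. g z - f z) \<in> carrier (near_ring M' (F p))"
      using R'.minus_closed[OF g f] near_ring_minus[OF p' g f] by simp
    moreover have "germ_at M' (F p) (\<lambda>z. g z - f z) \<in> jet_ideal M' Y' k (F p)"
      using eq jet_at_eq_iff[OF p' g f] by blast
    ultimately have "germ_at M p ((\<lambda>z. g z - f z) \<circ> F) \<in> jet_ideal M Y k p"
      using germ_pullback_jet_ideal[OF F p, of Y Y'] FY by blast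
    then show ?thesis
      using jet_at_eq_iff[OF p pullback_near_ring[OF F p g] pullback_near_ring[OF F p f]] by (simp add: o_def)
  qed
  moreover have "f \<in> \<Union> (jet_at M' Y' k (F p) f)" using mem_jet_at_iff[OF p' f] f by blast
  ultimately have "(\<lambda>g. jet_at M Y k p (g \<circ> F)) ` \<Union> (jet_at M' Y' k (F p) f) = {jet_at M Y k p (f \<circ> F)}"
    by blast
  then show ?thesis by (simp add: jet_pullback_def)
qed

section \<open>The structure sheaf of a formal completion\<close>

lemma formal_sections_ops:
  "S \<otimes>\<^bsub>formal_sections M Y U\<^esub> T = (\<lambda>n. \<lambda>p\<in>U. S n p \<otimes>\<^bsub>jet_ring M Y (Suc n) p\<^esub> T n p)"
  "S \<oplus>\<^bsub>formal_sections M Y U\<^esub> T = (\<lambda>n. \<lambda>p\<in>U. S n p \<oplus>\<^bsub>jet_ring M Y (Suc n) p\<^esub> T n p)"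
  "\<one>\<^bsub>formal_sections M Y U\<^esub> = (\<lambda>n. \<lambda>p\<in>U. \<one>\<^bsub>jet_ring M Y (Suc n) p\<^esub>)"
  "\<zero>\<^bsub>formal_sections M Y U\<^esub> = (\<lambda>n. \<lambda>p\<in>U. \<zero>\<^bsub>jet_ring M Y (Suc n) p\<^esub>)"
  by (simp_all add: formal_sections_def)

lemma holo_near_ring:
  "openin (mtop M) V \<Longrightarrow> p \<in> V \<Longrightarrow> holo_on_mfd M V f \<Longrightarrow> f \<in> carrier (near_ring M p)"
  unfolding carrier_near_ring by blast

lemma jet_ops:
  assumes p: "p \<in> pts M"
  shows "f \<in> carrier (near_ring M p) \<Longrightarrow> g \<in> carrier (near_ring M p) \<Longrightarrow>
      jet_at M Y k p f \<otimes>\<^bsub>jet_ring M Y k p\<^esub> jet_at M Y k p g = jet_at M Y k p (\<lambda>z. f z * g z)"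
    and "f \<in> carrier (near_ring M p) \<Longrightarrow> g \<in> carrier (near_ring M p) \<Longrightarrow>
      jet_at M Y k p f \<oplus>\<^bsub>jet_ring M Y k p\<^esub> jet_at M Y k p g = jet_at M Y k p (\<lambda>z. f z + g z)"
    and "\<one>\<^bsub>jet_ring M Y k p\<^esub> = jet_at M Y k p (\<lambda>z. 1)"
    and "\<zero>\<^bsub>jet_ring M Y k p\<^esub> = jet_at M Y k p (\<lambda>z. 0)"
proof -
  note h = jet_hom[OF p, of Y k]
  interpret R: cring "near_ring M p" by (rule cring_near_ring[OF p])
  interpret S: cring "jet_ring M Y k p" by (rule cring_jet_ring[OF p])
  interpret h: ring_hom_cring "near_ring M p" "jet_ring M Y k p" "jet_at M Y k p"
    using h by unfold_locales
  show "f \<in> carrier (near_ring M p) \<Longrightarrow> g \<in> carrier (near_ring M p) \<Longrightarrow>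
      jet_at M Y k p f \<otimes>\<^bsub>jet_ring M Y k p\<^esub> jet_at M Y k p g = jet_at M Y k p (\<lambda>z. f z * g z)"
    "f \<in> carrier (near_ring M p) \<Longrightarrow> g \<in> carrier (near_ring M p) \<Longrightarrow>
      jet_at M Y k p f \<oplus>\<^bsub>jet_ring M Y k p\<^esub> jet_at M Y k p g = jet_at M Y k p (\<lambda>z. f z + g z)"
    using ring_hom_mult[OF h] ring_hom_add[OF h] by simp_all
  show "\<one>\<^bsub>jet_ring M Y k p\<^esub> = jet_at M Y k p (\<lambda>z. 1)"
    using ring_hom_one[OF h] by simp
  show "\<zero>\<^bsub>jet_ring M Y k p\<^esub> = jet_at M Y k p (\<lambda>z. 0)"
    using h.hom_zero by simp
qed

lemma formal_sections_extensional:
  "S \<in> carrier (formal_sections M Y U) \<Longrightarrow> S n \<in> extensional U"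
  by (simp add: formal_sections_def jet_sections_def)

lemma formal_sections_local:
  assumes "S \<in> carrier (formal_sections M Y U)" "p \<in> U"
  obtains V f where "openin (mtop M) V" "p \<in> V" "holo_on_mfd M V f"
    "\<forall>q\<in>V \<inter> U. S n q = jet_at M Y (Suc n) q f"
proof -
  have "S n \<in> jet_sections M Y (Suc n) U" using assms by (simp add: formal_sections_def)
  then have "\<exists>V f. openin (mtop M) V \<and> p \<in> V \<and> holo_on_mfd M V f \<and>
      (\<forall>q\<in>V \<inter> U. S n q = jet_at M Y (Suc n) q f)"
    using assms(2) unfolding jet_sections_def by simp
  then obtain V f where "openin (mtop M) V" "p \<in> V" "holo_on_mfd M V f"
    "\<forall>q\<in>V \<inter> U. S n q = jet_at M Y (Suc n) q f" by (elim exE conjE)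
  then show ?thesis by (intro that[of V f]) simp_all
qed

text \<open>Consecutive members of a formal section are cosets one of which contains the other; hence at every point they
  are jets of one function.  This reduces calculations with formal sections to calculations with functions.\<close>

lemma formal_sections_jet:
  assumes U: "U \<subseteq> pts M" and S: "S \<in> carrier (formal_sections M Y U)" and p: "p \<in> U"
  obtains f where "f \<in> carrier (near_ring M p)" "S n p = jet_at M Y (Suc n) p f"
    "S (Suc n) p = jet_at M Y (Suc (Suc n)) p f"
proof -
  obtain V f where f: "openin (mtop M) V" "p \<in> V" "holo_on_mfd M V f"
    "\<forall>q\<in>V \<inter> U. S (Suc n) q = jet_at M Y (Suc (Suc n)) q f"
    by (rule formal_sections_local[OF S p, where n="Suc n"])
  obtain W g where g: "openin (mtop M) W" "p \<in> W" "holo_on_mfd M W g"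
    "\<forall>q\<in>W \<inter> U. S n q = jet_at M Y (Suc n) q g"
    by (rule formal_sections_local[OF S p, where n=n])
  have nf: "f \<in> carrier (near_ring M p)" and ng: "g \<in> carrier (near_ring M p)"
    by (rule holo_near_ring[OF f(1-3)], rule holo_near_ring[OF g(1-3)])
  have "S (Suc n) p \<subseteq> S n p" using S p by (simp add: formal_sections_def)
  then have "jet_at M Y (Suc n) p f = jet_at M Y (Suc n) p g"
    using jet_at_subset_iff[OF _ nf ng] p U f(2,4) g(2,4) p by auto
  then show ?thesis using that[OF nf] f(2,4) g(2,4) p by simp
qed

lemma formal_sectionsI:
  assumes U: "U \<subseteq> pts M" and ext: "\<And>n. S n \<in> extensional U"
    and loc: "\<And>n p. p \<in> U \<Longrightarrow> \<exists>V f. openin (mtop M) V \<and> p \<in> V \<and> holo_on_mfd M V f \<and>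
      (\<forall>q\<in>V \<inter> U. S n q = jet_at M Y (Suc n) q f)"
    and comp: "\<And>n p. p \<in> U \<Longrightarrow> \<exists>f\<in>carrier (near_ring M p).
      S n p = jet_at M Y (Suc n) p f \<and> S (Suc n) p = jet_at M Y (Suc (Suc n)) p f"
  shows "S \<in> carrier (formal_sections M Y U)"
proof -
  have "S (Suc n) p \<subseteq> S n p" if p: "p \<in> U" for n p
  proof -
    obtain f where "f \<in> carrier (near_ring M p)" "S n p = jet_at M Y (Suc n) p f"
      "S (Suc n) p = jet_at M Y (Suc (Suc n)) p f"
      using comp[OF p, where n=n] by (elim bexE conjE)
    then show ?thesis using jet_at_subset_iff[of p M f f Y "Suc n"] p U by auto
  qed
  then show ?thesis using ext loc by (simp add: formal_sections_def jet_sections_def)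
qed

text \<open>The closure argument that addition and multiplication share: \<open>op\<close> is an operation on jets that is induced by the
  operation \<open>b\<close> on values of functions.\<close>

lemma formal_sections_binop:
  assumes U: "U \<subseteq> pts M"
    and S: "S \<in> carrier (formal_sections M Y U)" and T: "T \<in> carrier (formal_sections M Y U)"
    and holo: "\<And>V f g. holo_on_mfd M V f \<Longrightarrow> holo_on_mfd M V g \<Longrightarrow> holo_on_mfd M V (\<lambda>z. b (f z) (g z))"
    and op: "\<And>k p f g. p \<in> pts M \<Longrightarrow> f \<in> carrier (near_ring M p) \<Longrightarrow> g \<in> carrier (near_ring M p) \<Longrightarrow>
      op k p (jet_at M Y k p f) (jet_at M Y k p g) = jet_at M Y k p (\<lambda>z. b (f z) (g z))"
  shows "(\<lambda>n. \<lambda>p\<in>U. op (Suc n) p (S n p) (T n p)) \<in> carrier (formal_sections M Y U)"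
proof (rule formal_sectionsI[OF U])
  fix n p assume p: "p \<in> U"
  obtain V f where f: "openin (mtop M) V" "p \<in> V" "holo_on_mfd M V f"
    "\<forall>q\<in>V \<inter> U. S n q = jet_at M Y (Suc n) q f"
    by (rule formal_sections_local[OF S p, where n=n])
  obtain W g where g: "openin (mtop M) W" "p \<in> W" "holo_on_mfd M W g"
    "\<forall>q\<in>W \<inter> U. T n q = jet_at M Y (Suc n) q g"
    by (rule formal_sections_local[OF T p, where n=n])
  have "holo_on_mfd M (V \<inter> W) (\<lambda>z. b (f z) (g z))"
    using f(3) g(3) by (intro holo) (auto elim: holo_on_mfd_subset)
  moreover have "op (Suc n) q (S n q) (T n q) = jet_at M Y (Suc n) q (\<lambda>z. b (f z) (g z))"
    if "q \<in> V \<inter> W \<inter> U" for q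
  proof -
    have "f \<in> carrier (near_ring M q)" "g \<in> carrier (near_ring M q)"
      using that f(1,3) g(1,3) holo_near_ring[of M] by auto
    then show ?thesis using op[of q f g] that U f(4) g(4) by auto
  qed
  ultimately show "\<exists>V f. openin (mtop M) V \<and> p \<in> V \<and> holo_on_mfd M V f \<and>
      (\<forall>q\<in>V \<inter> U. (\<lambda>p\<in>U. op (Suc n) p (S n p) (T n p)) q = jet_at M Y (Suc n) q f)"
    using f(1,2) g(1,2)
    by (intro exI[of _ "V \<inter> W"] exI[of _ "\<lambda>z. b (f z) (g z)"]) auto
next
  fix n p assume p: "p \<in> U"
  obtain f where f: "f \<in> carrier (near_ring M p)" "S n p = jet_at M Y (Suc n) p f"
    "S (Suc n) p = jet_at M Y (Suc (Suc n)) p f"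
    by (rule formal_sections_jet[OF U S p, where n=n])
  obtain g where g: "g \<in> carrier (near_ring M p)" "T n p = jet_at M Y (Suc n) p g"
    "T (Suc n) p = jet_at M Y (Suc (Suc n)) p g"
    by (rule formal_sections_jet[OF U T p, where n=n])
  obtain V where V: "openin (mtop M) V" "p \<in> V" "holo_on_mfd M V f"
    using f(1) unfolding carrier_near_ring by blast
  obtain W where W: "openin (mtop M) W" "p \<in> W" "holo_on_mfd M W g"
    using g(1) unfolding carrier_near_ring by blast
  have "holo_on_mfd M (V \<inter> W) (\<lambda>z. b (f z) (g z))"
    using V W by (intro holo) (auto elim: holo_on_mfd_subset)
  then have "(\<lambda>z. b (f z) (g z)) \<in> carrier (near_ring M p)"
    using V W by (intro holo_near_ring[of M "V \<inter> W"]) auto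
  then show "\<exists>h\<in>carrier (near_ring M p).
      (\<lambda>p\<in>U. op (Suc n) p (S n p) (T n p)) p = jet_at M Y (Suc n) p h \<and>
      (\<lambda>p\<in>U. op (Suc (Suc n)) p (S (Suc n) p) (T (Suc n) p)) p = jet_at M Y (Suc (Suc n)) p h"
    using f g op[of p f g] p U by (intro bexI[of _ "\<lambda>z. b (f z) (g z)"]) auto
qed auto

lemma formal_sections_const:
  assumes U: "U \<subseteq> pts M"
  shows "(\<lambda>n. \<lambda>p\<in>U. jet_at M Y (Suc n) p (\<lambda>z. a)) \<in> carrier (formal_sections M Y U)"
proof (rule formal_sectionsI[OF U])
  fix n p assume p: "p \<in> U"
  show "\<exists>V f. openin (mtop M) V \<and> p \<in> V \<and> holo_on_mfd M V f \<and>
      (\<forall>q\<in>V \<inter> U. (\<lambda>p\<in>U. jet_at M Y (Suc n) p (\<lambda>z. a)) q = jet_at M Y (Suc n) q f)"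
    using p U holo_on_mfd_const by (intro exI[of _ "pts M"] exI[of _ "\<lambda>z. a"]) auto
  show "\<exists>h\<in>carrier (near_ring M p).
      (\<lambda>p\<in>U. jet_at M Y (Suc n) p (\<lambda>z. a)) p = jet_at M Y (Suc n) p h \<and>
      (\<lambda>p\<in>U. jet_at M Y (Suc (Suc n)) p (\<lambda>z. a)) p = jet_at M Y (Suc (Suc n)) p h"
    using p U by (intro bexI[of _ "\<lambda>z. a"] const_near_ring) auto
qed auto

lemma formal_sections_in_jet_ring:
  assumes "U \<subseteq> pts M" "S \<in> carrier (formal_sections M Y U)" "p \<in> U"
  shows "S n p \<in> carrier (jet_ring M Y (Suc n) p)"
  by (rule formal_sections_jet[OF assms, where n=n]) (simp add: carrier_jet_ring)

lemma formal_sections_eqI: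
  assumes "S \<in> carrier (formal_sections M Y U)" "T \<in> carrier (formal_sections M Y U)"
    "\<And>n p. p \<in> U \<Longrightarrow> S n p = T n p"
  shows "S = T"
proof
  fix n show "S n = T n"
    by (rule extensionalityI[OF formal_sections_extensional[OF assms(1)] formal_sections_extensional[OF assms(2)]])
       (rule assms(3))
qed

lemma formal_sections_closed:
  assumes U: "U \<subseteq> pts M"
  shows "S \<in> carrier (formal_sections M Y U) \<Longrightarrow> T \<in> carrier (formal_sections M Y U) \<Longrightarrow>
      S \<otimes>\<^bsub>formal_sections M Y U\<^esub> T \<in> carrier (formal_sections M Y U)"
    and "S \<in> carrier (formal_sections M Y U) \<Longrightarrow> T \<in> carrier (formal_sections M Y U) \<Longrightarrow>
      S \<oplus>\<^bsub>formal_sections M Y U\<^esub> T \<in> carrier (formal_sections M Y U)"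
    and "\<one>\<^bsub>formal_sections M Y U\<^esub> \<in> carrier (formal_sections M Y U)"
    and "\<zero>\<^bsub>formal_sections M Y U\<^esub> \<in> carrier (formal_sections M Y U)"
proof -
  have *: "(\<lambda>p\<in>U. \<one>\<^bsub>jet_ring M Y (Suc n) p\<^esub>) = (\<lambda>p\<in>U. jet_at M Y (Suc n) p (\<lambda>z. 1))"
    "(\<lambda>p\<in>U. \<zero>\<^bsub>jet_ring M Y (Suc n) p\<^esub>) = (\<lambda>p\<in>U. jet_at M Y (Suc n) p (\<lambda>z. 0))" for n
    by (rule restrict_ext, rule jet_ops(3), erule subsetD[OF U],
        rule restrict_ext, rule jet_ops(4), erule subsetD[OF U])
  show "\<one>\<^bsub>formal_sections M Y U\<^esub> \<in> carrier (formal_sections M Y U)"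
    "\<zero>\<^bsub>formal_sections M Y U\<^esub> \<in> carrier (formal_sections M Y U)"
    unfolding formal_sections_ops * by (rule formal_sections_const[OF U])+
  show "S \<in> carrier (formal_sections M Y U) \<Longrightarrow> T \<in> carrier (formal_sections M Y U) \<Longrightarrow>
      S \<otimes>\<^bsub>formal_sections M Y U\<^esub> T \<in> carrier (formal_sections M Y U)"
    unfolding formal_sections_ops
    by (rule formal_sections_binop[OF U, where b="(*)" and op="\<lambda>k p. mult (jet_ring M Y k p)"])
       (auto simp: jet_ops holo_on_mfd_mult)
  show "S \<in> carrier (formal_sections M Y U) \<Longrightarrow> T \<in> carrier (formal_sections M Y U) \<Longrightarrow>
      S \<oplus>\<^bsub>formal_sections M Y U\<^esub> T \<in> carrier (formal_sections M Y U)"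
    unfolding formal_sections_ops
    by (rule formal_sections_binop[OF U, where b="(+)" and op="\<lambda>k p. add (jet_ring M Y k p)"])
       (auto simp: jet_ops holo_on_mfd_add)
qed

text \<open>A section is determined by its values, so every ring axiom is the same axiom in the rings of jets.\<close>

lemma cring_formal_sections:
  assumes U: "U \<subseteq> pts M"
  shows "cring (formal_sections M Y U)"
proof -
  let ?R = "formal_sections M Y U"
  note cl = formal_sections_closed[OF U]
  note inj = formal_sections_in_jet_ring[OF U]
  note ops = formal_sections_ops
  note eqI = formal_sections_eqI[where M=M and Y=Y and U=U]
  have J: "cring (jet_ring M Y k p)" if "p \<in> U" for k p by (rule cring_jet_ring) (use that U in blast)
  note Jr = cring.axioms(1)[OF J]
  show ?thesis
  proof (rule cringI)
    show "abelian_group ?R"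
    proof (rule abelian_groupI)
      fix S T Z assume S: "S \<in> carrier ?R" and T: "T \<in> carrier ?R" and Z: "Z \<in> carrier ?R"
      show "S \<oplus>\<^bsub>?R\<^esub> T \<oplus>\<^bsub>?R\<^esub> Z = S \<oplus>\<^bsub>?R\<^esub> (T \<oplus>\<^bsub>?R\<^esub> Z)"
        by (intro eqI cl S T Z) (simp add: ops abelian_monoid.a_assoc[OF abelian_group.axioms(1)[OF ring.is_abelian_group[OF Jr]]] inj S T Z)
      show "S \<oplus>\<^bsub>?R\<^esub> T = T \<oplus>\<^bsub>?R\<^esub> S"
        by (intro eqI cl S T) (simp add: ops abelian_monoid.a_comm[OF abelian_group.axioms(1)[OF ring.is_abelian_group[OF Jr]]] inj S T)
      show "\<zero>\<^bsub>?R\<^esub> \<oplus>\<^bsub>?R\<^esub> S = S"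
        by (intro eqI cl S) (simp add: ops abelian_monoid.l_zero[OF abelian_group.axioms(1)[OF ring.is_abelian_group[OF Jr]]] inj S)
      (* the negative of S is its product with the constant section -1 *)
      have c: "(\<lambda>n. \<lambda>p\<in>U. jet_at M Y (Suc n) p (\<lambda>z. -1)) \<in> carrier ?R" (is "?m \<in> _")
        by (rule formal_sections_const[OF U])
      have "(?m \<otimes>\<^bsub>?R\<^esub> S) \<oplus>\<^bsub>?R\<^esub> S = \<zero>\<^bsub>?R\<^esub>"
      proof (rule eqI)
        fix n p assume p: "p \<in> U"
        then have pM: "p \<in> pts M" using U by blast
        obtain f where f: "f \<in> carrier (near_ring M p)" "S n p = jet_at M Y (Suc n) p f"
          by (rule formal_sections_jet[OF U S p, where n=n])
        have "(\<lambda>z. -1 * f z) \<in> carrier (near_ring M p)"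
          by (rule mult_near_ring[OF const_near_ring[OF pM] f(1)])
        then show "((?m \<otimes>\<^bsub>?R\<^esub> S) \<oplus>\<^bsub>?R\<^esub> S) n p = \<zero>\<^bsub>?R\<^esub> n p"
          using p pM f jet_ops(1)[OF pM const_near_ring[OF pM] f(1)] jet_ops(2)[OF pM _ f(1)]
          by (simp add: ops jet_ops(4))
      qed (intro cl S c)+
      then show "\<exists>T\<in>carrier ?R. T \<oplus>\<^bsub>?R\<^esub> S = \<zero>\<^bsub>?R\<^esub>" using cl(1)[OF c S] by blast
    qed (simp_all add: cl)
    show "comm_monoid ?R"
    proof (rule comm_monoidI)
      fix S T Z assume S: "S \<in> carrier ?R" and T: "T \<in> carrier ?R" and Z: "Z \<in> carrier ?R"
      show "S \<otimes>\<^bsub>?R\<^esub> T \<otimes>\<^bsub>?R\<^esub> Z = S \<otimes>\<^bsub>?R\<^esub> (T \<otimes>\<^bsub>?R\<^esub> Z)"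
        by (intro eqI cl S T Z) (simp add: ops monoid.m_assoc[OF ring.is_monoid[OF Jr]] inj S T Z)
    next
      fix S T assume S: "S \<in> carrier ?R" and T: "T \<in> carrier ?R"
      show "S \<otimes>\<^bsub>?R\<^esub> T = T \<otimes>\<^bsub>?R\<^esub> S"
        by (intro eqI cl S T) (simp add: ops comm_monoid.m_comm[OF cring.axioms(2)[OF J]] inj S T)
      show "\<one>\<^bsub>?R\<^esub> \<otimes>\<^bsub>?R\<^esub> S = S"
        by (intro eqI cl S) (simp add: ops monoid.l_one[OF ring.is_monoid[OF Jr]] inj S)
    qed (simp_all add: cl)
    fix S T Z assume S: "S \<in> carrier ?R" and T: "T \<in> carrier ?R" and Z: "Z \<in> carrier ?R"
    show "(S \<oplus>\<^bsub>?R\<^esub> T) \<otimes>\<^bsub>?R\<^esub> Z = S \<otimes>\<^bsub>?R\<^esub> Z \<oplus>\<^bsub>?R\<^esub> T \<otimes>\<^bsub>?R\<^esub> Z"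
      by (intro eqI cl S T Z) (simp add: ops ring.ring_simprules(13)[OF Jr] inj S T Z)
  qed
qed

lemma formal_completion_simps [simp]:
  "rs_top (formal_completion M Y) = subtopology (mtop M) Y"
  "rs_sec (formal_completion M Y) = formal_sections M Y"
  "rs_res (formal_completion M Y) U V S n = restrict (S n) V"
  "rs_scal (formal_completion M Y) U a = (\<lambda>n. \<lambda>p\<in>U. jet_at M Y (Suc n) p (\<lambda>z. a))"
  by (simp_all add: formal_completion_def)

lemma formal_sections_restrict:
  assumes U: "U \<subseteq> pts M" and V: "V \<subseteq> U" and S: "S \<in> carrier (formal_sections M Y U)"
  shows "(\<lambda>n. restrict (S n) V) \<in> carrier (formal_sections M Y V)"
proof (rule formal_sectionsI)
  fix n p assume p: "p \<in> V"
  then have pU: "p \<in> U" using V by blast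
  obtain W f where f: "openin (mtop M) W" "p \<in> W" "holo_on_mfd M W f"
    "\<forall>q\<in>W \<inter> U. S n q = jet_at M Y (Suc n) q f"
    by (rule formal_sections_local[OF S pU, where n=n])
  then show "\<exists>W f. openin (mtop M) W \<and> p \<in> W \<and> holo_on_mfd M W f \<and>
      (\<forall>q\<in>W \<inter> V. restrict (S n) V q = jet_at M Y (Suc n) q f)"
    using V by (intro exI[of _ W] exI[of _ f]) auto
  show "\<exists>f\<in>carrier (near_ring M p). restrict (S n) V p = jet_at M Y (Suc n) p f \<and>
      restrict (S (Suc n)) V p = jet_at M Y (Suc (Suc n)) p f"
    by (rule formal_sections_jet[OF U S pU, where n=n]) (use p in auto)
qed (use U V in auto)

text \<open>Sections are glued point by point.  The result is a section because a relatively open subset of \<open>Y\<close> is the trace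
  of an open subset of \<open>M\<close>, to which the functions that induce the given sections can be restricted.\<close>

lemma formal_sections_gluing:
  assumes Y: "Y \<subseteq> pts M"
    and s: "\<And>U. U \<in> \<U> \<Longrightarrow> openin (subtopology (mtop M) Y) U \<and> s U \<in> carrier (formal_sections M Y U)"
    and agree: "\<And>U V n p. U \<in> \<U> \<Longrightarrow> V \<in> \<U> \<Longrightarrow> p \<in> U \<Longrightarrow> p \<in> V \<Longrightarrow> s U n p = s V n p"
  shows "\<exists>t\<in>carrier (formal_sections M Y (\<Union>\<U>)). \<forall>U\<in>\<U>. \<forall>n. restrict (t n) U = s U n"
proof
  define t where "t = (\<lambda>n. \<lambda>p\<in>\<Union>\<U>. s (SOME U. U \<in> \<U> \<and> p \<in> U) n p)"
  have t: "t n p = s U n p" if "U \<in> \<U>" "p \<in> U" for n p U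
  proof -
    define V where "V = (SOME U. U \<in> \<U> \<and> p \<in> U)"
    have V: "V \<in> \<U>" "p \<in> V"
      using someI[of "\<lambda>U. U \<in> \<U> \<and> p \<in> U", OF conjI[OF that]] by (simp_all add: V_def)
    have "p \<in> \<Union>\<U>" using that by blast
    then have "t n p = s V n p" by (simp only: t_def restrict_apply' V_def)
    also have "\<dots> = s U n p" by (rule agree[OF V(1) that(1) V(2) that(2)])
    finally show ?thesis .
  qed
  have sub: "U \<subseteq> Y" if "U \<in> \<U>" for U
    using openin_subset[OF conjunct1[OF s[OF that]]] by simp
  show "t \<in> carrier (formal_sections M Y (\<Union>\<U>))"
  proof (rule formal_sectionsI)
    show "\<Union>\<U> \<subseteq> pts M" using sub Y by blast
    show "t n \<in> extensional (\<Union>\<U>)" for n by (simp add: t_def)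
    fix n p assume "p \<in> \<Union>\<U>"
    then obtain U where U: "U \<in> \<U>" "p \<in> U" by blast
    have UM: "U \<subseteq> pts M" using sub[OF U(1)] Y by blast
    have sU: "s U \<in> carrier (formal_sections M Y U)" using s[OF U(1)] by simp
    obtain W f where f: "openin (mtop M) W" "p \<in> W" "holo_on_mfd M W f"
      "\<forall>q\<in>W \<inter> U. s U n q = jet_at M Y (Suc n) q f"
      by (rule formal_sections_local[OF sU U(2), where n=n])
    obtain O' where O': "openin (mtop M) O'" "U = O' \<inter> Y"
      using conjunct1[OF s[OF U(1)]] by (auto simp: openin_subtopology)
    have "openin (mtop M) (W \<inter> O')" "p \<in> W \<inter> O'" using f O' U by auto
    moreover have "holo_on_mfd M (W \<inter> O') f" using f(3) by (rule holo_on_mfd_subset) blast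
    moreover have "\<forall>q\<in>W \<inter> O' \<inter> \<Union>\<U>. t n q = jet_at M Y (Suc n) q f"
    proof
      fix q assume "q \<in> W \<inter> O' \<inter> \<Union>\<U>"
      then have "q \<in> W" "q \<in> U" using O' sub by auto
      then show "t n q = jet_at M Y (Suc n) q f" using t[OF U(1)] f(4) by simp
    qed
    ultimately show "\<exists>V f. openin (mtop M) V \<and> p \<in> V \<and> holo_on_mfd M V f \<and>
      (\<forall>q\<in>V \<inter> \<Union>\<U>. t n q = jet_at M Y (Suc n) q f)" by (intro exI conjI)
    show "\<exists>f\<in>carrier (near_ring M p). t n p = jet_at M Y (Suc n) p f \<and>
      t (Suc n) p = jet_at M Y (Suc (Suc n)) p f"
      by (rule formal_sections_jet[OF UM sU U(2), where n=n]) (auto simp: t[OF U])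
  qed
  show "\<forall>U\<in>\<U>. \<forall>n. restrict (t n) U = s U n"
  proof (intro ballI allI)
    fix U n assume U: "U \<in> \<U>"
    have "s U n \<in> extensional U" by (rule formal_sections_extensional[OF conjunct2[OF s[OF U]]])
    then show "restrict (t n) U = s U n"
      by (intro extensionalityI[of _ U]) (auto simp: t[OF U])
  qed
qed

lemma formal_sections_scalar_hom:
  assumes U: "U \<subseteq> pts M"
  shows "(\<lambda>a n. \<lambda>p\<in>U. jet_at M Y (Suc n) p (\<lambda>z. a)) \<in>
    ring_hom (ring_of_type_algebra :: complex ring) (formal_sections M Y U)"
proof (rule ring_hom_memI)
  have *: "jet_at M Y k p (\<lambda>z. a) \<otimes>\<^bsub>jet_ring M Y k p\<^esub> jet_at M Y k p (\<lambda>z. b) = jet_at M Y k p (\<lambda>z. a * b)"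
    "jet_at M Y k p (\<lambda>z. a) \<oplus>\<^bsub>jet_ring M Y k p\<^esub> jet_at M Y k p (\<lambda>z. b) = jet_at M Y k p (\<lambda>z. a + b)"
    if "p \<in> U" for p k a b
    by (rule jet_ops(1,2), (rule const_near_ring)?, rule subsetD[OF U that],
        (intro const_near_ring subsetD[OF U that])+)+
  fix a b :: complex
  show "(\<lambda>n. \<lambda>p\<in>U. jet_at M Y (Suc n) p (\<lambda>z. a)) \<in> carrier (formal_sections M Y U)"
    by (rule formal_sections_const[OF U])
  show "(\<lambda>n. \<lambda>p\<in>U. jet_at M Y (Suc n) p (\<lambda>z. a \<otimes>\<^bsub>ring_of_type_algebra\<^esub> b)) =
    (\<lambda>n. \<lambda>p\<in>U. jet_at M Y (Suc n) p (\<lambda>z. a)) \<otimes>\<^bsub>formal_sections M Y U\<^esub> (\<lambda>n. \<lambda>p\<in>U. jet_at M Y (Suc n) p (\<lambda>z. b))"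
    by (auto simp: formal_sections_ops ring_of_type_algebra_def fun_eq_iff restrict_def *)
  show "(\<lambda>n. \<lambda>p\<in>U. jet_at M Y (Suc n) p (\<lambda>z. a \<oplus>\<^bsub>ring_of_type_algebra\<^esub> b)) =
    (\<lambda>n. \<lambda>p\<in>U. jet_at M Y (Suc n) p (\<lambda>z. a)) \<oplus>\<^bsub>formal_sections M Y U\<^esub> (\<lambda>n. \<lambda>p\<in>U. jet_at M Y (Suc n) p (\<lambda>z. b))"
    by (auto simp: formal_sections_ops ring_of_type_algebra_def fun_eq_iff restrict_def *)
  show "(\<lambda>n. \<lambda>p\<in>U. jet_at M Y (Suc n) p (\<lambda>z. \<one>\<^bsub>ring_of_type_algebra\<^esub>)) = \<one>\<^bsub>formal_sections M Y U\<^esub>"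
    using U by (auto simp: formal_sections_ops ring_of_type_algebra_def fun_eq_iff restrict_def jet_ops(3) subset_iff)
qed

lemma formal_sections_restrict_hom:
  assumes U: "U \<subseteq> pts M" and V: "V \<subseteq> U"
  shows "(\<lambda>S n. restrict (S n) V) \<in> ring_hom (formal_sections M Y U) (formal_sections M Y V)"
proof (rule ring_hom_memI)
  fix S T
  assume "S \<in> carrier (formal_sections M Y U)"
  then show "(\<lambda>n. restrict (S n) V) \<in> carrier (formal_sections M Y V)"
    by (rule formal_sections_restrict[OF U V])
qed (use V in \<open>auto simp: formal_sections_ops fun_eq_iff restrict_def\<close>)

lemma cringed_space_formal_completion:
  assumes Y: "Y \<subseteq> pts M"
  shows "cringed_space (formal_completion M Y)"
proof -
  let ?T = "subtopology (mtop M) Y"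
  have res: "rs_res (formal_completion M Y) U V = (\<lambda>S n. restrict (S n) V)" for U V
    by (simp add: fun_eq_iff)
  have scal: "rs_scal (formal_completion M Y) U = (\<lambda>a n. \<lambda>p\<in>U. jet_at M Y (Suc n) p (\<lambda>z. a))" for U
    by (simp add: fun_eq_iff)
  have sub: "U \<subseteq> pts M" if "openin ?T U" for U using openin_subset[OF that] by auto
  show ?thesis
    unfolding cringed_space_def formal_completion_simps(1,2) res scal
  proof (intro conjI allI impI)
    fix U assume U: "openin ?T U"
    show "cring (formal_sections M Y U)" by (rule cring_formal_sections[OF sub[OF U]])
    show "(\<lambda>a n. \<lambda>p\<in>U. jet_at M Y (Suc n) p (\<lambda>z. a)) \<in> ring_hom ring_of_type_algebra (formal_sections M Y U)"
      by (rule formal_sections_scalar_hom[OF sub[OF U]])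
    show "\<forall>S\<in>carrier (formal_sections M Y U). (\<lambda>n. restrict (S n) U) = S"
      by (intro ballI ext extensional_restrict formal_sections_extensional)
  next
    fix U V assume "openin ?T U \<and> openin ?T V \<and> V \<subseteq> U"
    then show "(\<lambda>S n. restrict (S n) V) \<in> ring_hom (formal_sections M Y U) (formal_sections M Y V)"
      and "(\<lambda>n. restrict (\<lambda>p\<in>U. jet_at M Y (Suc n) p (\<lambda>z. a)) V) = (\<lambda>n. \<lambda>p\<in>V. jet_at M Y (Suc n) p (\<lambda>z. a))" for a
      by (intro formal_sections_restrict_hom sub, simp_all, auto simp: fun_eq_iff restrict_def)
  next
    fix U V Z assume "openin ?T U \<and> openin ?T V \<and> openin ?T Z \<and> Z \<subseteq> V \<and> V \<subseteq> U"
    then show "\<forall>S\<in>carrier (formal_sections M Y U).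
        (\<lambda>n. restrict (restrict (S n) V) Z) = (\<lambda>n. restrict (S n) Z)"
      by (auto simp: fun_eq_iff restrict_def)
  next
    fix \<U> s
    assume A: "(\<forall>U\<in>\<U>. openin ?T U \<and> s U \<in> carrier (formal_sections M Y U)) \<and>
      (\<forall>U\<in>\<U>. \<forall>V\<in>\<U>. (\<lambda>n. restrict (s U n) (U \<inter> V)) = (\<lambda>n. restrict (s V n) (U \<inter> V)))"
    have agree: "s U n p = s V n p" if "U \<in> \<U>" "V \<in> \<U>" "p \<in> U" "p \<in> V" for U V n p
    proof -
      have "restrict (s U n) (U \<inter> V) p = restrict (s V n) (U \<inter> V) p" using A that by metis
      then show ?thesis using that by simp
    qed
    have "\<exists>t\<in>carrier (formal_sections M Y (\<Union>\<U>)). \<forall>U\<in>\<U>. \<forall>n. restrict (t n) U = s U n"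
      by (rule formal_sections_gluing[OF Y]) (use A in simp, rule agree)
    then obtain t where t: "t \<in> carrier (formal_sections M Y (\<Union>\<U>))"
      "\<forall>U\<in>\<U>. \<forall>n. restrict (t n) U = s U n"
      by (elim bexE)
    show "\<exists>!t. t \<in> carrier (formal_sections M Y (\<Union>\<U>)) \<and> (\<forall>U\<in>\<U>. (\<lambda>n. restrict (t n) U) = s U)"
    proof (rule ex1I[of _ t])
      show "t \<in> carrier (formal_sections M Y (\<Union>\<U>)) \<and> (\<forall>U\<in>\<U>. (\<lambda>n. restrict (t n) U) = s U)"
        using t by (auto simp: fun_eq_iff)
      fix t' assume t': "t' \<in> carrier (formal_sections M Y (\<Union>\<U>)) \<and> (\<forall>U\<in>\<U>. (\<lambda>n. restrict (t' n) U) = s U)"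
      show "t' = t"
      proof (rule formal_sections_eqI)
        fix n p assume "p \<in> \<Union>\<U>"
        then obtain U where U: "U \<in> \<U>" "p \<in> U" by blast
        have "restrict (t' n) U p = s U n p" using t' U by (metis (no_types, lifting))
        moreover have "restrict (t n) U p = s U n p" using t U by metis
        ultimately show "t' n p = t n p" using U by simp
      qed (use t t' in auto)
    qed
  qed
qed

section \<open>Maps of formal completions\<close>

lemma fst_completion_map: "fst (completion_map M Y F) = restrict F Y"
  and snd_completion_map: "snd (completion_map M Y F) U S n =
     (\<lambda>p\<in>{p\<in>Y. F p \<in> U}. jet_pullback M Y F (Suc n) p (S n (F p)))"
  by (simp_all add: completion_map_def)

lemma rs_preimage_completion_map:
  "Y \<subseteq> pts M \<Longrightarrow>
   rs_preimage (formal_completion M Y) (fst (completion_map M Y F)) U = {p\<in>Y. F p \<in> U}"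
  by (auto simp: rs_preimage_def fst_completion_map)

text \<open>Holomorphic maps of pairs, the morphisms on which formal completion is a functor.\<close>

locale completion_morphism =
  fixes M :: "('a, 'n::finite) cmfd" and Y :: "'a set"
    and M' :: "('b, 'm::finite) cmfd" and Y' :: "'b set" and F :: "'a \<Rightarrow> 'b"
  assumes Y: "Y \<subseteq> pts M" and Y': "Y' \<subseteq> pts M'"
    and F: "pullback_map M M' F" and FY: "\<And>p. p \<in> Y \<Longrightarrow> F p \<in> Y'"
begin

abbreviation "\<phi> \<equiv> completion_map M Y F"

lemma pullback_section_apply:
  assumes "p \<in> Y" "F p \<in> U" "f \<in> carrier (near_ring M' (F p))" "S n (F p) = jet_at M' Y' (Suc n) (F p) f"
  shows "snd \<phi> U S n p = jet_at M Y (Suc n) p (f \<circ> F)"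
proof -
  have p: "p \<in> pts M" using assms(1) Y by blast
  show ?thesis
    using assms jet_pullback_jet_at[OF F p FY assms(3), of Y "Suc n"] by (simp add: snd_completion_map)
qed

lemma open_sub: "openin (subtopology (mtop M') Y') U \<Longrightarrow> U \<subseteq> Y'"
  using openin_subset by fastforce

lemma pullback_section_closed:
  assumes U: "U \<subseteq> Y'" and S: "S \<in> carrier (formal_sections M' Y' U)"
  shows "snd \<phi> U S \<in> carrier (formal_sections M Y {p\<in>Y. F p \<in> U})"
proof (rule formal_sectionsI)
  have UM: "U \<subseteq> pts M'" using U Y' by blast
  show "{p\<in>Y. F p \<in> U} \<subseteq> pts M" using Y by blast
  show "snd \<phi> U S n \<in> extensional {p\<in>Y. F p \<in> U}" for n by (simp add: snd_completion_map)
  fix n p assume "p \<in> {p\<in>Y. F p \<in> U}"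
  then have p: "p \<in> Y" "F p \<in> U" by auto
  obtain V f where f: "openin (mtop M') V" "F p \<in> V" "holo_on_mfd M' V f"
    "\<forall>q\<in>V \<inter> U. S n q = jet_at M' Y' (Suc n) q f"
    by (rule formal_sections_local[OF S p(2), where n=n])
  let ?V = "{q \<in> pts M. F q \<in> V}"
  have "openin (mtop M) ?V" by (rule pullback_map_openin[OF F f(1)])
  moreover have "p \<in> ?V" using p f Y by auto
  moreover have "holo_on_mfd M ?V (f \<circ> F)" by (rule pullback_map_holo[OF F f(1,3)])
  moreover have "\<forall>q\<in>?V \<inter> {p\<in>Y. F p \<in> U}. snd \<phi> U S n q = jet_at M Y (Suc n) q (f \<circ> F)"
  proof
    fix q assume "q \<in> ?V \<inter> {p\<in>Y. F p \<in> U}"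
    then have q: "q \<in> Y" "F q \<in> U" "F q \<in> V" by auto
    show "snd \<phi> U S n q = jet_at M Y (Suc n) q (f \<circ> F)"
      by (rule pullback_section_apply[OF q(1,2) holo_near_ring[OF f(1) q(3) f(3)]]) (use f(4) q in simp)
  qed
  ultimately show "\<exists>V f. openin (mtop M) V \<and> p \<in> V \<and> holo_on_mfd M V f \<and>
      (\<forall>q\<in>V \<inter> {p\<in>Y. F p \<in> U}. snd \<phi> U S n q = jet_at M Y (Suc n) q f)"
    by (intro exI conjI)
  obtain f where f: "f \<in> carrier (near_ring M' (F p))" "S n (F p) = jet_at M' Y' (Suc n) (F p) f"
    "S (Suc n) (F p) = jet_at M' Y' (Suc (Suc n)) (F p) f"
    by (rule formal_sections_jet[OF UM S p(2), where n=n])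
  have "p \<in> pts M" using p Y by blast
  then show "\<exists>f\<in>carrier (near_ring M p). snd \<phi> U S n p = jet_at M Y (Suc n) p f \<and>
      snd \<phi> U S (Suc n) p = jet_at M Y (Suc (Suc n)) p f"
    using pullback_section_apply[where S=S, OF p f(1,2)] pullback_section_apply[where S=S, OF p f(1,3)] pullback_near_ring[OF F _ f(1)]
    by (intro bexI[of _ "f \<circ> F"]) simp_all
qed

lemma pullback_section_hom:
  assumes U: "U \<subseteq> Y'"
  shows "snd \<phi> U \<in> ring_hom (formal_sections M' Y' U) (formal_sections M Y {p\<in>Y. F p \<in> U})"
proof -
  let ?P = "{p\<in>Y. F p \<in> U}"
  have UM: "U \<subseteq> pts M'" using U Y' by blast
  have P: "?P \<subseteq> pts M" using Y by blast
  note cl = formal_sections_closed[OF UM] and clP = formal_sections_closed[OF P]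
  note eqI = formal_sections_eqI[where M=M and Y=Y and U="?P"]
  show ?thesis
  proof (rule ring_hom_memI)
    fix S T assume S: "S \<in> carrier (formal_sections M' Y' U)" and T: "T \<in> carrier (formal_sections M' Y' U)"
    have *: "snd \<phi> U (S \<otimes>\<^bsub>formal_sections M' Y' U\<^esub> T) n p = snd \<phi> U S n p \<otimes>\<^bsub>jet_ring M Y (Suc n) p\<^esub> snd \<phi> U T n p"
      "snd \<phi> U (S \<oplus>\<^bsub>formal_sections M' Y' U\<^esub> T) n p = snd \<phi> U S n p \<oplus>\<^bsub>jet_ring M Y (Suc n) p\<^esub> snd \<phi> U T n p"
      if "p \<in> ?P" for n p
    proof -
      have p: "p \<in> Y" "F p \<in> U" "p \<in> pts M" "F p \<in> pts M'" using that Y UM by auto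
      obtain f where f: "f \<in> carrier (near_ring M' (F p))" "S n (F p) = jet_at M' Y' (Suc n) (F p) f"
        by (rule formal_sections_jet[OF UM S p(2), where n=n])
      obtain g where g: "g \<in> carrier (near_ring M' (F p))" "T n (F p) = jet_at M' Y' (Suc n) (F p) g"
        by (rule formal_sections_jet[OF UM T p(2), where n=n])
      have "snd \<phi> U (S \<otimes>\<^bsub>formal_sections M' Y' U\<^esub> T) n p = jet_at M Y (Suc n) p ((\<lambda>z. f z * g z) \<circ> F)"
        by (rule pullback_section_apply[OF p(1,2) mult_near_ring[OF f(1) g(1)]])
           (use p f g in \<open>simp add: formal_sections_ops jet_ops\<close>)
      moreover have "snd \<phi> U (S \<oplus>\<^bsub>formal_sections M' Y' U\<^esub> T) n p = jet_at M Y (Suc n) p ((\<lambda>z. f z + g z) \<circ> F)"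
        by (rule pullback_section_apply[OF p(1,2) add_near_ring[OF f(1) g(1)]])
           (use p f g in \<open>simp add: formal_sections_ops jet_ops\<close>)
      ultimately show "snd \<phi> U (S \<otimes>\<^bsub>formal_sections M' Y' U\<^esub> T) n p = snd \<phi> U S n p \<otimes>\<^bsub>jet_ring M Y (Suc n) p\<^esub> snd \<phi> U T n p"
        "snd \<phi> U (S \<oplus>\<^bsub>formal_sections M' Y' U\<^esub> T) n p = snd \<phi> U S n p \<oplus>\<^bsub>jet_ring M Y (Suc n) p\<^esub> snd \<phi> U T n p"
        unfolding pullback_section_apply[where S=S, OF p(1,2) f] pullback_section_apply[where S=T, OF p(1,2) g]
          jet_ops(1)[OF p(3) pullback_near_ring[OF F p(3) f(1)] pullback_near_ring[OF F p(3) g(1)]]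
          jet_ops(2)[OF p(3) pullback_near_ring[OF F p(3) f(1)] pullback_near_ring[OF F p(3) g(1)]]
        by (simp_all add: o_def)
    qed
    show "snd \<phi> U (S \<otimes>\<^bsub>formal_sections M' Y' U\<^esub> T) = snd \<phi> U S \<otimes>\<^bsub>formal_sections M Y ?P\<^esub> snd \<phi> U T"
      by (intro eqI pullback_section_closed U cl clP S T, simp only: *(1)) (simp add: formal_sections_ops)
    show "snd \<phi> U (S \<oplus>\<^bsub>formal_sections M' Y' U\<^esub> T) = snd \<phi> U S \<oplus>\<^bsub>formal_sections M Y ?P\<^esub> snd \<phi> U T"
      by (intro eqI pullback_section_closed U cl clP S T, simp only: *(2)) (simp add: formal_sections_ops)
  next
    show "snd \<phi> U \<one>\<^bsub>formal_sections M' Y' U\<^esub> = \<one>\<^bsub>formal_sections M Y ?P\<^esub>"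
    proof (intro eqI pullback_section_closed U cl clP)
      fix n p assume P: "p \<in> ?P"
      then have p: "p \<in> Y" "F p \<in> U" "p \<in> pts M" "F p \<in> pts M'" using Y UM by auto
      have "snd \<phi> U \<one>\<^bsub>formal_sections M' Y' U\<^esub> n p = jet_at M Y (Suc n) p ((\<lambda>z. 1) \<circ> F)"
        by (rule pullback_section_apply[OF p(1,2) const_near_ring[OF p(4)]])
           (use p in \<open>simp add: formal_sections_ops jet_ops\<close>)
      then show "snd \<phi> U \<one>\<^bsub>formal_sections M' Y' U\<^esub> n p = \<one>\<^bsub>formal_sections M Y ?P\<^esub> n p"
        using P p by (simp add: formal_sections_ops jet_ops o_def)
    qed
  qed (rule pullback_section_closed[OF U])
qed

lemma pullback_section_scal:
  assumes U: "U \<subseteq> Y'"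
  shows "snd \<phi> U (rs_scal (formal_completion M' Y') U a) = rs_scal (formal_completion M Y) {p\<in>Y. F p \<in> U} a"
proof (rule formal_sections_eqI)
  let ?P = "{p\<in>Y. F p \<in> U}"
  have UM: "U \<subseteq> pts M'" using U Y' by blast
  have P: "?P \<subseteq> pts M" using Y by blast
  show "snd \<phi> U (rs_scal (formal_completion M' Y') U a) \<in> carrier (formal_sections M Y ?P)"
    unfolding formal_completion_simps by (rule pullback_section_closed[OF U formal_sections_const[OF UM]])
  show "rs_scal (formal_completion M Y) ?P a \<in> carrier (formal_sections M Y ?P)"
    unfolding formal_completion_simps by (rule formal_sections_const[OF P])
  fix n p assume P: "p \<in> ?P"
  then have p: "p \<in> Y" "F p \<in> U" "p \<in> pts M" "F p \<in> pts M'" using Y UM by auto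
  have "snd \<phi> U (rs_scal (formal_completion M' Y') U a) n p = jet_at M Y (Suc n) p ((\<lambda>z. a) \<circ> F)"
    by (rule pullback_section_apply[OF p(1,2) const_near_ring[OF p(4)]]) (use p in simp)
  then show "snd \<phi> U (rs_scal (formal_completion M' Y') U a) n p = rs_scal (formal_completion M Y) ?P a n p"
    using P by (simp add: o_def)
qed

lemma cringed_morphism_completion_map:
  "cringed_morphism (formal_completion M Y) (formal_completion M' Y') \<phi>"
  unfolding cringed_morphism_def rs_preimage_completion_map[OF Y]
proof (intro conjI allI impI)
  show "cringed_space (formal_completion M Y)" "cringed_space (formal_completion M' Y')"
    by (rule cringed_space_formal_completion[OF Y], rule cringed_space_formal_completion[OF Y'])
  have "continuous_map (subtopology (mtop M) Y) (subtopology (mtop M') Y') F"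
    using F FY by (auto simp: pullback_map_def continuous_map_in_subtopology continuous_map_from_subtopology)
  then have "continuous_map (subtopology (mtop M) Y) (subtopology (mtop M') Y') (restrict F Y)"
    by (rule continuous_map_eq) simp
  then show "continuous_map (rs_top (formal_completion M Y)) (rs_top (formal_completion M' Y')) (fst \<phi>)"
    by (simp add: fst_completion_map)
next
  fix U assume "openin (rs_top (formal_completion M' Y')) U"
  then have U: "U \<subseteq> Y'" using open_sub by simp
  show "snd \<phi> U \<in> ring_hom (rs_sec (formal_completion M' Y') U) (rs_sec (formal_completion M Y) {p\<in>Y. F p \<in> U})"
    using pullback_section_hom[OF U] by simp
  show "snd \<phi> U (rs_scal (formal_completion M' Y') U a) = rs_scal (formal_completion M Y) {p\<in>Y. F p \<in> U} a" for a
    by (rule pullback_section_scal[OF U])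
next
  fix U V assume "openin (rs_top (formal_completion M' Y')) U \<and> openin (rs_top (formal_completion M' Y')) V \<and> V \<subseteq> U"
  then have "V \<subseteq> U" by blast
  then show "\<forall>S\<in>carrier (rs_sec (formal_completion M' Y') U). snd \<phi> V (rs_res (formal_completion M' Y') U V S) =
      rs_res (formal_completion M Y) {p\<in>Y. F p \<in> U} {p\<in>Y. F p \<in> V} (snd \<phi> U S)"
    by (intro ballI ext) (auto simp: snd_completion_map restrict_def)
qed

end

text \<open>Functoriality in the form used below: a composite of two completion maps is pullback along the composite map.\<close>

lemma completion_map_compose:
  assumes 1: "completion_morphism M Y M' Y' F" and 2: "completion_morphism M' Y' M'' Y'' G"
    and p: "p \<in> Y" "G (F p) \<in> U" and f: "f \<in> carrier (near_ring M'' (G (F p)))"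
    and S: "S n (G (F p)) = jet_at M'' Y'' (Suc n) (G (F p)) f"
  shows "snd (completion_map M Y F) {q\<in>Y'. G q \<in> U} (snd (completion_map M' Y' G) U S) n p =
    jet_at M Y (Suc n) p (f \<circ> G \<circ> F)"
proof -
  interpret F: completion_morphism M Y M' Y' F by fact
  interpret G: completion_morphism M' Y' M'' Y'' G by fact
  have Fp: "F p \<in> Y'" by (rule F.FY[OF p(1)])
  then have Fp': "F p \<in> pts M'" using G.Y by blast
  show ?thesis
  proof (rule F.pullback_section_apply[OF p(1)])
    show "F p \<in> {q\<in>Y'. G q \<in> U}" using Fp p by simp
    show "f \<circ> G \<in> carrier (near_ring M' (F p))" by (rule pullback_near_ring[OF G.F Fp' f])
    show "snd (completion_map M' Y' G) U S n (F p) = jet_at M' Y' (Suc n) (F p) (f \<circ> G)"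
      by (rule G.pullback_section_apply[where S=S, OF Fp p(2) f S])
  qed
qed

lemma completion_map_inverse:
  assumes 1: "completion_morphism M Y M' Y' F" and 2: "completion_morphism M' Y' M Y G"
    and FG: "\<And>q. q \<in> pts M' \<Longrightarrow> F (G q) = q"
    and U: "U \<subseteq> Y'" and S: "S \<in> carrier (formal_sections M' Y' U)"
  shows "snd (completion_map M' Y' G) {p\<in>Y. F p \<in> U} (snd (completion_map M Y F) U S) = S"
proof -
  interpret F: completion_morphism M Y M' Y' F by fact
  interpret G: completion_morphism M' Y' M Y G by fact
  let ?P = "{p\<in>Y. F p \<in> U}"
  have UM: "U \<subseteq> pts M'" using U F.Y' by blast
  have FGY: "F (G q) = q" if "q \<in> Y'" for q using FG F.Y' that by blast
  have PU: "{q\<in>Y'. G q \<in> ?P} = U" using U G.FY by (auto simp: FGY)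
  show ?thesis
  proof (rule formal_sections_eqI[OF _ S])
    have "snd (completion_map M' Y' G) ?P (snd (completion_map M Y F) U S) \<in>
        carrier (formal_sections M' Y' {q\<in>Y'. G q \<in> ?P})"
      by (rule G.pullback_section_closed[OF _ F.pullback_section_closed[OF U S]]) blast
    then show "snd (completion_map M' Y' G) ?P (snd (completion_map M Y F) U S) \<in> carrier (formal_sections M' Y' U)"
      unfolding PU .
    fix n q assume q: "q \<in> U"
    then have qM: "q \<in> pts M'" and qY: "q \<in> Y'" using UM U by auto
    note e = FG[OF qM]
    obtain f where f: "f \<in> carrier (near_ring M' q)" "S n q = jet_at M' Y' (Suc n) q f"
      by (rule formal_sections_jet[OF UM S q, where n=n])
    have "snd (completion_map M' Y' G) ?P (snd (completion_map M Y F) U S) n q = jet_at M' Y' (Suc n) q (f \<circ> F \<circ> G)"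
      by (rule completion_map_compose[OF 2 1 qY]) (simp_all add: e q f)
    also have "\<dots> = jet_at M' Y' (Suc n) q f"
    proof (rule jet_at_cong[OF qM _ f(1) openin_topspace qM])
      have Gq: "G q \<in> pts M" by (rule pullback_map_pts[OF G.F qM])
      have "f \<circ> F \<in> carrier (near_ring M (G q))"
        by (rule pullback_near_ring[OF F.F Gq]) (simp add: e f)
      then show "f \<circ> F \<circ> G \<in> carrier (near_ring M' q)" by (rule pullback_near_ring[OF G.F qM])
      show "(f \<circ> F \<circ> G) z = f z" if "z \<in> pts M'" for z using FG[OF that] by simp
    qed
    finally show "snd (completion_map M' Y' G) ?P (snd (completion_map M Y F) U S) n q = S n q"
      by (simp add: f)
  qed
qed

text \<open>The completion maps of two mutually inverse maps of pairs are mutually inverse, by functoriality.\<close>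

lemma cringed_iso_completion_map:
  assumes 1: "completion_morphism M Y M' Y' F" and 2: "completion_morphism M' Y' M Y G"
    and GF: "\<And>p. p \<in> pts M \<Longrightarrow> G (F p) = p" and FG: "\<And>q. q \<in> pts M' \<Longrightarrow> F (G q) = q"
  shows "cringed_iso (formal_completion M Y) (formal_completion M' Y') (completion_map M Y F)"
proof -
  interpret F: completion_morphism M Y M' Y' F by fact
  interpret G: completion_morphism M' Y' M Y G by fact
  show ?thesis
    unfolding cringed_iso_def
  proof (intro conjI allI impI)
    show mF: "cringed_morphism (formal_completion M Y) (formal_completion M' Y') (completion_map M Y F)"
      by (rule F.cringed_morphism_completion_map)
    have mG: "cringed_morphism (formal_completion M' Y') (formal_completion M Y) (completion_map M' Y' G)"
      by (rule G.cringed_morphism_completion_map)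
    have "homeomorphic_maps (subtopology (mtop M) Y) (subtopology (mtop M') Y') (restrict F Y) (restrict G Y')"
      using mF mG F.FY G.FY F.Y G.Y GF FG
      by (auto simp: homeomorphic_maps_def cringed_morphism_def fst_completion_map subset_iff)
    then show "homeomorphic_map (rs_top (formal_completion M Y)) (rs_top (formal_completion M' Y')) (fst (completion_map M Y F))"
      by (auto simp: fst_completion_map homeomorphic_map_maps)
    fix U assume "openin (rs_top (formal_completion M' Y')) U"
    then have U: "U \<subseteq> Y'" using F.open_sub by simp
    let ?P = "{p\<in>Y. F p \<in> U}"
    have FGY: "F (G q) = q" if "q \<in> Y'" for q using FG F.Y' that by blast
    have PU: "{q\<in>Y'. G q \<in> ?P} = U" using U G.FY by (auto simp: FGY)
    have "bij_betw (snd (completion_map M Y F) U) (carrier (formal_sections M' Y' U)) (carrier (formal_sections M Y ?P))"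
    proof (rule bij_betwI)
      show "snd (completion_map M Y F) U \<in> carrier (formal_sections M' Y' U) \<rightarrow> carrier (formal_sections M Y ?P)"
        by (intro funcsetI F.pullback_section_closed[OF U])
      show "snd (completion_map M' Y' G) ?P \<in> carrier (formal_sections M Y ?P) \<rightarrow> carrier (formal_sections M' Y' U)"
        using G.pullback_section_closed[of ?P] unfolding PU by (intro funcsetI) blast
      show "snd (completion_map M' Y' G) ?P (snd (completion_map M Y F) U S) = S"
        if "S \<in> carrier (formal_sections M' Y' U)" for S
        by (rule completion_map_inverse[OF 1 2 FG U that])
      show "snd (completion_map M Y F) U (snd (completion_map M' Y' G) ?P T) = T"
        if "T \<in> carrier (formal_sections M Y ?P)" for T
        using completion_map_inverse[OF 2 1 GF _ that] unfolding PU by blast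
    qed
    then show "snd (completion_map M Y F) U \<in> ring_iso (rs_sec (formal_completion M' Y') U)
        (rs_sec (formal_completion M Y) (rs_preimage (formal_completion M Y) (fst (completion_map M Y F)) U))"
      unfolding rs_preimage_completion_map[OF F.Y] using F.pullback_section_hom[OF U]
      by (simp add: ring_iso_def)
  qed
qed

text \<open>Both sides pull functions back along the same map from \<open>M\<close> to \<open>M'\<close>.\<close>

lemma completion_map_commuting_square:
  assumes F1: "completion_morphism M Y M1 Y1 F1" and G1: "completion_morphism M1 Y1 M' Y' G1"
    and F2: "completion_morphism M Y M2 Y2 F2" and G2: "completion_morphism M2 Y2 M' Y' G2"
    and comm: "\<And>p. p \<in> pts M \<Longrightarrow> G1 (F1 p) = G2 (F2 p)"
  shows "rs_map_eq (formal_completion M Y) (formal_completion M' Y')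
     (rs_comp (formal_completion M1 Y1) (completion_map M1 Y1 G1) (completion_map M Y F1))
     (rs_comp (formal_completion M2 Y2) (completion_map M2 Y2 G2) (completion_map M Y F2))"
proof -
  interpret F1: completion_morphism M Y M1 Y1 F1 by fact
  interpret G1: completion_morphism M1 Y1 M' Y' G1 by fact
  interpret F2: completion_morphism M Y M2 Y2 F2 by fact
  interpret G2: completion_morphism M2 Y2 M' Y' G2 by fact
  have com: "G1 (F1 p) = G2 (F2 p)" if "p \<in> Y" for p using comm F1.Y that by blast
  show ?thesis
    unfolding rs_map_eq_def rs_comp_def fst_conv snd_conv o_apply
      rs_preimage_completion_map[OF G1.Y] rs_preimage_completion_map[OF G2.Y]
  proof (intro conjI ballI allI impI)
    fix p assume "p \<in> topspace (rs_top (formal_completion M Y))"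
    then have "p \<in> Y" using F1.Y by auto
    then show "fst (completion_map M1 Y1 G1) (fst (completion_map M Y F1) p) =
        fst (completion_map M2 Y2 G2) (fst (completion_map M Y F2) p)"
      using com F1.FY F2.FY by (simp add: fst_completion_map)
  next
    fix U S assume "openin (rs_top (formal_completion M' Y')) U"
      and "S \<in> carrier (rs_sec (formal_completion M' Y') U)"
    then have U: "U \<subseteq> Y'" and S: "S \<in> carrier (formal_sections M' Y' U)" using G1.open_sub by simp_all
    have UM: "U \<subseteq> pts M'" using U G1.Y' by blast
    let ?L = "snd (completion_map M Y F1) {p \<in> Y1. G1 p \<in> U} (snd (completion_map M1 Y1 G1) U S)"
    let ?R = "snd (completion_map M Y F2) {p \<in> Y2. G2 p \<in> U} (snd (completion_map M2 Y2 G2) U S)"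
    have dom: "{p\<in>Y. F1 p \<in> {p \<in> Y1. G1 p \<in> U}} = {p\<in>Y. F2 p \<in> {p \<in> Y2. G2 p \<in> U}}"
      using com F1.FY F2.FY by auto
    show "?L = ?R"
    proof (rule formal_sections_eqI)
      show "?L \<in> carrier (formal_sections M Y {p\<in>Y. F1 p \<in> {p \<in> Y1. G1 p \<in> U}})"
        by (rule F1.pullback_section_closed[OF _ G1.pullback_section_closed[OF U S]]) blast
      show "?R \<in> carrier (formal_sections M Y {p\<in>Y. F1 p \<in> {p \<in> Y1. G1 p \<in> U}})"
        unfolding dom by (rule F2.pullback_section_closed[OF _ G2.pullback_section_closed[OF U S]]) blast
      fix n p assume "p \<in> {p\<in>Y. F1 p \<in> {p \<in> Y1. G1 p \<in> U}}"
      then have p: "p \<in> Y" "G1 (F1 p) \<in> U" by auto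
      have pM: "p \<in> pts M" using p F1.Y by blast
      obtain f where f: "f \<in> carrier (near_ring M' (G1 (F1 p)))"
        "S n (G1 (F1 p)) = jet_at M' Y' (Suc n) (G1 (F1 p)) f"
        by (rule formal_sections_jet[OF UM S p(2), where n=n])
      note f2 = p(2)[unfolded com[OF p(1)]] f[unfolded com[OF p(1)]]
      have "?L n p = jet_at M Y (Suc n) p (f \<circ> G1 \<circ> F1)"
        by (rule completion_map_compose[where S=S, OF F1 G1 p f])
      also have "\<dots> = jet_at M Y (Suc n) p (f \<circ> G2 \<circ> F2)"
      proof (rule jet_at_cong[OF pM _ _ openin_topspace pM])
        show "f \<circ> G1 \<circ> F1 \<in> carrier (near_ring M p)"
          by (intro pullback_near_ring[OF F1.F pM] pullback_near_ring[OF G1.F pullback_map_pts[OF F1.F pM]] f(1))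
        show "f \<circ> G2 \<circ> F2 \<in> carrier (near_ring M p)"
          by (intro pullback_near_ring[OF F2.F pM] pullback_near_ring[OF G2.F pullback_map_pts[OF F2.F pM]] f2(2))
        show "(f \<circ> G1 \<circ> F1) z = (f \<circ> G2 \<circ> F2) z" if "z \<in> pts M" for z using comm[OF that] by simp
      qed
      also have "\<dots> = ?R n p"
        by (rule completion_map_compose[where S=S, OF F2 G2 p(1) f2, symmetric])
      finally show "?L n p = ?R n p" .
    qed
  qed
qed

section \<open>Coordinates on the holomorphic tangent bundle\<close>

definition chart_jacobian ::
    "('a, 'n::finite) chart \<Rightarrow> ('a, 'n) chart \<Rightarrow> 'a \<Rightarrow> complex^'n \<Rightarrow> complex^'n" where
  "chart_jacobian c d p = frechet_derivative (transition c d) (at (snd c p))"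

lemma transition_has_derivative:
  assumes "holo_compatible c d" "p \<in> fst c" "p \<in> fst d"
  shows "(transition c d has_derivative chart_jacobian c d p) (at (snd c p))"
    and "Vector_Spaces.linear (*s) (*s) (chart_jacobian c d p)"
  using holo_vec_on_frechet[OF holo_transition[OF assms(1)], of "snd c p"] assms(2,3)
  unfolding chart_jacobian_def by blast+

text \<open>The cocycle identity of the Jacobians, i.e. the chain rule for \<open>transition c e = transition d e \<circ> transition c d\<close>,
  which holds near the point.\<close>

lemma chart_jacobian_chain:
  assumes c: "top_chart T c" and d: "top_chart T d" and e: "top_chart T e"
    and cd: "holo_compatible c d" and de: "holo_compatible d e"
    and p: "p \<in> fst c" "p \<in> fst d" "p \<in> fst e"
  shows "chart_jacobian d e p (chart_jacobian c d p v) = chart_jacobian c e p v"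
proof -
  note inj = top_chart_inj[OF c] top_chart_inj[OF d]
  have dp: "transition c d (snd c p) = snd d p" by (rule transition_chart[OF inj(1) p(1)])
  have "((\<lambda>z. transition d e (transition c d z)) has_derivative
      (\<lambda>v. chart_jacobian d e p (chart_jacobian c d p v))) (at (snd c p))"
    by (rule has_derivative_compose[OF transition_has_derivative(1)[OF cd p(1,2)]])
       (use transition_has_derivative(1)[OF de p(2,3)] dp in simp)
  moreover have "open (snd c ` (fst c \<inter> (fst d \<inter> fst e)))"
    by (rule top_chart_open_image[OF c]) (use d e in \<open>auto simp: top_chart_def\<close>)
  ultimately have "(transition c e has_derivative
      (\<lambda>v. chart_jacobian d e p (chart_jacobian c d p v))) (at (snd c p))"
    by (rule has_derivative_transform_within_open)
       (use p inj in \<open>auto simp: transition_chart\<close>)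
  from frechet_derivative_at[OF this] show ?thesis unfolding chart_jacobian_def by metis
qed

lemma chart_jacobian_self:
  assumes c: "top_chart T c" and p: "p \<in> fst c"
  shows "chart_jacobian c c p v = v"
proof -
  have "((\<lambda>z. z) has_derivative (\<lambda>v. v)) (at (snd c p))" by (rule has_derivative_ident)
  moreover have "open (snd c ` fst c)" using c by (simp add: top_chart_def)
  ultimately have "(transition c c has_derivative (\<lambda>v. v)) (at (snd c p))"
    by (rule has_derivative_transform_within_open)
       (use p top_chart_inj[OF c] in \<open>auto simp: transition_chart\<close>)
  from frechet_derivative_at[OF this] show ?thesis unfolding chart_jacobian_def by metis
qed

text \<open>The coordinate change of the tangent bundle over the one from \<open>c\<close> to \<open>d\<close>.\<close>

definition tangent_transition ::
    "('a, 'n::finite) chart \<Rightarrow> ('a, 'n) chart \<Rightarrow> complex^('n+'n) \<Rightarrow> complex^('n+'n)" where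
  "tangent_transition c d y = join_halves (transition c d (left_half y))
     (frechet_derivative (transition c d) (at (left_half y)) (right_half y))"

lemma open_left_half:
  assumes "open A" shows "open {y. left_half y \<in> A}"
proof -
  have "open (left_half -` A)" by (rule open_vimage[OF assms]) (intro continuous_intros)
  then show ?thesis by (simp add: vimage_def)
qed

lemma holo_tangent_transition:
  assumes c: "top_chart T c" and d: "top_chart T d" and cd: "holo_compatible c d"
  shows "holo_vec_on {y. left_half y \<in> snd c ` (fst c \<inter> fst d)} (tangent_transition c d)"
  unfolding holo_vec_on_def
proof
  fix k
  let ?O = "snd c ` (fst c \<inter> fst d)" and ?\<tau> = "transition c d"
  have o: "open ?O" by (rule top_chart_open_image[OF c]) (use d in \<open>simp add: top_chart_def\<close>)
  then have o': "open {y. left_half y \<in> ?O}"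
    by (rule open_left_half)
  have h: "holo_fun_on ?O (\<lambda>z. ?\<tau> z $ i)" for i
    using holo_transition[OF cd] by (simp add: holo_vec_on_def)
  show "holo_fun_on {y. left_half y \<in> ?O} (\<lambda>z. tangent_transition c d z $ k)"
  proof (cases k)
    case (Inl i)
    have "holo_fun_on {y. left_half y \<in> ?O} (\<lambda>y. ?\<tau> (left_half y) $ i)"
      by (rule holo_fun_on_compose[OF holo_vec_on_clinear[OF clinear_left_half] h]) simp
    then show ?thesis using Inl by (simp add: tangent_transition_def join_halves_def)
  next
    case (Inr i)
    have "holo_fun_on {y. left_half y \<in> ?O}
        (\<lambda>y. frechet_derivative (\<lambda>z. ?\<tau> z $ i) (at (left_half y)) (right_half y))"
      by (rule holo_fun_on_derivative[OF o h])
    then show ?thesis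
    proof (rule holo_fun_on_cong_open[OF _ o' order_refl])
      fix y assume "y \<in> {y. left_half y \<in> ?O}"
      then have "(?\<tau> has_derivative frechet_derivative ?\<tau> (at (left_half y))) (at (left_half y))"
        using holo_vec_on_frechet(1)[OF holo_transition[OF cd]] by simp
      then have "((\<lambda>z. ?\<tau> z $ i) has_derivative (\<lambda>v. frechet_derivative ?\<tau> (at (left_half y)) v $ i)) (at (left_half y))"
        by (simp add: has_derivative_vec_componentwise)
      from frechet_derivative_at[OF this]
      show "frechet_derivative (\<lambda>z. ?\<tau> z $ i) (at (left_half y)) (right_half y) = tangent_transition c d y $ k"
        using Inr by (simp add: tangent_transition_def join_halves_def) metis
    qed
  qed
qed

lemma top_chart_cong:
  assumes "top_chart T c" "fst d = fst c" "\<And>p. p \<in> fst c \<Longrightarrow> snd d p = snd c p"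
  shows "top_chart T d"
proof -
  have im: "snd d ` fst c = snd c ` fst c" using assms(3) by (auto intro: image_cong)
  have "homeomorphic_map (subtopology T (fst c)) (top_of_set (snd c ` fst c)) (snd d)"
    using assms(1,3) homeomorphic_map_eq[of "subtopology T (fst c)" _ "snd c" "snd d"]
    unfolding top_chart_def by auto
  then show ?thesis using assms im unfolding top_chart_def by simp
qed

lemma tvec_add_apply [simp]: "tvec_add v w c = v c + w c"
  and tvec_scale_apply [simp]: "tvec_scale a v c = a *s v c"
  and tvec_zero_apply [simp]: "tvec_zero c = 0"
  by (simp_all add: tvec_add_def tvec_scale_def tvec_zero_def)

text \<open>A tangent vector is a family of components indexed by the charts of the given atlas.  For a chart \<open>c0\<close> of the
  maximal atlas, such as that of a linear slice, the components \<open>coords\<close> are obtained by a Jacobian from any chart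
  of the atlas; \<open>vector_of\<close> is the inverse operation.  Together with \<open>c0\<close> they form a chart of the tangent bundle.\<close>

locale tangent_coordinates =
  fixes M :: "('a, 'n::finite) cmfd" and c0 :: "('a, 'n) chart"
  assumes M: "complex_manifold M" and c0: "holo_chart M c0"
begin

lemma chart_facts:
  "charted M" "top_chart (mtop M) c0" "c \<in> atlas M \<Longrightarrow> top_chart (mtop M) c"
  "c \<in> atlas M \<Longrightarrow> holo_compatible c0 c" "c \<in> atlas M \<Longrightarrow> holo_compatible c c0"
  "c \<in> atlas M \<Longrightarrow> d \<in> atlas M \<Longrightarrow> holo_compatible c d"
  using M c0 holo_compatible_sym[of c0 c]
  by (auto simp: complex_manifold_def holo_chart_def complex_manifold_charted[OF M])

lemma charts_at_ex: "p \<in> fst c0 \<Longrightarrow> \<exists>c. c \<in> charts_at M p"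
  using charted_cover[OF chart_facts(1), of p] top_chart_subset[OF chart_facts(2)]
  unfolding charts_at_def by blast

lemma charts_atD: "c \<in> charts_at M p \<Longrightarrow> c \<in> atlas M" "c \<in> charts_at M p \<Longrightarrow> p \<in> fst c"
  by (auto simp: charts_at_def)

definition coords :: "'a \<Rightarrow> ('a, 'n) tvec \<Rightarrow> complex^'n" where
  "coords p v = (let c = SOME c. c \<in> charts_at M p in chart_jacobian c c0 p (v c))"

definition vector_of :: "'a \<Rightarrow> complex^'n \<Rightarrow> ('a, 'n) tvec" where
  "vector_of p b = (\<lambda>c. if c \<in> charts_at M p then chart_jacobian c0 c p b else 0)"

lemma tangent_space_jacobian:
  "v \<in> tangent_space M p \<Longrightarrow> c \<in> charts_at M p \<Longrightarrow> d \<in> charts_at M p \<Longrightarrow> v d = chart_jacobian c d p (v c)"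
  unfolding tangent_space_def chart_jacobian_def by blast

text \<open>The transformation law of tangent vectors and the cocycle identity make \<open>coords\<close> independent of the chart that
  is selected in its definition.\<close>

lemma coords_chart:
  assumes p: "p \<in> fst c0" and v: "v \<in> tangent_space M p" and c: "c \<in> charts_at M p"
  shows "coords p v = chart_jacobian c c0 p (v c)"
proof -
  define d where "d = (SOME c. c \<in> charts_at M p)"
  have d: "d \<in> charts_at M p" unfolding d_def by (rule someI[of _ c]) (rule c)
  have "coords p v = chart_jacobian d c0 p (v d)" by (simp add: coords_def d_def Let_def)
  also have "\<dots> = chart_jacobian c c0 p (v c)"
    unfolding tangent_space_jacobian[OF v d c]
    by (rule chart_jacobian_chain[symmetric, where T="mtop M"])
       (use chart_facts charts_atD c d p in auto)
  finally show ?thesis .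
qed

lemma coords_of_atlas_chart:
  assumes "c0 \<in> atlas M" "p \<in> fst c0" "v \<in> tangent_space M p"
  shows "coords p v = v c0"
  using coords_chart[OF assms(2,3), of c0] assms chart_jacobian_self[OF chart_facts(2) assms(2)]
  by (simp add: charts_at_def)

lemma vector_of_tangent: "p \<in> fst c0 \<Longrightarrow> vector_of p b \<in> tangent_space M p"
  unfolding tangent_space_def chart_jacobian_def[symmetric] vector_of_def
  using chart_facts charts_atD
  by (auto intro!: chart_jacobian_chain[symmetric, where T="mtop M"])

lemma coords_vector_of:
  assumes p: "p \<in> fst c0" shows "coords p (vector_of p b) = b"
proof -
  obtain c where c: "c \<in> charts_at M p" using charts_at_ex[OF p] by blast
  have "coords p (vector_of p b) = chart_jacobian c c0 p (chart_jacobian c0 c p b)"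
    using coords_chart[OF p vector_of_tangent[OF p] c, of b] c by (simp add: vector_of_def)
  also have "\<dots> = chart_jacobian c0 c0 p b"
    by (rule chart_jacobian_chain[where T="mtop M"]) (use chart_facts charts_atD c p in auto)
  also have "\<dots> = b" by (rule chart_jacobian_self[OF chart_facts(2) p])
  finally show ?thesis .
qed

lemma vector_of_coords:
  assumes p: "p \<in> fst c0" and v: "v \<in> tangent_space M p"
  shows "vector_of p (coords p v) = v"
proof
  fix c show "vector_of p (coords p v) c = v c"
  proof (cases "c \<in> charts_at M p")
    case True
    then have "vector_of p (coords p v) c = chart_jacobian c0 c p (chart_jacobian c c0 p (v c))"
      using coords_chart[OF p v True] by (simp add: vector_of_def)
    also have "\<dots> = chart_jacobian c c p (v c)"
      by (rule chart_jacobian_chain[where T="mtop M"]) (use chart_facts charts_atD True p in auto)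
    also have "\<dots> = v c" 
      by (rule chart_jacobian_self[OF chart_facts(3)[OF charts_atD(1)[OF True]] charts_atD(2)[OF True]])
    finally show ?thesis .
  next
    case False
    then have "v c = 0" using v unfolding tangent_space_def by blast
    with False show ?thesis by (simp add: vector_of_def)
  qed
qed

lemma coords_inject:
  "p \<in> fst c0 \<Longrightarrow> v \<in> tangent_space M p \<Longrightarrow> w \<in> tangent_space M p \<Longrightarrow> coords p v = coords p w \<longleftrightarrow> v = w"
  using vector_of_coords by metis

lemma vector_of_linear:
  assumes p: "p \<in> fst c0"
  shows "vector_of p (a + b) = tvec_add (vector_of p a) (vector_of p b)"
    and "vector_of p (k *s a) = tvec_scale k (vector_of p a)"
    and "vector_of p 0 = tvec_zero"
proof -
  have lin: "Vector_Spaces.linear (*s) (*s) (chart_jacobian c0 c p)" if "c \<in> charts_at M p" for c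
    by (rule transition_has_derivative(2)) (use chart_facts charts_atD that p in auto)
  show "vector_of p (a + b) = tvec_add (vector_of p a) (vector_of p b)"
    "vector_of p (k *s a) = tvec_scale k (vector_of p a)" "vector_of p 0 = tvec_zero"
    by (auto simp: vector_of_def fun_eq_iff vec.linear_add[OF lin] vec.linear_scale[OF lin] vec.linear_0[OF lin])
qed

lemma tvec_zero_tangent:
  assumes p: "p \<in> fst c0"
  shows "tvec_zero \<in> tangent_space M p" "coords p tvec_zero = 0"
  using vector_of_tangent[OF p, of 0] coords_vector_of[OF p, of 0] by (simp_all add: vector_of_linear(3)[OF p])

lemma tangent_space_closed:
  assumes p: "p \<in> fst c0" and v: "v \<in> tangent_space M p" and w: "w \<in> tangent_space M p"
  shows "tvec_add v w \<in> tangent_space M p" "tvec_scale k v \<in> tangent_space M p"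
    "coords p (tvec_add v w) = coords p v + coords p w" "coords p (tvec_scale k v) = k *s coords p v"
proof -
  have "tvec_add v w = vector_of p (coords p v + coords p w)" "tvec_scale k v = vector_of p (k *s coords p v)"
    by (simp_all add: vector_of_linear[OF p] vector_of_coords[OF p] v w)
  then show "tvec_add v w \<in> tangent_space M p" "tvec_scale k v \<in> tangent_space M p"
    "coords p (tvec_add v w) = coords p v + coords p w" "coords p (tvec_scale k v) = k *s coords p v"
    using vector_of_tangent[OF p] coords_vector_of[OF p] by metis+
qed

definition bundle_chart :: "('a \<times> ('a, 'n) tvec, 'n + 'n) chart" where
  "bundle_chart = ({(p, v)\<in>tangent_total M. p \<in> fst c0}, \<lambda>(p, v). join_halves (snd c0 p) (coords p v))"

lemma mem_bundle_chart: "(p, v) \<in> fst bundle_chart \<longleftrightarrow> p \<in> fst c0 \<and> v \<in> tangent_space M p"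
  using top_chart_subset[OF chart_facts(2)] by (auto simp: bundle_chart_def tangent_total_def)

lemma bundle_chart_apply [simp]: "snd bundle_chart (p, v) = join_halves (snd c0 p) (coords p v)"
  by (simp add: bundle_chart_def)

lemma mem_tangent_chart:
  "c \<in> atlas M \<Longrightarrow> (p, v) \<in> fst (tangent_chart M c) \<longleftrightarrow> p \<in> fst c \<and> v \<in> tangent_space M p"
  using top_chart_subset[OF chart_facts(3)[of c]] by (auto simp: tangent_chart_def tangent_total_def)

lemma tangent_chart_apply [simp]: "snd (tangent_chart M c) (p, v) = join_halves (snd c p) (v c)"
  by (simp add: tangent_chart_def join_halves_def vec_eq_iff split: sum.splits)

lemma join_halves_eq_iff: "join_halves a b = join_halves a' b' \<longleftrightarrow> a = a' \<and> b = b'"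
  by (metis halves_join)

lemma inj_bundle_chart: "inj_on (snd bundle_chart) (fst bundle_chart)"
proof (rule inj_onI, clarify)
  fix p v q w assume *: "(p, v) \<in> fst bundle_chart" "(q, w) \<in> fst bundle_chart"
    "snd bundle_chart (p, v) = snd bundle_chart (q, w)"
  then have "p = q" using top_chart_inj[OF chart_facts(2)]
    by (simp add: join_halves_eq_iff mem_bundle_chart inj_on_def)
  with * show "p = q \<and> v = w" by (simp add: join_halves_eq_iff mem_bundle_chart coords_inject)
qed

lemma image_bundle_chart:
  "snd bundle_chart ` {(p, v) \<in> fst bundle_chart. p \<in> A} = {y. left_half y \<in> snd c0 ` (fst c0 \<inter> A)}"
proof (intro equalityI subsetI)
  fix y assume "y \<in> {y. left_half y \<in> snd c0 ` (fst c0 \<inter> A)}"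
  then obtain p where p: "p \<in> fst c0" "p \<in> A" "left_half y = snd c0 p" by auto
  have "y = snd bundle_chart (p, vector_of p (right_half y))"
    by (simp add: coords_vector_of[OF p(1)] p(3)[symmetric])
  moreover have "(p, vector_of p (right_half y)) \<in> {(p, v) \<in> fst bundle_chart. p \<in> A}"
    using p vector_of_tangent by (simp add: mem_bundle_chart)
  ultimately show "y \<in> snd bundle_chart ` {(p, v) \<in> fst bundle_chart. p \<in> A}" by blast
qed (auto simp: mem_bundle_chart)

lemma tangent_transition_to:
  assumes c: "c \<in> atlas M" and p: "p \<in> fst c" "p \<in> fst c0" and v: "v \<in> tangent_space M p"
  shows "tangent_transition c c0 (snd (tangent_chart M c) (p, v)) = snd bundle_chart (p, v)"
  using coords_chart[OF p(2) v, of c] c p top_chart_inj[OF chart_facts(3)[OF c]]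
  by (simp add: tangent_transition_def transition_chart charts_at_def chart_jacobian_def)

lemma tangent_transition_from:
  assumes c: "c \<in> atlas M" and p: "p \<in> fst c" "p \<in> fst c0" and v: "v \<in> tangent_space M p"
  shows "tangent_transition c0 c (snd bundle_chart (p, v)) = snd (tangent_chart M c) (p, v)"
proof -
  have "c \<in> charts_at M p" using c p by (simp add: charts_at_def)
  then have "v c = chart_jacobian c0 c p (coords p v)"
    using fun_cong[OF vector_of_coords[OF p(2) v], of c] by (simp add: vector_of_def)
  then show ?thesis
    using top_chart_inj[OF chart_facts(2)] p by (simp add: tangent_transition_def transition_chart chart_jacobian_def)
qed

lemma open_tangent_transition_preimage:
  assumes c: "top_chart (mtop M) c" and d: "top_chart (mtop M) d" and cd: "holo_compatible c d" and B: "open B"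
  shows "open {y. left_half y \<in> snd c ` (fst c \<inter> fst d) \<and> tangent_transition c d y \<in> B}"
proof -
  let ?O = "{y. left_half y \<in> snd c ` (fst c \<inter> fst d)}"
  have "open ?O"
    by (rule open_left_half[OF top_chart_open_image[OF c]]) (use d in \<open>simp add: top_chart_def\<close>)
  then have "open (tangent_transition c d -` B \<inter> ?O)"
    using continuous_on_open_vimage holo_vec_on_imp_continuous_on[OF holo_tangent_transition[OF c d cd]] B by blast
  moreover have "tangent_transition c d -` B \<inter> ?O =
    {y. left_half y \<in> snd c ` (fst c \<inter> fst d) \<and> tangent_transition c d y \<in> B}" by auto
  ultimately show ?thesis by simp
qed

lemma openin_tangent_chart_preimage:
  "c \<in> atlas M \<Longrightarrow> open B \<Longrightarrow>
   openin (mtop (tangent_bundle M)) {q\<in>fst (tangent_chart M c). snd (tangent_chart M c) q \<in> B}"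
  unfolding tangent_bundle_def by (simp only: cmfd.select_convs, rule topology_generated_by_Basis) blast

lemma pts_tangent_bundle: "pts (tangent_bundle M) = tangent_total M"
proof -
  let ?S = "{{q\<in>fst (tangent_chart M c). snd (tangent_chart M c) q \<in> B} | c B. c \<in> atlas M \<and> open B}"
  have "\<Union>?S = tangent_total M"
  proof (intro equalityI subsetI)
    fix q assume "q \<in> \<Union>?S" then show "q \<in> tangent_total M" by (auto simp: tangent_chart_def)
  next
    fix q assume q: "q \<in> tangent_total M"
    then obtain p v where pv: "q = (p, v)" "p \<in> pts M" by (auto simp: tangent_total_def)
    obtain c where c: "c \<in> atlas M" "p \<in> fst c" using charted_cover[OF chart_facts(1) pv(2)] by blast
    then have "q \<in> {q\<in>fst (tangent_chart M c). snd (tangent_chart M c) q \<in> UNIV}"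
      using q pv by (auto simp: tangent_chart_def)
    then show "q \<in> \<Union>?S" using c(1) open_UNIV by blast
  qed
  then show ?thesis by (simp add: tangent_bundle_def topology_generated_by_topspace)
qed

lemma bundle_chart_preimage:
  assumes B: "open B"
  shows "openin (mtop (tangent_bundle M)) {q \<in> fst bundle_chart. snd bundle_chart q \<in> B}"
proof -
  define P where "P = (\<lambda>c. {q\<in>fst (tangent_chart M c). snd (tangent_chart M c) q \<in>
      {y. left_half y \<in> snd c ` (fst c \<inter> fst c0) \<and> tangent_transition c c0 y \<in> B}})"
  (* the preimage of B, cut into the pieces over the charts c of the atlas *)
  have "openin (mtop (tangent_bundle M)) (\<Union>c\<in>atlas M. P c)"
    unfolding P_def
    by (intro openin_Union ballI, clarify)
       (intro openin_tangent_chart_preimage open_tangent_transition_preimage chart_facts B; assumption)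
  moreover have "(\<Union>c\<in>atlas M. P c) = {q \<in> fst bundle_chart. snd bundle_chart q \<in> B}"
  proof (intro equalityI subsetI)
    fix q assume "q \<in> (\<Union>c\<in>atlas M. P c)"
    then obtain c where c: "c \<in> atlas M" "q \<in> P c" by blast
    obtain p v where q: "q = (p, v)" by force
    have *: "p \<in> fst c" "v \<in> tangent_space M p" "snd c p \<in> snd c ` (fst c \<inter> fst c0)"
      "tangent_transition c c0 (snd (tangent_chart M c) (p, v)) \<in> B"
      using c q mem_tangent_chart[OF c(1)] by (auto simp: P_def simp del: tangent_chart_apply) (auto)
    then have "p \<in> fst c0" using top_chart_inj[OF chart_facts(3)[OF c(1)]] by (auto simp: inj_on_def)
    then show "q \<in> {q \<in> fst bundle_chart. snd bundle_chart q \<in> B}"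
      using tangent_transition_to[OF c(1) *(1) _ *(2)] * q by (simp add: mem_bundle_chart)
  next
    fix q assume q: "q \<in> {q \<in> fst bundle_chart. snd bundle_chart q \<in> B}"
    obtain p v where pv: "q = (p, v)" by force
    then have *: "p \<in> fst c0" "v \<in> tangent_space M p" using q by (auto simp: mem_bundle_chart)
    obtain c where c: "c \<in> charts_at M p" using charts_at_ex[OF *(1)] by blast
    note ca = charts_atD[OF c]
    have "q \<in> P c"
      using q pv * ca tangent_transition_to[OF ca *] mem_tangent_chart[OF ca(1)] by (auto simp: P_def)
    then show "q \<in> (\<Union>c\<in>atlas M. P c)" using ca(1) by blast
  qed
  ultimately show ?thesis by simp
qed

text \<open>The chart is open because its inverse is continuous.  As the topology of the tangent bundle is generated by
  preimages under the charts of the atlas, continuity is tested on them, where it is continuity of the coordinate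
  changes.\<close>

lemma bundle_chart_image:
  assumes V: "openin (mtop (tangent_bundle M)) V"
  shows "open (snd bundle_chart ` (fst bundle_chart \<inter> V))"
proof -
  define \<psi> where "\<psi> = inv_into (fst bundle_chart) (snd bundle_chart)"
  let ?D = "{y. left_half y \<in> snd c0 ` fst c0}"
  let ?S = "{{q\<in>fst (tangent_chart M c). snd (tangent_chart M c) q \<in> B} | c B. c \<in> atlas M \<and> open B}"
  have D: "open ?D" using chart_facts(2) by (intro open_left_half) (simp add: top_chart_def)
  have im: "snd bundle_chart ` fst bundle_chart = ?D"
    using image_bundle_chart[of UNIV] by simp
  have \<psi>: "\<psi> (snd bundle_chart q) = q" if "q \<in> fst bundle_chart" for q
    using inj_bundle_chart that by (simp add: \<psi>_def)
  have "continuous_map (top_of_set ?D) (topology_generated_by ?S) \<psi>"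
  proof (rule continuous_on_generated_topo)
    fix U assume "U \<in> ?S"
    then obtain c B where c: "c \<in> atlas M" and B: "open B"
      and U: "U = {q\<in>fst (tangent_chart M c). snd (tangent_chart M c) q \<in> B}" by blast
    have "\<psi> -` U \<inter> topspace (top_of_set ?D) =
      {y. left_half y \<in> snd c0 ` (fst c0 \<inter> fst c) \<and> tangent_transition c0 c y \<in> B}" (is "?A = ?E")
    proof (intro equalityI subsetI)
      fix y assume y: "y \<in> ?A"
      then have "y \<in> snd bundle_chart ` fst bundle_chart" unfolding im by simp
      then obtain p v where pv: "y = snd bundle_chart (p, v)" "(p, v) \<in> fst bundle_chart" by force
      have "\<psi> y \<in> U" using y by blast
      moreover have "\<psi> y = (p, v)" unfolding pv(1) by (rule \<psi>[OF pv(2)])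
      ultimately have "(p, v) \<in> U" by simp
      then show "y \<in> ?E"
        using pv tangent_transition_from[OF c] by (auto simp: U mem_tangent_chart[OF c] mem_bundle_chart)
    next
      fix y assume y: "y \<in> ?E"
      then have "y \<in> snd bundle_chart ` {(p, v) \<in> fst bundle_chart. p \<in> fst c}"
        unfolding image_bundle_chart by simp
      then obtain p v where pv: "y = snd bundle_chart (p, v)" "(p, v) \<in> fst bundle_chart" "p \<in> fst c" by force
      then have "(p, v) \<in> U"
        using y tangent_transition_from[OF c, of p v] by (auto simp: U mem_tangent_chart[OF c] mem_bundle_chart)
      then show "y \<in> ?A" using pv \<psi> by (auto simp: mem_bundle_chart)
    qed
    moreover have "open ?E"
      by (rule open_tangent_transition_preimage[OF chart_facts(2,3,4) B]) (rule c)+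
    ultimately show "openin (top_of_set ?D) (\<psi> -` U \<inter> topspace (top_of_set ?D))"
      using D by (metis (no_types, lifting) Int_commute open_subset openin_open_eq topspace_euclidean_subtopology inf_le2)
  next
    have "\<psi> ` ?D \<subseteq> fst bundle_chart" unfolding im[symmetric] using \<psi> by auto
    also have "\<dots> \<subseteq> tangent_total M" by (auto simp: bundle_chart_def)
    also have "\<dots> = \<Union>?S" using pts_tangent_bundle by (simp add: tangent_bundle_def topology_generated_by_topspace)
    finally show "\<psi> ` topspace (top_of_set ?D) \<subseteq> \<Union>?S" by simp
  qed
  then have "openin (top_of_set ?D) {y \<in> topspace (top_of_set ?D). \<psi> y \<in> V}"
    using V by (intro openin_continuous_map_preimage) (auto simp: tangent_bundle_def)
  then have "open {y \<in> ?D. \<psi> y \<in> V}" using D openin_open_eq by auto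
  moreover have "{y \<in> ?D. \<psi> y \<in> V} = snd bundle_chart ` (fst bundle_chart \<inter> V)"
    unfolding im[symmetric] using \<psi> by auto
  ultimately show ?thesis by simp
qed

lemma top_chart_bundle_chart: "top_chart (mtop (tangent_bundle M)) bundle_chart"
proof (rule top_chartI[OF _ inj_bundle_chart])
  show "openin (mtop (tangent_bundle M)) (fst bundle_chart)" using bundle_chart_preimage[OF open_UNIV] by simp
qed (rule bundle_chart_image bundle_chart_preimage; assumption)+

end

lemma top_chart_tangent_chart:
  assumes M: "complex_manifold M" and c: "c \<in> atlas M"
  shows "top_chart (mtop (tangent_bundle M)) (tangent_chart M c)"
proof -
  interpret tangent_coordinates M c by unfold_locales (rule M, rule atlas_holo_chart[OF M c])
  show ?thesis
  proof (rule top_chart_cong[OF top_chart_bundle_chart])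
    show "fst (tangent_chart M c) = fst bundle_chart" by (simp add: tangent_chart_def bundle_chart_def)
    fix q assume "q \<in> fst bundle_chart"
    then show "snd (tangent_chart M c) q = snd bundle_chart q"
      by (cases q) (simp add: mem_bundle_chart coords_of_atlas_chart[OF c])
  qed
qed

lemma charted_tangent_bundle:
  assumes M: "complex_manifold M"
  shows "charted (tangent_bundle M)"
proof (cases "atlas M = {}")
  case True
  then show ?thesis
    by (auto simp: charted_def tangent_bundle_def topology_generated_by_topspace)
next
  case False
  then obtain c where c: "c \<in> atlas M" by blast
  interpret tangent_coordinates M c by unfold_locales (rule M, rule atlas_holo_chart[OF M c])
  have "(\<Union>c\<in>atlas (tangent_bundle M). fst c) = pts (tangent_bundle M)"
    unfolding pts_tangent_bundle
  proof (intro equalityI subsetI)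
    fix q assume "q \<in> tangent_total M"
    then obtain p v where pv: "q = (p, v)" "p \<in> pts M" "v \<in> tangent_space M p" by (auto simp: tangent_total_def)
    obtain d where d: "d \<in> atlas M" "p \<in> fst d" using charted_cover[OF chart_facts(1) pv(2)] by blast
    then show "q \<in> (\<Union>c\<in>atlas (tangent_bundle M). fst c)"
      using pv mem_tangent_chart[OF d(1)] by (auto simp: tangent_bundle_def)
  qed (auto simp: tangent_bundle_def tangent_chart_def)
  then show ?thesis using top_chart_tangent_chart[OF M] by (auto simp: charted_def tangent_bundle_def)
qed

context tangent_coordinates
begin

lemma holo_chart_bundle_chart: "holo_chart (tangent_bundle M) bundle_chart"
  unfolding holo_chart_def
proof (intro conjI ballI)
  show tb: "top_chart (mtop (tangent_bundle M)) bundle_chart" by (rule top_chart_bundle_chart)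
  fix d assume "d \<in> atlas (tangent_bundle M)"
  then obtain c where c: "c \<in> atlas M" and d: "d = tangent_chart M c" by (auto simp: tangent_bundle_def)
  have td: "top_chart (mtop (tangent_bundle M)) d" unfolding d by (rule top_chart_tangent_chart[OF M c])
  note inj = top_chart_inj[OF td]
  have od: "openin (mtop (tangent_bundle M)) (fst d)" and ob: "openin (mtop (tangent_bundle M)) (fst bundle_chart)"
    using td tb by (simp_all add: top_chart_def)
  show "holo_compatible bundle_chart d"
    unfolding holo_compatible_def
  proof
    show "holo_vec_on (snd bundle_chart ` (fst bundle_chart \<inter> fst d)) (transition bundle_chart d)"
    proof (rule holo_vec_on_cong_open[OF holo_tangent_transition[OF chart_facts(2,3,4), OF c c]])
      show "open (snd bundle_chart ` (fst bundle_chart \<inter> fst d))" by (rule top_chart_open_image[OF tb od])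
      show "snd bundle_chart ` (fst bundle_chart \<inter> fst d) \<subseteq> {y. left_half y \<in> snd c0 ` (fst c0 \<inter> fst c)}"
        by (auto simp: d mem_bundle_chart mem_tangent_chart[OF c])
      fix z assume "z \<in> snd bundle_chart ` (fst bundle_chart \<inter> fst d)"
      then obtain p v where pv: "z = snd bundle_chart (p, v)" "(p, v) \<in> fst bundle_chart" "(p, v) \<in> fst d" by force
      have "transition bundle_chart d z = snd d (p, v)"
        unfolding pv(1) by (rule transition_chart[OF inj_bundle_chart pv(2)])
      then show "tangent_transition c0 c z = transition bundle_chart d z"
        using pv tangent_transition_from[OF c, of p v] by (simp add: d mem_bundle_chart mem_tangent_chart[OF c])
    qed
    show "holo_vec_on (snd d ` (fst bundle_chart \<inter> fst d)) (transition d bundle_chart)"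
    proof (rule holo_vec_on_cong_open[OF holo_tangent_transition[OF chart_facts(3,2,5), OF c c]])
      show "open (snd d ` (fst bundle_chart \<inter> fst d))"
        using top_chart_open_image[OF td ob] by (simp add: Int_commute)
      show "snd d ` (fst bundle_chart \<inter> fst d) \<subseteq> {y. left_half y \<in> snd c ` (fst c \<inter> fst c0)}"
        by (auto simp: d mem_bundle_chart mem_tangent_chart[OF c])
      fix z assume "z \<in> snd d ` (fst bundle_chart \<inter> fst d)"
      then obtain p v where pv: "z = snd d (p, v)" "(p, v) \<in> fst bundle_chart" "(p, v) \<in> fst d" by force
      have "transition d bundle_chart z = snd bundle_chart (p, v)"
        unfolding pv(1) by (rule transition_chart[OF inj pv(3)])
      then show "tangent_transition c c0 z = transition d bundle_chart z"
        using pv tangent_transition_to[OF c, of p v] by (simp add: d mem_bundle_chart mem_tangent_chart[OF c])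
    qed
  qed
qed

end

section \<open>Normal spaces in a linear slice\<close>

definition fixed_part :: "'n::finite set \<Rightarrow> complex^'n \<Rightarrow> complex^'n" where
  "fixed_part I z = (\<chi> i. if i \<in> I then 0 else z $ i)"

definition moving_part :: "'n::finite set \<Rightarrow> complex^'n \<Rightarrow> complex^'n" where
  "moving_part I z = (\<chi> i. if i \<in> I then z $ i else 0)"

lemma fixed_plus_moving: "fixed_part I z + moving_part I z = z"
  by (simp add: fixed_part_def moving_part_def vec_eq_iff)

lemma parts_in_coord_subspace:
  "fixed_part I z \<in> coord_subspace (- I)" "moving_part I z \<in> coord_subspace I"
  by (simp_all add: fixed_part_def moving_part_def coord_subspace_def)

lemma coord_subspace_parts:
  "a \<in> coord_subspace (- I) \<Longrightarrow> b \<in> coord_subspace I \<Longrightarrow> fixed_part I (a + b) = a \<and> moving_part I (a + b) = b"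
  by (auto simp: fixed_part_def moving_part_def coord_subspace_def vec_eq_iff)

lemma subspace_coord_subspace: "vec.subspace (coord_subspace I)"
  by (auto simp: vec.subspace_def coord_subspace_def)

lemma coord_subspace_disjoint:
  "z \<in> coord_subspace I \<Longrightarrow> z \<in> coord_subspace (- I) \<Longrightarrow> z = 0"
  by (auto simp: coord_subspace_def vec_eq_iff)

lemma invariant_complement_sum:
  assumes "invariant_complement M H p K" "v \<in> tangent_space M p"
  obtains a b where "a \<in> fixed_tangent M H p" "b \<in> K" "v = tvec_add a b"
proof -
  have "\<exists>!(a, b). a \<in> fixed_tangent M H p \<and> b \<in> K \<and> v = tvec_add a b"
    using assms by (simp add: invariant_complement_def)
  then obtain ab where "case ab of (a, b) \<Rightarrow> a \<in> fixed_tangent M H p \<and> b \<in> K \<and> v = tvec_add a b"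
    by (elim ex1E)
  then have "fst ab \<in> fixed_tangent M H p \<and> snd ab \<in> K \<and> v = tvec_add (fst ab) (snd ab)"
    by (simp only: case_prod_beta)
  then show ?thesis by (elim conjE) (rule that)
qed

lemma invariant_complement_unique_sum:
  assumes K: "invariant_complement M H p K" and v: "v \<in> tangent_space M p"
    and ab: "a \<in> fixed_tangent M H p" "b \<in> K" "v = tvec_add a b"
    and ab': "a' \<in> fixed_tangent M H p" "b' \<in> K" "v = tvec_add a' b'"
  shows "(a, b) = (a', b')"
proof -
  let ?P = "\<lambda>(a, b). a \<in> fixed_tangent M H p \<and> b \<in> K \<and> v = tvec_add a b"
  have "\<exists>!x. ?P x" using K v by (simp add: invariant_complement_def)
  then have "\<exists>\<^sub>\<le>\<^sub>1x. ?P x" unfolding ex1_iff_ex_Uniq by (rule conjunct2)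
  moreover have "?P (a, b)" "?P (a', b')" using ab ab' by simp_all
  ultimately show ?thesis by (rule Uniq_D)
qed

text \<open>The consequences of a linear slice from which the embedding is constructed.  The group law of \<open>H\<close>
  enters through \<open>\<rho>_average\<close>, the connectedness of the component \<open>C\<close> through \<open>stratum\<close>, and the product
  shape of \<open>\<Phi> ` W\<close> through \<open>box\<close>.\<close>

locale slice = tangent_coordinates M "(W, \<Phi>)"
  for M :: "('a, 'n::finite) cmfd" and W :: "'a set" and \<Phi> :: "'a \<Rightarrow> complex^'n" +
  fixes H :: "('a \<Rightarrow> 'a) set" and \<rho> :: "('a \<Rightarrow> 'a) \<Rightarrow> complex^'n \<Rightarrow> complex^'n"
    and I :: "'n set" and C :: "'a set"
  assumes finite_H: "finite H" and H_nonempty: "H \<noteq> {}"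
    and \<rho>_linear: "h \<in> H \<Longrightarrow> Vector_Spaces.linear (*s) (*s) (\<rho> h)"
    and \<rho>_fixed: "{z. \<forall>h\<in>H. \<rho> h z = z} = coord_subspace (- I)"
    and \<rho>_invariant: "h \<in> H \<Longrightarrow> \<rho> h ` coord_subspace I = coord_subspace I"
    and \<rho>_average: "g \<in> H \<Longrightarrow> \<rho> g (\<Sum>h\<in>H. \<rho> h z) = (\<Sum>h\<in>H. \<rho> h z)"
    and H_W: "h \<in> H \<Longrightarrow> w \<in> W \<Longrightarrow> h w \<in> W"
    and \<Phi>_equivariant: "h \<in> H \<Longrightarrow> w \<in> W \<Longrightarrow> \<Phi> (h w) = \<rho> h (\<Phi> w)"
    and stratum: "w \<in> W \<Longrightarrow> w \<in> C \<longleftrightarrow> \<Phi> w \<in> coord_subspace (- I)"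
    and box: "w \<in> W \<Longrightarrow> fixed_part I (\<Phi> w) \<in> \<Phi> ` W"
begin

abbreviation "Y \<equiv> W \<inter> C"

lemma W_open: "openin (mtop M) W" and inj_\<Phi>: "inj_on \<Phi> W"
  and open_\<Phi>W: "open (\<Phi> ` W)" and W_sub: "W \<subseteq> pts M"
  using chart_facts(2) top_chart_inj[OF chart_facts(2)] top_chart_subset[OF chart_facts(2)]
  by (simp_all add: top_chart_def)

lemma \<rho>_fixedD: "h \<in> H \<Longrightarrow> z \<in> coord_subspace (- I) \<Longrightarrow> \<rho> h z = z"
  using \<rho>_fixed by blast

lemma fixed_point: "h \<in> H \<Longrightarrow> p \<in> Y \<Longrightarrow> h p = p"
  using \<Phi>_equivariant[of h p] \<rho>_fixedD[of h "\<Phi> p"] stratum[of p] H_W[of h p] inj_\<Phi>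
  by (auto simp: inj_on_def)

text \<open>Near \<open>p\<close> the map \<open>h\<close> is, in the chart \<open>\<Phi>\<close>, the linear map \<open>\<rho> h\<close>, which is its own differential.  Both charts of
  the atlas that enter the definition of \<open>tangent_map\<close> are compared with \<open>\<Phi>\<close> by the chain rule.\<close>

lemma tangent_map_coords:
  assumes h: "h \<in> H" and p: "p \<in> Y" and v: "v \<in> tangent_space M p"
  shows "tangent_map M h p v = vector_of p (\<rho> h (coords p v))"
proof
  have pW: "p \<in> W" using p by blast
  have hp: "h p = p" by (rule fixed_point[OF h p])
  have \<rho>p: "\<rho> h (\<Phi> p) = \<Phi> p" using \<rho>_fixedD[OF h] stratum[OF pW] p by blast
  have cont\<rho>: "continuous_on UNIV (\<rho> h)"
    by (rule holo_vec_on_imp_continuous_on[OF holo_vec_on_clinear[OF \<rho>_linear[OF h]]])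
  fix d
  define c where "c = (SOME c. c \<in> charts_at M p)"
  have c: "c \<in> charts_at M p" unfolding c_def using charts_at_ex[of p] pW by (auto intro: someI)
  note ca = charts_atD[OF c]
  show "tangent_map M h p v d = vector_of p (\<rho> h (coords p v)) d"
  proof (cases "d \<in> charts_at M p")
    case True
    note da = charts_atD[OF True]
    have tc: "top_chart (mtop M) c" and td: "top_chart (mtop M) d" using chart_facts ca da by blast+
    note inj = top_chart_inj[OF tc] top_chart_inj[OF td] top_chart_inj[OF chart_facts(2)]
    have cc: "holo_compatible c (W, \<Phi>)" and cd: "holo_compatible (W, \<Phi>) d"
      using chart_facts(4,5) ca da by blast+
    have D1: "(transition c (W, \<Phi>) has_derivative chart_jacobian c (W, \<Phi>) p) (at (snd c p))"
      by (rule transition_has_derivative(1)[OF cc ca(2)]) (use pW in simp)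
    have e1: "transition c (W, \<Phi>) (snd c p) = \<Phi> p" using transition_chart[OF inj(1) ca(2)] by simp
    have D2: "(\<rho> h has_derivative \<rho> h) (at (transition c (W, \<Phi>) (snd c p)))"
      by (rule bounded_linear_imp_has_derivative[OF bounded_linear_clinear[OF \<rho>_linear[OF h]]])
    have D3: "(transition (W, \<Phi>) d has_derivative chart_jacobian (W, \<Phi>) d p)
        (at (\<rho> h (transition c (W, \<Phi>) (snd c p))))"
      using transition_has_derivative(1)[OF cd _ da(2)] pW by (simp add: e1 \<rho>p)
    have "((\<lambda>z. transition (W, \<Phi>) d (\<rho> h (transition c (W, \<Phi>) z))) has_derivative
        (\<lambda>u. chart_jacobian (W, \<Phi>) d p (\<rho> h (chart_jacobian c (W, \<Phi>) p u)))) (at (snd c p))"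
      by (rule has_derivative_compose[OF has_derivative_compose[OF D1 D2] D3])
    (* a neighbourhood of p on which h maps into W and the domain of d *)
    moreover define N where "N = {q \<in> W. \<Phi> q \<in> \<rho> h -` (\<Phi> ` (W \<inter> fst d))}"
    have "openin (mtop M) N"
    proof -
      have "open (\<Phi> ` (W \<inter> fst d))"
        using top_chart_open_image[OF chart_facts(2), of "fst d"] td by (simp add: top_chart_def)
      then have "open (\<rho> h -` (\<Phi> ` (W \<inter> fst d)))" by (rule open_vimage[OF _ cont\<rho>])
      from top_chart_openin_vimage[OF chart_facts(2) this] show ?thesis by (simp add: N_def)
    qed
    then have "open (snd c ` (fst c \<inter> N))" by (rule top_chart_open_image[OF tc])
    moreover have "snd c p \<in> snd c ` (fst c \<inter> N)"
      using ca pW da by (auto simp: N_def \<rho>p)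
    ultimately have "((snd d \<circ> h \<circ> inv_into (fst c) (snd c)) has_derivative
        (\<lambda>u. chart_jacobian (W, \<Phi>) d p (\<rho> h (chart_jacobian c (W, \<Phi>) p u)))) (at (snd c p))"
    proof (rule has_derivative_transform_within_open)
      fix z assume "z \<in> snd c ` (fst c \<inter> N)"
      then obtain q where q: "z = snd c q" "q \<in> fst c" "q \<in> W" "\<rho> h (\<Phi> q) \<in> \<Phi> ` (W \<inter> fst d)"
        by (auto simp: N_def)
      then obtain q' where q': "\<rho> h (\<Phi> q) = \<Phi> q'" "q' \<in> W" "q' \<in> fst d" by blast
      then have "h q = q'"
        using \<Phi>_equivariant[OF h q(3)] H_W[OF h q(3)] inj_\<Phi> by (auto simp: inj_on_def)
      then show "transition (W, \<Phi>) d (\<rho> h (transition c (W, \<Phi>) z)) = (snd d \<circ> h \<circ> inv_into (fst c) (snd c)) z"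
        using q q' inj transition_chart[OF inj(3), of q' d] by (simp add: transition_chart[OF inj(1)])
    qed
    from frechet_derivative_at[OF this]
    have "frechet_derivative (snd d \<circ> h \<circ> inv_into (fst c) (snd c)) (at (snd c p)) (v c) =
        chart_jacobian (W, \<Phi>) d p (\<rho> h (chart_jacobian c (W, \<Phi>) p (v c)))" by metis
    then show ?thesis
      using True coords_chart[OF _ v c] pW
      by (simp add: tangent_map_def hp Let_def vector_of_def flip: c_def)
  next
    case False then show ?thesis by (simp add: tangent_map_def hp vector_of_def)
  qed
qed

lemma fixed_tangent_iff:
  assumes p: "p \<in> Y"
  shows "v \<in> fixed_tangent M H p \<longleftrightarrow> v \<in> tangent_space M p \<and> coords p v \<in> coord_subspace (- I)"
proof -
  have pW: "p \<in> fst (W, \<Phi>)" using p by simp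
  have "tangent_map M h p v = v \<longleftrightarrow> \<rho> h (coords p v) = coords p v"
    if v: "v \<in> tangent_space M p" and h: "h \<in> H" for h
    unfolding tangent_map_coords[OF h p v]
    using vector_of_coords[OF pW v] coords_vector_of[OF pW] by metis
  then show ?thesis unfolding fixed_tangent_def \<rho>_fixed[symmetric] by blast
qed

definition moving_tangent :: "'a \<Rightarrow> ('a, 'n) tvec set" where
  "moving_tangent p = {v \<in> tangent_space M p. coords p v \<in> coord_subspace I}"

lemma moving_tangent_complement:
  assumes p: "p \<in> Y"
  shows "invariant_complement M H p (moving_tangent p)"
  unfolding invariant_complement_def
proof (intro conjI ballI)
  have pW: "p \<in> fst (W, \<Phi>)" using p by simp
  note cl = tangent_space_closed[OF pW]
  note sub = vec.subspace_add[OF subspace_coord_subspace[of I]] vec.subspace_scale[OF subspace_coord_subspace[of I]]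
    vec.subspace_0[OF subspace_coord_subspace[of I]]
  note z = tvec_zero_tangent[OF pW]
  show "tangent_csubspace M p (moving_tangent p)"
    unfolding tangent_csubspace_def moving_tangent_def using sub cl(1,2,3,4) z by auto
  fix h assume h: "h \<in> H"
  show "tangent_map M h p ` moving_tangent p \<subseteq> moving_tangent p"
  proof (clarsimp simp: moving_tangent_def)
    fix v assume v: "v \<in> tangent_space M p" "coords p v \<in> coord_subspace I"
    then have "\<rho> h (coords p v) \<in> coord_subspace I" using \<rho>_invariant[OF h] by blast
    then show "tangent_map M h p v \<in> tangent_space M p \<and> coords p (tangent_map M h p v) \<in> coord_subspace I"
      unfolding tangent_map_coords[OF h p v(1)] using vector_of_tangent[OF pW] coords_vector_of[OF pW] by simp
  qed
next
  have pW: "p \<in> fst (W, \<Phi>)" using p by simp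
  note cl = tangent_space_closed[OF pW]
  fix v assume v: "v \<in> tangent_space M p"
  define a b where "a = vector_of p (fixed_part I (coords p v))" and "b = vector_of p (moving_part I (coords p v))"
  have ab: "a \<in> fixed_tangent M H p" "b \<in> moving_tangent p"
    unfolding fixed_tangent_iff[OF p] moving_tangent_def a_def b_def
    by (simp_all add: vector_of_tangent[OF pW] coords_vector_of[OF pW] parts_in_coord_subspace del: fst_conv)
  have "v = tvec_add a b"
    unfolding a_def b_def vector_of_linear(1)[OF pW, symmetric] fixed_plus_moving vector_of_coords[OF pW v] ..
  show "\<exists>!(a, b). a \<in> fixed_tangent M H p \<and> b \<in> moving_tangent p \<and> v = tvec_add a b"
  proof (rule ex1I[of _ "(a, b)"])
    show "case (a, b) of (a, b) \<Rightarrow> a \<in> fixed_tangent M H p \<and> b \<in> moving_tangent p \<and> v = tvec_add a b"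
      using ab \<open>v = tvec_add a b\<close> by simp
    fix ab' assume "case ab' of (a, b) \<Rightarrow> a \<in> fixed_tangent M H p \<and> b \<in> moving_tangent p \<and> v = tvec_add a b"
    then obtain a' b' where ab': "ab' = (a', b')" "a' \<in> fixed_tangent M H p" "b' \<in> moving_tangent p" "v = tvec_add a' b'"
      by (cases ab') auto
    then have t: "a' \<in> tangent_space M p" "b' \<in> tangent_space M p"
      and c: "coords p a' \<in> coord_subspace (- I)" "coords p b' \<in> coord_subspace I"
      unfolding fixed_tangent_iff[OF p] moving_tangent_def by auto
    have "coords p v = coords p a' + coords p b'" using ab'(4) cl(3)[OF t] by simp
    then have "fixed_part I (coords p v) = coords p a'" "moving_part I (coords p v) = coords p b'"
      using coord_subspace_parts[OF c] by simp_all
    then have "a = a'" "b = b'" using vector_of_coords[OF pW t(1)] vector_of_coords[OF pW t(2)] by (simp_all add: a_def b_def)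
    then show "ab' = (a, b)" using ab' by simp
  qed
qed

text \<open>For \<open>v\<close> in \<open>K\<close> with coordinates \<open>a + b\<close>, where \<open>a\<close> is the fixed part, the sum of the translates of \<open>v\<close> under \<open>H\<close>
  lies in \<open>K\<close>.  The translates of \<open>b\<close> have a fixed sum in the moving coordinate subspace, which is \<open>0\<close>; so the sum
  of the translates of \<open>v\<close> is \<open>card H\<close> times the fixed vector \<open>a\<close>.  As \<open>K\<close> meets the fixed vectors in \<open>0\<close>, this gives
  \<open>a = 0\<close> and one inclusion.  The other one follows since both sets are complements of the fixed vectors.\<close>

lemma invariant_complement_unique:
  assumes p: "p \<in> Y" and K: "invariant_complement M H p K"
  shows "K = moving_tangent p"
proof -
  have pW: "p \<in> fst (W, \<Phi>)" using p by simp
  note cl = tangent_space_closed[OF pW]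
  note z = tvec_zero_tangent[OF pW]
  have cs: "tangent_csubspace M p K" using K by (simp add: invariant_complement_def)
  have KT: "K \<subseteq> tangent_space M p" and K0: "tvec_zero \<in> K" and Kadd: "\<And>v w. v \<in> K \<Longrightarrow> w \<in> K \<Longrightarrow> tvec_add v w \<in> K"
    using cs by (simp_all add: tangent_csubspace_def)
  have Kinv: "\<And>h v. h \<in> H \<Longrightarrow> v \<in> K \<Longrightarrow> tangent_map M h p v \<in> K"
    using K by (simp add: invariant_complement_def image_subset_iff)
  have disjoint: "v = tvec_zero" if v: "v \<in> K" "v \<in> fixed_tangent M H p" for v
  proof -
    have vT: "v \<in> tangent_space M p" using v KT by blast
    have z0: "tvec_zero \<in> fixed_tangent M H p"
      unfolding fixed_tangent_iff[OF p] using z by (simp add: coord_subspace_def)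
    have e: "v = tvec_add v tvec_zero" "v = tvec_add tvec_zero v" by (auto simp: fun_eq_iff)
    have "(v, tvec_zero) = (tvec_zero, v)"
      by (rule invariant_complement_unique_sum[OF K vT v(2) K0 e(1) z0 v(1) e(2)])
    then show ?thesis by simp
  qed
  have KM: "coords p v \<in> coord_subspace I" if v: "v \<in> K" for v
  proof -
    have vT: "v \<in> tangent_space M p" using v KT by blast
    let ?a = "fixed_part I (coords p v)" and ?b = "moving_part I (coords p v)"
    have "vector_of p (\<Sum>h\<in>S. \<rho> h (coords p v)) \<in> K" if "S \<subseteq> H" for S
    proof -
      have "finite S" using that finite_H finite_subset by blast
      then show ?thesis using that
      proof (induction S)
        case empty then show ?case using K0 by (simp only: sum.empty vector_of_linear(3)[OF pW])
      next
        case (insert h S)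
        have "vector_of p (\<rho> h (coords p v)) \<in> K"
          using Kinv[of h v] insert.prems v tangent_map_coords[OF _ p vT, of h] by auto
        then have "tvec_add (vector_of p (\<rho> h (coords p v))) (vector_of p (\<Sum>h\<in>S. \<rho> h (coords p v))) \<in> K"
          using insert.IH insert.prems by (intro Kadd) auto
        then show ?case by (simp only: sum.insert[OF insert(1,2)] vector_of_linear(1)[OF pW])
      qed
    qed
    then have sK: "vector_of p (\<Sum>h\<in>H. \<rho> h (coords p v)) \<in> K" by blast
    have "\<rho> h ?b \<in> coord_subspace I" if "h \<in> H" for h
      using \<rho>_invariant[OF that] parts_in_coord_subspace(2) by blast
    then have "(\<Sum>h\<in>H. \<rho> h ?b) \<in> coord_subspace I"
      by (rule vec.subspace_sum[OF subspace_coord_subspace])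
    moreover have "(\<Sum>h\<in>H. \<rho> h ?b) \<in> coord_subspace (- I)"
      using \<rho>_average unfolding \<rho>_fixed[symmetric] by blast
    ultimately have b0: "(\<Sum>h\<in>H. \<rho> h ?b) = 0" by (rule coord_subspace_disjoint)
    have "\<rho> h (coords p v) = ?a + \<rho> h ?b" if "h \<in> H" for h
      using vec.linear_add[OF \<rho>_linear[OF that], of ?a ?b] \<rho>_fixedD[OF that parts_in_coord_subspace(1)]
      by (simp add: fixed_plus_moving)
    then have "(\<Sum>h\<in>H. \<rho> h (coords p v)) = (\<Sum>h\<in>H. ?a)"
      using b0 by (simp add: sum.distrib)
    also have "\<dots> = of_nat (card H) *s ?a" by (simp add: vec_eq_iff of_nat_index)
    finally have s: "(\<Sum>h\<in>H. \<rho> h (coords p v)) = of_nat (card H) *s ?a" .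
    have "vector_of p (of_nat (card H) *s ?a) \<in> fixed_tangent M H p"
      unfolding fixed_tangent_iff[OF p] coords_vector_of[OF pW]
      using vector_of_tangent[OF pW] vec.subspace_scale[OF subspace_coord_subspace parts_in_coord_subspace(1)] by blast
    then have "vector_of p (of_nat (card H) *s ?a) = tvec_zero" using disjoint sK s by simp
    then have "of_nat (card H) *s ?a = 0" using coords_vector_of[OF pW, of "of_nat (card H) *s ?a"] z by simp
    then have "?a = 0" using finite_H H_nonempty by (simp add: vec_eq_iff)
    then have "coords p v = ?b" using fixed_plus_moving[of I "coords p v"] by simp
    then show ?thesis using parts_in_coord_subspace(2)[of I "coords p v"] by simp
  qed
  show ?thesis
  proof (intro equalityI subsetI)
    fix v assume "v \<in> K" then show "v \<in> moving_tangent p" using KM KT by (auto simp: moving_tangent_def)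
  next
    fix v assume "v \<in> moving_tangent p"
    then have v: "v \<in> tangent_space M p" "coords p v \<in> coord_subspace I" by (auto simp: moving_tangent_def)
    obtain a b where ab: "a \<in> fixed_tangent M H p" "b \<in> K" "v = tvec_add a b" by (rule invariant_complement_sum[OF K v(1)])
    have t: "a \<in> tangent_space M p" "b \<in> tangent_space M p" using ab KT by (auto simp: fixed_tangent_def)
    have "coords p v = coords p a + coords p b" using ab cl(3)[OF t] by simp
    then have "coords p a = coords p v - coords p b" by simp
    then have "coords p a \<in> coord_subspace I"
      using vec.subspace_diff[OF subspace_coord_subspace v(2) KM[OF ab(2)]] by simp
    then have "coords p a = 0"
      using coord_subspace_disjoint ab(1) unfolding fixed_tangent_iff[OF p] by blast
    then have "a = tvec_zero" using coords_inject[OF pW t(1) z(1)] z(2) by simp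
    then have "v = b" using ab by (simp add: fun_eq_iff)
    then show "v \<in> K" using ab by simp
  qed
qed

lemma normal_space_eq: "p \<in> Y \<Longrightarrow> normal_space M H p = moving_tangent p"
  unfolding normal_space_def
  using moving_tangent_complement invariant_complement_unique by (intro the_equality) auto

end

section \<open>The embedding of a slice into the normal bundle\<close>

lemma second_countable_euclidean:
  "second_countable (euclidean :: 'a::second_countable_topology topology)"
proof -
  obtain B :: "'a set set" where "countable B" and B: "topological_basis B"
    using ex_countable_basis by blast
  show ?thesis
    unfolding second_countable_def
  proof (intro exI[of _ B] conjI ballI allI impI)
    show "countable B" by fact
    show "openin euclidean V" if "V \<in> B" for V
      using topological_basis_open[OF B that] by simp
    fix U :: "'a set" and x assume "openin euclidean U \<and> x \<in> U"
    then have "open U" "x \<in> U" by simp_all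
    then show "\<exists>V\<in>B. x \<in> V \<and> V \<subseteq> U" using topological_basisE[OF B] by metis
  qed
qed

lemma global_chart_Hausdorff_second_countable:
  assumes c: "top_chart T c" and full: "fst c = topspace T"
  shows "Hausdorff_space T" "second_countable T"
proof -
  have "homeomorphic_map T (top_of_set (snd c ` fst c)) (snd c)"
    using c full by (simp add: top_chart_def)
  then have h: "T homeomorphic_space top_of_set (snd c ` fst c)"
    by (rule homeomorphic_map_imp_homeomorphic_space)
  show "Hausdorff_space T"
    using homeomorphic_Hausdorff_space[OF h] by (simp add: Hausdorff_space_subtopology)
  show "second_countable T"
    using homeomorphic_space_second_countability[OF h]
    by (simp add: second_countable_subtopology second_countable_euclidean)
qed

lemma analytic_subset_global_chart:
  fixes M :: "('a, 'n::finite) cmfd"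
  assumes M: "charted M" and c: "holo_chart M c" "fst c = pts M"
    and Y: "Y \<subseteq> pts M" "\<And>q. q \<in> pts M \<Longrightarrow> q \<in> Y \<longleftrightarrow> snd c q \<in> coord_subspace (- I)"
  shows "analytic_subset M Y"
  unfolding analytic_subset_def
proof (intro conjI ballI)
  fix p assume p: "p \<in> pts M"
  let ?f = "\<lambda>i q. snd c q $ i"
  have "openin (mtop M) (pts M) \<and> p \<in> pts M \<and> finite (?f ` I) \<and> (\<forall>f\<in>?f ` I. holo_on_mfd M (pts M) f) \<and>
      Y \<inter> pts M = {q\<in>pts M. \<forall>f\<in>?f ` I. f q = 0}"
    using p Y holo_on_mfd_chart_component[OF M c(1) openin_topspace] c(2) by (auto simp: coord_subspace_def)
  then show "\<exists>U fs. openin (mtop M) U \<and> p \<in> U \<and> finite fs \<and> (\<forall>f\<in>fs. holo_on_mfd M U f) \<and>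
      Y \<inter> U = {q\<in>U. \<forall>f\<in>fs. f q = 0}"
    by (intro exI)
qed (rule Y(1))

definition model_subspace :: "'n::finite set \<Rightarrow> (complex^('n+'n)) set" where
  "model_subspace I = {z. left_half z \<in> coord_subspace (- I) \<and> right_half z \<in> coord_subspace I}"

definition add_halves :: "complex^('n+'n) \<Rightarrow> complex^'n::finite" where
  "add_halves z = left_half z + right_half z"

lemma clinear_add_halves: "Vector_Spaces.linear (*s) (*s) add_halves"
  by (auto simp: Vector_Spaces.linear_iff vec.vector_space_axioms add_halves_def
      vec.linear_add[OF clinear_left_half] vec.linear_scale[OF clinear_left_half]
      vec.linear_add[OF clinear_right_half] vec.linear_scale[OF clinear_right_half] algebra_simps
      vec.scale_right_distrib)

lemma bij_add_halves: "bij_betw add_halves (model_subspace I) UNIV"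
proof (rule bij_betwI[where g="\<lambda>w. join_halves (fixed_part I w) (moving_part I w)"])
  show "(\<lambda>w. join_halves (fixed_part I w) (moving_part I w)) \<in> UNIV \<rightarrow> model_subspace I"
    by (auto simp: model_subspace_def parts_in_coord_subspace)
  show "join_halves (fixed_part I (add_halves z)) (moving_part I (add_halves z)) = z" if "z \<in> model_subspace I" for z
    using that coord_subspace_parts[of "left_half z" I "right_half z"] by (simp add: model_subspace_def add_halves_def)
qed (simp_all add: add_halves_def fixed_plus_moving)

lemma subspace_model_subspace: "vec.subspace (model_subspace I)"
  using subspace_coord_subspace[of I] subspace_coord_subspace[of "- I"]
  by (auto simp: vec.subspace_def model_subspace_def
      vec.linear_add[OF clinear_left_half] vec.linear_scale[OF clinear_left_half] vec.linear_0[OF clinear_left_half]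
      vec.linear_add[OF clinear_right_half] vec.linear_scale[OF clinear_right_half] vec.linear_0[OF clinear_right_half])

context slice
begin

abbreviation "NC \<equiv> Sigma C (normal_space M H)"

definition "N\<^sub>Y = fst bundle_chart \<inter> NC"

definition "\<Psi> = add_halves \<circ> snd bundle_chart"

lemma \<Psi>_apply: "\<Psi> (p, v) = \<Phi> p + coords p v"
  by (simp add: \<Psi>_def add_halves_def)

lemma mem_normal: "(p, v) \<in> fst bundle_chart \<Longrightarrow> (p, v) \<in> NC \<longleftrightarrow> snd bundle_chart (p, v) \<in> model_subspace I"
  using stratum[of p] normal_space_eq[of p]
  by (auto simp: mem_bundle_chart model_subspace_def moving_tangent_def)

text \<open>In the chart of the tangent bundle induced by \<open>\<Phi>\<close> the normal bundle is linear: the base point has fixed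
  coordinates and the vector has moving components.\<close>

lemma adapted_bundle_chart: "adapted_chart (tangent_bundle M) NC bundle_chart (model_subspace I)"
  unfolding adapted_chart_def
proof (intro conjI holo_chart_bundle_chart subspace_model_subspace)
  have "q \<in> NC \<longleftrightarrow> snd bundle_chart q \<in> model_subspace I" if "q \<in> fst bundle_chart" for q
    using that mem_normal by (cases q) blast
  then show "snd bundle_chart ` (fst bundle_chart \<inter> NC) = snd bundle_chart ` fst bundle_chart \<inter> model_subspace I"
    by blast
qed

lemma mem_N\<^sub>Y: "(p, v) \<in> N\<^sub>Y \<longleftrightarrow> p \<in> Y \<and> v \<in> moving_tangent p"
  using normal_space_eq[of p] by (auto simp: N\<^sub>Y_def mem_bundle_chart moving_tangent_def)

abbreviation "NB \<equiv> normal_bundle M H C"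

abbreviation "NW \<equiv> bundle_restrict NB Y"

lemma NW_eq: "NW = open_submfd NB N\<^sub>Y"
proof -
  have "{q\<in>pts NB. fst q \<in> Y} = N\<^sub>Y"
    unfolding normal_bundle_def mtop_submfd topspace_subtopology pts_tangent_bundle
    by (auto simp: N\<^sub>Y_def tangent_total_def mem_bundle_chart) (use W_sub in auto)
  then show ?thesis by (simp add: bundle_restrict_def)
qed

lemma N\<^sub>Y_open: "openin (mtop NB) N\<^sub>Y"
  using top_chart_bundle_chart by (auto simp: normal_bundle_def N\<^sub>Y_def top_chart_def openin_subtopology_Int)

lemma pts_NW: "pts NW = N\<^sub>Y"
  unfolding NW_eq using openin_subset[OF N\<^sub>Y_open] by auto

lemma \<Psi>_in_atlas: "(N\<^sub>Y, \<Psi>) \<in> atlas NW"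
proof -
  have "(N\<^sub>Y, \<Psi>) \<in> atlas NB"
    unfolding normal_bundle_def submfd_def N\<^sub>Y_def \<Psi>_def
    by (simp only: cmfd.select_convs, intro CollectI exI[of _ bundle_chart] exI[of _ "model_subspace I"]
        exI[of _ add_halves] conjI refl adapted_bundle_chart clinear_add_halves bij_add_halves)
  then show ?thesis unfolding NW_eq atlas_open_submfd by (force intro: rev_image_eqI)
qed

text \<open>The chart \<open>\<Psi>\<close> covers the bundle, so the separation and countability axioms are inherited from an open
  subset of the model space.\<close>

lemma complex_manifold_NW: "complex_manifold NW"
proof -
  have TM: "charted (tangent_bundle M)" by (rule charted_tangent_bundle[OF M])
  have tc: "top_chart (mtop NB) c" if "c \<in> atlas NB" for c
    using that submfd_top_chart by (simp add: normal_bundle_def)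
  have tcN: "top_chart (mtop NW) c" if c: "c \<in> atlas NW" for c
  proof -
    obtain d where "d \<in> atlas NB" "c = (fst d \<inter> N\<^sub>Y, snd d)" using c unfolding NW_eq atlas_open_submfd by blast
    then show ?thesis using top_chart_restrict[OF tc N\<^sub>Y_open] unfolding NW_eq by simp
  qed
  have "holo_compatible c d" if cd: "c \<in> atlas NW" "d \<in> atlas NW" for c d
  proof -
    obtain c' d' where c': "c' \<in> atlas NB" "c = (fst c' \<inter> N\<^sub>Y, snd c')"
      and d': "d' \<in> atlas NB" "d = (fst d' \<inter> N\<^sub>Y, snd d')"
      using cd unfolding NW_eq atlas_open_submfd image_iff by metis
    have "holo_compatible c' d'"
      using submfd_compatible[OF TM] c'(1) d'(1) unfolding normal_bundle_def by metis
    then show ?thesis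
      unfolding c'(2) d'(2) by (rule holo_compatible_restrict[OF tc[OF c'(1)] tc[OF d'(1)] _ N\<^sub>Y_open])
  qed
  moreover have "(\<Union>c\<in>atlas NW. fst c) = pts NW"
  proof (intro equalityI subsetI)
    fix q assume "q \<in> (\<Union>c\<in>atlas NW. fst c)" then show "q \<in> pts NW" using tcN top_chart_subset by blast
  next
    fix q assume "q \<in> pts NW"
    then have "q \<in> fst (N\<^sub>Y, \<Psi>)" by (simp add: pts_NW)
    then show "q \<in> (\<Union>c\<in>atlas NW. fst c)" using \<Psi>_in_atlas by blast
  qed
  moreover have "Hausdorff_space (mtop NW)" "second_countable (mtop NW)"
    using global_chart_Hausdorff_second_countable[OF tcN[OF \<Psi>_in_atlas]] pts_NW by simp_all
  ultimately show ?thesis using tcN by (simp add: complex_manifold_def)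
qed

lemma holo_chart_\<Psi>: "holo_chart NW (N\<^sub>Y, \<Psi>)"
  by (rule atlas_holo_chart[OF complex_manifold_NW \<Psi>_in_atlas])

lemma inj_\<Psi>: "inj_on \<Psi> N\<^sub>Y"
  using holo_chart_\<Psi> top_chart_inj[of "mtop NW" "(N\<^sub>Y, \<Psi>)"] by (simp add: holo_chart_def)

text \<open>The point of \<open>W\<close> whose coordinates are the fixed part of \<open>\<Phi> w\<close> is the base point, and the moving part
  gives the normal vector.\<close>

lemma image_\<Phi>_\<Psi>: "w \<in> W \<Longrightarrow> \<Phi> w \<in> \<Psi> ` N\<^sub>Y"
proof -
  assume "w \<in> W"
  then obtain p where p: "p \<in> W" "\<Phi> p = fixed_part I (\<Phi> w)" using box by (metis imageE)
  have pW: "p \<in> fst (W, \<Phi>)" using p by simp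
  have "\<Phi> p \<in> coord_subspace (- I)" using p parts_in_coord_subspace(1)[of I "\<Phi> w"] by simp
  then have "p \<in> Y" using p stratum by simp
  moreover have "vector_of p (moving_part I (\<Phi> w)) \<in> moving_tangent p"
    using vector_of_tangent[OF pW] coords_vector_of[OF pW] parts_in_coord_subspace(2)
    by (simp add: moving_tangent_def)
  ultimately have "(p, vector_of p (moving_part I (\<Phi> w))) \<in> N\<^sub>Y" by (simp add: mem_N\<^sub>Y)
  moreover have "\<Psi> (p, vector_of p (moving_part I (\<Phi> w))) = \<Phi> w"
    using coords_vector_of[OF pW] p(2) fixed_plus_moving by (simp add: \<Psi>_apply)
  ultimately show ?thesis by (metis imageI)
qed

definition "\<zeta> w = inv_into N\<^sub>Y \<Psi> (\<Phi> w)"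

lemma \<zeta>_mem: "w \<in> W \<Longrightarrow> \<zeta> w \<in> N\<^sub>Y" and \<Psi>_\<zeta>: "w \<in> W \<Longrightarrow> \<Psi> (\<zeta> w) = \<Phi> w"
  unfolding \<zeta>_def by (auto intro: inv_into_into f_inv_into_f image_\<Phi>_\<Psi>)

lemma \<zeta>_eqI: "w \<in> W \<Longrightarrow> q \<in> N\<^sub>Y \<Longrightarrow> \<Psi> q = \<Phi> w \<Longrightarrow> \<zeta> w = q"
  unfolding \<zeta>_def using inj_\<Psi> by (metis inv_into_f_f)

lemma inj_\<zeta>: "inj_on \<zeta> W"
  using \<Psi>_\<zeta> inj_\<Phi> unfolding inj_on_def by metis

abbreviation "V \<equiv> \<zeta> ` W"
abbreviation "MW \<equiv> open_submfd M W"
abbreviation "MV \<equiv> open_submfd NW V"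

lemma V_open: "openin (mtop NW) V"
proof -
  have "V = {q \<in> N\<^sub>Y. \<Psi> q \<in> \<Phi> ` W}"
    using \<zeta>_mem \<Psi>_\<zeta> \<zeta>_eqI by (auto simp: image_iff) metis
  moreover have "openin (mtop NW) {q \<in> fst (N\<^sub>Y, \<Psi>). snd (N\<^sub>Y, \<Psi>) q \<in> \<Phi> ` W}"
    by (rule top_chart_openin_vimage) (use holo_chart_\<Psi> open_\<Phi>W in \<open>auto simp: holo_chart_def\<close>)
  ultimately show ?thesis by simp
qed

lemma pts_MW: "pts MW = W" and pts_MV: "pts MV = V"
  using W_sub openin_subset[OF V_open] by auto

lemma complex_manifold_MW: "complex_manifold MW" and complex_manifold_MV: "complex_manifold MV"
  by (rule complex_manifold_open_submfd[OF M W_open], rule complex_manifold_open_submfd[OF complex_manifold_NW V_open])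

lemma holo_chart_MW: "holo_chart MW (W, \<Phi>)"
  using holo_chart_open_submfd[OF chart_facts(1) W_open c0] by simp

lemma holo_chart_MV: "holo_chart MV (V, \<Psi>)"
proof -
  have "N\<^sub>Y \<inter> V = V" using \<zeta>_mem by blast
  then show ?thesis
    using holo_chart_open_submfd[OF complex_manifold_charted[OF complex_manifold_NW] V_open holo_chart_\<Psi>] by simp
qed

lemma charted_MW: "charted MW" and charted_MV: "charted MV"
  by (rule complex_manifold_charted[OF complex_manifold_MW], rule complex_manifold_charted[OF complex_manifold_MV])

lemma clinear_id: "Vector_Spaces.linear (*s) (*s) (\<lambda>z::complex^'n. z)"
  by (simp add: Vector_Spaces.linear_iff vec.vector_space_axioms)

lemma holo_map_\<zeta>: "holo_map MW MV \<zeta>"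
proof (rule holo_map_global_chart[OF charted_MW charted_MV holo_chart_MW _ holo_chart_MV _ _ holo_vec_on_clinear[OF clinear_id]])
  fix w assume "w \<in> pts MW"
  then have w: "w \<in> W" by (simp only: pts_MW)
  show "\<zeta> w \<in> pts MV" using w unfolding pts_MV by blast
  show "snd (V, \<Psi>) (\<zeta> w) = snd (W, \<Phi>) w" using \<Psi>_\<zeta>[OF w] by simp
qed (simp_all only: fst_conv pts_MV pts_MW)

abbreviation "\<zeta>' \<equiv> inv_into (pts MW) \<zeta>"

lemma \<zeta>'_\<zeta>: "w \<in> W \<Longrightarrow> \<zeta>' (\<zeta> w) = w" and \<zeta>_\<zeta>': "q \<in> V \<Longrightarrow> \<zeta> (\<zeta>' q) = q" and \<zeta>'_mem: "q \<in> V \<Longrightarrow> \<zeta>' q \<in> W"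
  unfolding pts_MW using inj_\<zeta> by (auto simp: f_inv_into_f inv_into_into)

lemma holo_map_\<zeta>': "holo_map MV MW \<zeta>'"
proof (rule holo_map_global_chart[OF charted_MV charted_MW holo_chart_MV _ holo_chart_MW _ _ holo_vec_on_clinear[OF clinear_id]])
  fix q assume "q \<in> pts MV"
  then have q: "q \<in> V" by (simp only: pts_MV)
  show "\<zeta>' q \<in> pts MW" using \<zeta>'_mem[OF q] by (simp only: pts_MW)
  show "snd (W, \<Phi>) (\<zeta>' q) = snd (V, \<Psi>) q" using \<Psi>_\<zeta>[OF \<zeta>'_mem[OF q]] \<zeta>_\<zeta>'[OF q] by simp
qed (simp_all only: fst_conv pts_MV pts_MW)

lemma embedding: "holo_open_embedding MW NW \<zeta>"
  unfolding holo_open_embedding_def biholomorphic_def pts_MW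
  using complex_manifold_NW V_open complex_manifold_MW complex_manifold_MV inj_\<zeta> holo_map_\<zeta> holo_map_\<zeta>'
  unfolding pts_MW pts_MV by (simp add: bij_betw_def pts_MV[simplified])

text \<open>Both sides have the same coordinate \<open>\<rho> h (\<Phi> w)\<close> in the chart \<open>\<Psi>\<close>: the base point is fixed by \<open>h\<close>, and on the
  vector \<open>h\<close> acts by \<open>\<rho> h\<close>.\<close>

lemma equivariant:
  assumes h: "h \<in> H" and w: "w \<in> W"
  shows "\<zeta> (h w) = bundle_action M h (\<zeta> w)"
proof -
  obtain p v where pv: "\<zeta> w = (p, v)" by force
  then have "(p, v) \<in> N\<^sub>Y" using \<zeta>_mem[OF w] by simp
  then have p: "p \<in> Y" and v: "v \<in> tangent_space M p" "coords p v \<in> coord_subspace I"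
    by (auto simp: mem_N\<^sub>Y moving_tangent_def)
  have pW: "p \<in> fst (W, \<Phi>)" using p by simp
  have act: "bundle_action M h (\<zeta> w) = (p, vector_of p (\<rho> h (coords p v)))"
    using pv fixed_point[OF h p] tangent_map_coords[OF h p v(1)] by (simp add: bundle_action_def)
  have "\<rho> h (coords p v) \<in> coord_subspace I" using \<rho>_invariant[OF h] v(2) by blast
  then have mem: "(p, vector_of p (\<rho> h (coords p v))) \<in> N\<^sub>Y"
    using p vector_of_tangent[OF pW] coords_vector_of[OF pW] by (simp add: mem_N\<^sub>Y moving_tangent_def)
  have "\<Phi> p \<in> coord_subspace (- I)" using p stratum by blast
  then have "\<Psi> (p, vector_of p (\<rho> h (coords p v))) = \<rho> h (\<Phi> p) + \<rho> h (coords p v)"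
    using \<rho>_fixedD[OF h] coords_vector_of[OF pW] by (simp add: \<Psi>_apply)
  also have "\<dots> = \<rho> h (\<Psi> (p, v))" by (simp add: \<Psi>_apply vec.linear_add[OF \<rho>_linear[OF h]])
  also have "\<dots> = \<Phi> (h w)" using \<Psi>_\<zeta>[OF w] \<Phi>_equivariant[OF h w] pv by simp
  finally show ?thesis unfolding act by (rule \<zeta>_eqI[OF H_W[OF h w] mem])
qed

lemma \<zeta>_zero_section: "p \<in> Y \<Longrightarrow> \<zeta> p = (p, tvec_zero)"
proof (rule \<zeta>_eqI)
  assume p: "p \<in> Y"
  then have pW: "p \<in> fst (W, \<Phi>)" by simp
  note z = tvec_zero_tangent[OF pW]
  show "(p, tvec_zero) \<in> N\<^sub>Y"
    using p z by (simp add: mem_N\<^sub>Y moving_tangent_def coord_subspace_def)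
  show "\<Psi> (p, tvec_zero) = \<Phi> p" using z by (simp add: \<Psi>_apply)
qed simp

abbreviation "Z \<equiv> zero_section Y \<inter> V"

lemma Z_eq: "Z = \<zeta> ` Y"
  using \<zeta>_zero_section by (fastforce simp: zero_section_def image_iff)

lemma analytic_Y: "analytic_subset MW Y"
  by (rule analytic_subset_global_chart[OF charted_MW holo_chart_MW]) (auto simp: pts_MW stratum simp del: topspace_subtopology mtop_open_submfd)

lemma analytic_Z: "analytic_subset MV Z"
proof (rule analytic_subset_global_chart[OF charted_MV holo_chart_MV])
  show "Z \<subseteq> pts MV" unfolding pts_MV by blast
  fix q assume "q \<in> pts MV"
  then obtain w where w: "w \<in> W" "q = \<zeta> w" unfolding pts_MV by blast
  have "q \<in> Z \<longleftrightarrow> w \<in> Y" unfolding Z_eq using w inj_\<zeta> by (auto simp: inj_on_def)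
  then show "q \<in> Z \<longleftrightarrow> snd (V, \<Psi>) q \<in> coord_subspace (- I)" using w stratum \<Psi>_\<zeta> by simp
qed (simp only: fst_conv pts_MV)

lemma morphism_\<zeta>: "completion_morphism MW Y MV Z \<zeta>"
proof
  show "Y \<subseteq> pts MW" "Z \<subseteq> pts MV" unfolding pts_MW pts_MV by blast+
  show "pullback_map MW MV \<zeta>" by (rule holo_map_pullback_map[OF charted_MW charted_MV holo_map_\<zeta>])
  show "\<zeta> p \<in> Z" if "p \<in> Y" for p using that unfolding Z_eq by blast
qed

lemma morphism_\<zeta>': "completion_morphism MV Z MW Y \<zeta>'"
proof
  show "Y \<subseteq> pts MW" "Z \<subseteq> pts MV" unfolding pts_MW pts_MV by blast+
  show "pullback_map MV MW \<zeta>'" by (rule holo_map_pullback_map[OF charted_MV charted_MW holo_map_\<zeta>'])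
  show "\<zeta>' q \<in> Y" if "q \<in> Z" for q using that \<zeta>'_\<zeta> unfolding Z_eq by auto
qed

lemma iso: "cringed_iso (formal_completion MW Y) (formal_completion MV Z) (completion_map MW Y \<zeta>)"
  by (rule cringed_iso_completion_map[OF morphism_\<zeta> morphism_\<zeta>'])
     (auto simp only: pts_MW pts_MV \<zeta>'_\<zeta>[unfolded pts_MW] \<zeta>_\<zeta>'[unfolded pts_MW])

lemma morphism_H:
  assumes h: "h \<in> H"
  shows "completion_morphism MW Y MW Y h" "completion_morphism MV Z MV Z (bundle_action M h)"
proof -
  note lin = holo_vec_on_clinear[OF \<rho>_linear[OF h]]
  have "holo_map MW MW h"
    by (rule holo_map_global_chart[OF charted_MW charted_MW holo_chart_MW _ holo_chart_MW _ _ lin])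
       (simp_all only: fst_conv snd_conv pts_MW H_W[OF h] \<Phi>_equivariant[OF h])
  then show "completion_morphism MW Y MW Y h"
    using fixed_point[OF h] by unfold_locales (auto simp: pts_MW holo_map_pullback_map[OF charted_MW charted_MW] simp del: topspace_subtopology mtop_open_submfd)
  have "holo_map MV MV (bundle_action M h)"
  proof (rule holo_map_global_chart[OF charted_MV charted_MV holo_chart_MV _ holo_chart_MV _ _ lin])
    fix q assume "q \<in> pts MV"
    then obtain w where w: "w \<in> W" "q = \<zeta> w" unfolding pts_MV by blast
    have e: "bundle_action M h q = \<zeta> (h w)" using equivariant[OF h w(1)] w(2) by simp
    show "bundle_action M h q \<in> pts MV" unfolding pts_MV e using H_W[OF h w(1)] by blast
    show "snd (V, \<Psi>) (bundle_action M h q) = \<rho> h (snd (V, \<Psi>) q)"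
      unfolding e snd_conv using \<Psi>_\<zeta> H_W[OF h] \<Phi>_equivariant[OF h] w by simp
  qed (simp_all only: fst_conv pts_MV)
  then have pb: "pullback_map MV MV (bundle_action M h)"
    by (rule holo_map_pullback_map[OF charted_MV charted_MV])
  show "completion_morphism MV Z MV Z (bundle_action M h)"
  proof (rule completion_morphism.intro[OF _ _ pb])
    show "Z \<subseteq> pts MV" "Z \<subseteq> pts MV" unfolding pts_MV by blast+
    fix q assume "q \<in> Z"
    then obtain p where p: "p \<in> Y" "q = \<zeta> p" unfolding Z_eq by blast
    then have "bundle_action M h q = q" using equivariant[OF h, of p] fixed_point[OF h p(1)] by simp
    then show "bundle_action M h q \<in> Z" using \<open>q \<in> Z\<close> by simp
  qed
qed

lemma equivariant_completion:
  assumes h: "h \<in> H"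
  shows "rs_map_eq (formal_completion MW Y) (formal_completion MV Z)
     (rs_comp (formal_completion MW Y) (completion_map MW Y \<zeta>) (completion_map MW Y h))
     (rs_comp (formal_completion MV Z) (completion_map MV Z (bundle_action M h)) (completion_map MW Y \<zeta>))"
  by (rule completion_map_commuting_square[OF morphism_H(1)[OF h] morphism_\<zeta> morphism_\<zeta> morphism_H(2)[OF h]])
     (simp only: pts_MW equivariant[OF h])

end

section \<open>Orbit types in a linear slice\<close>

lemma coord_subspace_sum_fixed:
  "a \<in> coord_subspace (- I) \<Longrightarrow> b \<in> coord_subspace I \<Longrightarrow> a + b \<in> coord_subspace (- I) \<Longrightarrow> b = 0"
  by (auto simp: coord_subspace_def vec_eq_iff)

text \<open>Applying \<open>\<rho> g\<close> permutes the summands, by translation in the group.\<close>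

lemma group_action_average:
  fixes \<rho> :: "'g \<Rightarrow> complex^'n \<Rightarrow> complex^'n"
  assumes act: "group_action K UNIV \<rho>" and fin: "finite (carrier K)"
    and lin: "\<And>h. h \<in> carrier K \<Longrightarrow> Vector_Spaces.linear (*s) (*s) (\<rho> h)"
    and g: "g \<in> carrier K"
  shows "\<rho> g (\<Sum>h\<in>carrier K. \<rho> h z) = (\<Sum>h\<in>carrier K. \<rho> h z)"
proof -
  interpret group_action K UNIV \<rho> by fact
  interpret group K using group_hom by (simp add: group_hom_def)
  have inj: "inj_on (\<lambda>h. g \<otimes>\<^bsub>K\<^esub> h) (carrier K)" by (rule inj_on_cmult[OF g])
  have "(\<lambda>h. g \<otimes>\<^bsub>K\<^esub> h) ` carrier K = carrier K"
    by (rule endo_inj_surj[OF fin _ inj]) (use g in auto)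
  with inj have bij: "bij_betw (\<lambda>h. g \<otimes>\<^bsub>K\<^esub> h) (carrier K) (carrier K)" by (simp add: bij_betw_def)
  have "\<rho> g (\<Sum>h\<in>carrier K. \<rho> h z) = (\<Sum>h\<in>carrier K. \<rho> g (\<rho> h z))"
    by (rule vec.linear_sum[OF lin[OF g]])
  also have "\<dots> = (\<Sum>h\<in>carrier K. \<rho> (g \<otimes>\<^bsub>K\<^esub> h) z)"
    using composition_rule[OF UNIV_I g] by (intro sum.cong) auto
  also have "\<dots> = (\<Sum>h\<in>carrier K. \<rho> h z)"
    using sum.reindex_bij_betw[OF bij, of "\<lambda>h. \<rho> h z"] by simp
  finally show ?thesis .
qed

text \<open>Elements outside \<open>H\<close> move \<open>W\<close> off itself, so the stabiliser of a point of \<open>W\<close> is contained in \<open>H\<close>.\<close>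

lemma slice_orbit_type:
  assumes H: "H \<subseteq> G" and W: "W \<subseteq> pts M" and inv: "\<forall>h\<in>H. h ` W = W" and disj: "\<forall>g\<in>G - H. g ` W \<inter> W = {}"
    and inj: "inj_on \<Phi> W" and eq: "\<forall>h\<in>H. \<forall>w\<in>W. \<Phi> (h w) = \<rho> h (\<Phi> w)" and w: "w \<in> W"
  shows "w \<in> orbit_type M G H \<longleftrightarrow> (\<forall>h\<in>H. \<rho> h (\<Phi> w) = \<Phi> w)"
proof -
  have *: "h w = w \<longleftrightarrow> \<rho> h (\<Phi> w) = \<Phi> w" if h: "h \<in> H" for h
  proof -
    have "h w \<in> W" using inv h w by blast
    then have "h w = w \<longleftrightarrow> \<Phi> (h w) = \<Phi> w" using inj w by (auto simp: inj_on_def)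
    then show ?thesis using eq h w by simp
  qed
  have "g \<in> H" if "g \<in> G" "g w = w" for g
    using disj that w by (metis DiffI IntI empty_iff image_eqI)
  then have "Stab G w = H \<longleftrightarrow> (\<forall>h\<in>H. h w = w)" using H unfolding Stab_def by blast
  then show ?thesis using * W w unfolding orbit_type_def by auto
qed

text \<open>The subset \<open>K\<close> of \<open>W\<close> where \<open>\<Phi>\<close> takes values in the fixed space consists of the points of \<open>W\<close> of orbit type \<open>H\<close>.
  It corresponds under \<open>\<Phi>\<close> to the factor \<open>D\<close> of the box, because \<open>E\<close> contains \<open>0\<close>: the point \<open>x\<close> has a fixed
  coordinate vector.  As \<open>D\<close> is connected, \<open>K\<close> lies in the connected component \<open>C\<close> of \<open>x\<close>.\<close>

lemma linear_slice_imp_slice: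
  assumes M: "complex_manifold M" and G: "finite G" and H: "subgroup H (subgrp M G)"
    and C: "C \<in> orbit_type_strata M G H" and x: "x \<in> C" and W: "linear_slice M G H l x W"
  obtains \<Phi> \<rho> I where "slice M W \<Phi> H \<rho> I C"
proof -
  have HG: "H \<subseteq> G" using subgroup.subset[OF H] by (simp add: subgrp_def)
  then have finH: "finite H" using G finite_subset by blast
  obtain \<Phi> \<rho> I where inv: "\<forall>h\<in>H. h ` W = W" and disj: "\<forall>g\<in>G - H. g ` W \<inter> W = {}" and xW: "x \<in> W"
    and act: "group_action (subgrp M H) UNIV \<rho>" and lin: "\<forall>h\<in>H. Vector_Spaces.linear (*s) (*s) (\<rho> h)"
    and fix\<rho>: "{z. \<forall>h\<in>H. \<rho> h z = z} = coord_subspace (- I)"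
    and inv\<rho>: "\<forall>h\<in>H. \<rho> h ` coord_subspace I = coord_subspace I"
    and chart: "holo_chart M (W, \<Phi>)" and box: "product_box I (\<Phi> ` W)"
    and eq: "\<forall>h\<in>H. \<forall>w\<in>W. \<Phi> (h w) = \<rho> h (\<Phi> w)"
    using W unfolding linear_slice_def by (elim conjE exE) (rule that)
  have cH: "carrier (subgrp M H) = H" by (simp add: subgrp_def)
  have tc: "top_chart (mtop M) (W, \<Phi>)" using chart by (simp add: holo_chart_def)
  have WM: "W \<subseteq> pts M" and inj: "inj_on \<Phi> W" using top_chart_subset[OF tc] top_chart_inj[OF tc] by simp_all
  obtain D E where oD: "openin (top_of_set (coord_subspace (- I))) D" and "connected D"
    and oE: "openin (top_of_set (coord_subspace I)) E"
    and DE: "\<Phi> ` W = {a + b | a b. a \<in> D \<and> b \<in> E}"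
    using box unfolding product_box_def by (elim exE conjE) (rule that)
  have D: "D \<subseteq> coord_subspace (- I)" "connected D" and E: "E \<subseteq> coord_subspace I"
    using openin_subset[OF oD] openin_subset[OF oE] \<open>connected D\<close> by simp_all
  have orbit: "w \<in> orbit_type M G H \<longleftrightarrow> \<Phi> w \<in> coord_subspace (- I)" if "w \<in> W" for w
    unfolding slice_orbit_type[OF HG WM inv disj inj eq that] fix\<rho>[symmetric] by simp
  have C_sub: "C \<subseteq> orbit_type M G H"
    using connected_components_of_subset[OF C[unfolded orbit_type_strata_def]] by auto
  obtain a0 b0 where ab0: "\<Phi> x = a0 + b0" "a0 \<in> D" "b0 \<in> E" using DE xW by (smt (verit) imageI mem_Collect_eq)
  have "\<Phi> x \<in> coord_subspace (- I)" using orbit[OF xW] C_sub x by blast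
  then have "b0 = 0"
    using coord_subspace_sum_fixed[of a0 I b0] ab0 D(1) E by auto
  then have zero: "0 \<in> E" using ab0 by simp
  have D_image: "D \<subseteq> \<Phi> ` W" unfolding DE using zero by force
  define K where "K = {w \<in> W. \<Phi> w \<in> coord_subspace (- I)}"
  have "\<Phi> ` K = D"
  proof (intro equalityI subsetI)
    fix z assume "z \<in> \<Phi> ` K"
    then have "z \<in> \<Phi> ` W" and z: "z \<in> coord_subspace (- I)" by (auto simp: K_def)
    then obtain a b where ab: "z = a + b" "a \<in> D" "b \<in> E" unfolding DE by blast
    then have "z = a"
      using coord_subspace_sum_fixed[of a I b] z D(1) E by auto
    then show "z \<in> D" using ab by simp
  next
    fix z assume "z \<in> D" then show "z \<in> \<Phi> ` K" using D_image D(1) by (auto simp: K_def)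
  qed
  then have "connectedin (top_of_set (\<Phi> ` W)) (\<Phi> ` K)"
    using D(2) D_image by (simp add: connectedin_subtopology connectedin_iff_connected)
  then have "connectedin (subtopology (mtop M) W) K"
    using homeomorphic_map_connectedness[of "subtopology (mtop M) W" "top_of_set (\<Phi> ` W)" \<Phi> K] tc WM
    by (auto simp: top_chart_def K_def)
  then have "connectedin (mtop M) K" by (simp add: connectedin_subtopology)
  moreover have "K \<subseteq> orbit_type M G H" using orbit by (auto simp: K_def)
  ultimately have "connectedin (subtopology (mtop M) (orbit_type M G H)) K"
    by (simp add: connectedin_subtopology)
  moreover have "x \<in> K" using xW \<open>\<Phi> x \<in> coord_subspace (- I)\<close> by (simp add: K_def)
  ultimately have K_sub: "K \<subseteq> C"
    using connected_components_of_maximal[OF C[unfolded orbit_type_strata_def]] x by (auto simp: disjnt_def)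
  have "slice M W \<Phi> H \<rho> I C"
  proof (intro slice.intro slice_axioms.intro tangent_coordinates.intro)
    show "complex_manifold M" "holo_chart M (W, \<Phi>)" "finite H" by fact+
    show "H \<noteq> {}" using subgroup.one_closed[OF H] by blast
    show "{z. \<forall>h\<in>H. \<rho> h z = z} = coord_subspace (- I)" by fact
    show "Vector_Spaces.linear (*s) (*s) (\<rho> h)" "\<rho> h ` coord_subspace I = coord_subspace I" if "h \<in> H" for h
      using lin inv\<rho> that by blast+
    show "\<rho> g (\<Sum>h\<in>H. \<rho> h z) = (\<Sum>h\<in>H. \<rho> h z)" if "g \<in> H" for g z
      using group_action_average[OF act, unfolded cH, OF finH _ that] lin by blast
    show "h w \<in> W" "\<Phi> (h w) = \<rho> h (\<Phi> w)" if "h \<in> H" "w \<in> W" for h w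
      using inv eq that by blast+
    show "w \<in> C \<longleftrightarrow> \<Phi> w \<in> coord_subspace (- I)" if "w \<in> W" for w
      using orbit[OF that] C_sub K_sub that by (auto simp: K_def)
    show "fixed_part I (\<Phi> w) \<in> \<Phi> ` W" if "w \<in> W" for w
    proof -
      obtain a b where "\<Phi> w = a + b" "a \<in> D" "b \<in> E" using DE \<open>w \<in> W\<close> by (smt (verit) imageI mem_Collect_eq)
      then have "fixed_part I (\<Phi> w) = a" using coord_subspace_parts[of a I b] D(1) E by auto
      then show ?thesis using D_image \<open>a \<in> D\<close> by blast
    qed
  qed
  then show ?thesis by (rule that)
qed

theorem theorem5p5:
  fixes M :: "('a, 'n::finite) cmfd"
    and G H :: "('a \<Rightarrow> 'a) set"
    and C W :: "'a set"
    and x :: 'a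
    and l :: nat
  assumes "complex_manifold M"
    and "finite G" and "holo_automorphism_group M G"
    and "subgroup H (subgrp M G)"
    and "C \<in> orbit_type_strata M G H"
    and "submanifold_of_codim M C l" and "l \<ge> 1"
    and "x \<in> C" and "linear_slice M G H l x W"
  shows "\<exists>\<zeta>.
    let Y = W \<inter> C;
        MW = open_submfd M W;
        NW = bundle_restrict (normal_bundle M H C) Y;
        V = \<zeta> ` W;
        MV = open_submfd NW V;
        Z = zero_section Y \<inter> V;
        What = formal_completion MW Y;
        Vhat = formal_completion MV Z;
        zhat = completion_map MW Y \<zeta>
    in holo_open_embedding MW NW \<zeta> \<and>
       (\<forall>h\<in>H. \<forall>w\<in>W. \<zeta> (h w) = bundle_action M h (\<zeta> w)) \<and>
       \<zeta> ` Y \<subseteq> zero_section Y \<and>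
       analytic_subset MW Y \<and> analytic_subset MV Z \<and>
       cringed_iso What Vhat zhat \<and>
       (\<forall>h\<in>H. rs_map_eq What Vhat
          (rs_comp What zhat (completion_map MW Y h))
          (rs_comp Vhat (completion_map MV Z (bundle_action M h)) zhat))"
proof -
  obtain \<Phi> \<rho> I where s: "slice M W \<Phi> H \<rho> I C"
    by (rule linear_slice_imp_slice[OF assms(1,2,4,5,8,9)])
  interpret slice M W \<Phi> H \<rho> I C by (rule s)
  show ?thesis
    unfolding Let_def
    by (intro exI[of _ \<zeta>] conjI ballI embedding equivariant analytic_Y analytic_Z iso equivariant_completion)
       (use \<zeta>_zero_section in \<open>auto simp: zero_section_def\<close>)
qed

end
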